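(* Let $(M,p)$ be a projective manifold of dimension $n\ge 2$, with projective cotractor bundle $\mathcal{T}^*$ and tractor connection $\nabla$. The sub-metrics on $\mathcal{T}^*$, compatible with (i.e. parallel for) the tractor connection $\nabla$, are in one-to-one correspondence with the Einstein metrics on $M$ whose Levi-Civita connection is in $p$.
   Context: Manifolds and fields are smooth; metrics are pseudo-Riemannian of arbitrary signature. A projective structure $(M^n,p)$, $n\ge2$, is an equivalence class $p$ of torsion-free affine connections, where $\nabla\sim\widehat\nabla$ iff there is a 1-form $\Upsilon_a$ with $\widehat\nabla_a Y^b=\nabla_aY^b+\Upsilon_aY^b+\Upsilon_cY^c\delta_a^b$ (equivalently $\widehat\nabla_au_b=\nabla_au_b-\Upsilon_au_b-\Upsilon_bu_a$). Curvature: $(\nabla_a\nabla_b-\nabla_b\nabla_a)v^c=R_{ab}{}^c{}_dv^d$, $\mathrm{Ric}_{ab}=R_{ca}{}^c{}_b$, and the projective Schouten tensor $P_{ab}$ is given by $(n-1)P_{ab}=\mathrm{Ric}_{ab}+\beta_{ab}$, where $\beta_{ab}=-2P_{[ab]}$. A metric $g$ is Einstein if $\mathrm{Ric}_{ab}$ is a constant multiple of $g_{ab}$ (zero allowed). Densities: $\mathcal{E}(1)$ is the positive $(2n+2)$-th root of the canonically oriented line bundle $(\Lambda^nTM)^2$, $\mathcal{E}(w)$ is its $w$-th power, and $\mathcal{B}(w)=\mathcal{B}\otimes\mathcal{E}(w)$ for any bundle $\mathcal{B}$; $\mathcal{E}_a=T^*M$. The projective cotractor bundle is $\mathcal{T}^*=\mathcal{E}_A=J^1\mathcal{E}(1)$,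 the first jet prolongation of $\mathcal{E}(1)$, with canonical exact sequence $0\to\mathcal{E}_a(1)\to\mathcal{E}_A\to\mathcal{E}(1)\to0$. Each $\nabla\in p$ induces a connection on $\mathcal{E}(1)$, hence a splitting $\mathcal{E}_A\cong\mathcal{E}_a(1)\oplus\mathcal{E}(1)$, written $U_A=(\mu_a\mid\sigma)$; under change of $\nabla$ by $\Upsilon$ it becomes $(\mu_a+\Upsilon_a\sigma\mid\sigma)$. The tractor connection, independent of the choice of $\nabla\in p$, is $\nabla_a(\mu_b\mid\sigma)=(\nabla_a\mu_b+P_{ab}\sigma\mid\nabla_a\sigma-\mu_a)$. A sub-metric on $\mathcal{T}^*$ is a symmetric bilinear form $h^{AB}$ on $\mathcal{T}^*$ whose restriction to the invariant sub-bundle $\mathcal{E}_a(1)$ is non-degenerate.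
   Formalization: M is assumed connected: on a disconnected M (e.g. a round sphere together with a flat torus) parallel sub-metrics may give different Einstein constants on different components, so no metric with one global constant corresponds to them. *)

theory Defs
  imports "HOL-Analysis.Analysis"
begin

section \<open>Smooth maps between normed spaces\<close>

primrec Ck_on :: "nat \<Rightarrow> 'a::real_normed_vector set \<Rightarrow> ('a \<Rightarrow> 'b::real_normed_vector) \<Rightarrow> bool" where
  "Ck_on 0 S f \<longleftrightarrow> continuous_on S f"
| "Ck_on (Suc k) S f \<longleftrightarrow>
     (\<forall>x\<in>S. f differentiable (at x)) \<and> (\<forall>v. Ck_on k S (\<lambda>x. frechet_derivative f (at x) v))"

text \<open>Only used for open sets.\<close>

definition smooth_on :: "'a::real_normed_vector set \<Rightarrow> ('a \<Rightarrow> 'b::real_normed_vector) \<Rightarrow> bool" where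
  "smooth_on S f \<longleftrightarrow> (\<forall>k. Ck_on k S f)"

definition partial :: "'n::finite \<Rightarrow> (real^'n \<Rightarrow> 'b::real_normed_vector) \<Rightarrow> real^'n \<Rightarrow> 'b" where
  "partial a f y = frechet_derivative f (at y) (axis a 1)"


section \<open>Smooth manifolds\<close>

text \<open>
  The manifold is the whole type \<open>'m\<close> (Hausdorff and second countable by its sort), with a
  smooth atlas that need not be maximal.  A chart is a domain together with a map that is only
  relevant on this domain; the dimension is \<open>CARD('n)\<close>.
\<close>

type_synonym ('m, 'n) chart = "'m set \<times> ('m \<Rightarrow> real^'n)"

definition chart_image :: "('m, 'n) chart \<Rightarrow> (real^'n) set" where
  "chart_image \<phi> = snd \<phi> ` fst \<phi>"

definition chart_inv :: "('m, 'n) chart \<Rightarrow> real^'n \<Rightarrow> 'm" where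
  "chart_inv \<phi> = inv_into (fst \<phi>) (snd \<phi>)"

definition is_chart :: "('m::topological_space, 'n::finite) chart \<Rightarrow> bool" where
  "is_chart \<phi> \<longleftrightarrow> open (fst \<phi>) \<and> open (chart_image \<phi>) \<and>
     homeomorphism (fst \<phi>) (chart_image \<phi>) (snd \<phi>) (chart_inv \<phi>)"

definition transition :: "('m, 'n) chart \<Rightarrow> ('m, 'n) chart \<Rightarrow> real^'n \<Rightarrow> real^'n" where
  "transition \<phi> \<psi> = snd \<psi> \<circ> chart_inv \<phi>"

definition smooth_atlas :: "('m::topological_space, 'n::finite) chart set \<Rightarrow> bool" where
  "smooth_atlas A \<longleftrightarrow> (\<forall>\<phi>\<in>A. is_chart \<phi>) \<and> (\<Union>\<phi>\<in>A. fst \<phi>) = UNIV \<and>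
     (\<forall>\<phi>\<in>A. \<forall>\<psi>\<in>A. smooth_on (snd \<phi> ` (fst \<phi> \<inter> fst \<psi>)) (transition \<phi> \<psi>))"

text \<open>Jacobian matrix of the change of coordinates from \<open>\<phi>\<close> to \<open>\<psi>\<close>, at \<open>y\<close> in the image of \<open>\<phi>\<close>;
  its entry in row \<open>b\<close> and column \<open>a\<close> is the derivative of the \<open>b\<close>-th new coordinate in
  direction \<open>a\<close>.\<close>

abbreviation jac ::
    "('m, 'n::finite) chart \<Rightarrow> ('m, 'n) chart \<Rightarrow> real^'n \<Rightarrow> real^'n^'n" where
  "jac \<phi> \<psi> y \<equiv> jacobian (transition \<phi> \<psi>) (at y)"


section \<open>Fields\<close>

text \<open>
  A field is the family of its coordinate expressions in all charts of the atlas, subject to the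
  transformation law of the bundle in question.  So that equality of fields is equality of
  functions, coordinate expressions are set to zero outside the chart image, and for pairs not in
  the atlas.  A local section over the domain of a single chart is just a smooth function on the
  chart image.
\<close>

definition zero_outside ::
    "('m, 'n) chart set \<Rightarrow> 'v \<Rightarrow> (('m, 'n) chart \<Rightarrow> real^'n \<Rightarrow> 'v) \<Rightarrow> bool" where
  "zero_outside A z s \<longleftrightarrow> (\<forall>\<phi> y. \<not> (\<phi> \<in> A \<and> y \<in> chart_image \<phi>) \<longrightarrow> s \<phi> y = z)"

definition smooth_field ::
    "('m, 'n::finite) chart set \<Rightarrow> (('m, 'n) chart \<Rightarrow> real^'n \<Rightarrow> 'v::real_normed_vector) \<Rightarrow> bool" where
  "smooth_field A s \<longleftrightarrow> zero_outside A 0 s \<and> (\<forall>\<phi>\<in>A. smooth_on (chart_image \<phi>) (s \<phi>))"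

definition one_form ::
    "('m, 'n::finite) chart set \<Rightarrow> (('m, 'n) chart \<Rightarrow> real^'n \<Rightarrow> real^'n) \<Rightarrow> bool" where
  "one_form A \<Upsilon> \<longleftrightarrow> smooth_field A \<Upsilon> \<and>
     (\<forall>\<phi>\<in>A. \<forall>\<psi>\<in>A. \<forall>x\<in>fst \<phi> \<inter> fst \<psi>.
        \<Upsilon> \<phi> (snd \<phi> x) = transpose (jac \<phi> \<psi> (snd \<phi> x)) *v \<Upsilon> \<psi> (snd \<psi> x))"

definition pseudo_metric ::
    "('m, 'n::finite) chart set \<Rightarrow> (('m, 'n) chart \<Rightarrow> real^'n \<Rightarrow> real^'n^'n) \<Rightarrow> bool" where
  "pseudo_metric A g \<longleftrightarrow> smooth_field A g \<and>
     (\<forall>\<phi>\<in>A. \<forall>y\<in>chart_image \<phi>. transpose (g \<phi> y) = g \<phi> y \<and> invertible (g \<phi> y)) \<and>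
     (\<forall>\<phi>\<in>A. \<forall>\<psi>\<in>A. \<forall>x\<in>fst \<phi> \<inter> fst \<psi>.
        g \<phi> (snd \<phi> x) =
          transpose (jac \<phi> \<psi> (snd \<phi> x)) ** g \<psi> (snd \<psi> x) ** jac \<phi> \<psi> (snd \<phi> x))"

definition push_vector ::
    "('m, 'n::finite) chart \<Rightarrow> ('m, 'n) chart \<Rightarrow> (real^'n \<Rightarrow> real^'n) \<Rightarrow> real^'n \<Rightarrow> real^'n" where
  "push_vector \<phi> \<psi> Y z = (let y = transition \<psi> \<phi> z in jac \<phi> \<psi> y *v Y y)"

text \<open>
  Sections of \<open>\<E>(w)\<close>.  In a chart, \<open>(\<partial>\<^sub>1 \<and> \<dots> \<and> \<partial>\<^sub>n)\<^sup>2\<close> is a positive section of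
  \<open>(\<Lambda>\<^sup>nTM)\<^sup>2\<close>, and the \<open>w\<close>-th power of its positive \<open>(2n+2)\<close>-th root trivialises \<open>\<E>(w)\<close>.
  Coordinate expressions in this trivialisation change by
  \<open>((det J)\<^sup>2)\<close> to the power \<open>w / (2n+2)\<close>, i.e. \<open>\<bar>det J\<bar>\<close> to the power \<open>w / (n+1)\<close>.
\<close>

definition push_density ::
    "real \<Rightarrow> ('m, 'n::finite) chart \<Rightarrow> ('m, 'n) chart \<Rightarrow> (real^'n \<Rightarrow> real) \<Rightarrow> real^'n \<Rightarrow> real" where
  "push_density w \<phi> \<psi> \<sigma> z =
     (let y = transition \<psi> \<phi> z
      in \<bar>det (jac \<phi> \<psi> y)\<bar> powr (w / (real CARD('n) + 1)) * \<sigma> y)"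


section \<open>Affine connections in coordinates\<close>

text \<open>
  In a chart, a connection is given by its Christoffel symbols: \<open>\<Gamma> y $ a $ b $ c\<close> is
  \<open>\<Gamma>\<^sub>a\<^sup>b\<^sub>c\<close>, the \<open>b\<close>-component of \<open>\<nabla>\<^sub>a \<partial>\<^sub>c\<close>.  In all covariant derivatives
  below, the differentiation index \<open>a\<close> comes first.
\<close>

type_synonym 'n christoffel = "real^'n \<Rightarrow> real^'n^'n^'n"

definition nabla_vec ::
    "('n::finite) christoffel \<Rightarrow> (real^'n \<Rightarrow> real^'n) \<Rightarrow> real^'n \<Rightarrow> real^'n^'n" where
  "nabla_vec \<Gamma> Y y = (\<chi> a b. partial a Y y $ b + (\<Sum>c\<in>UNIV. \<Gamma> y $ a $ b $ c * Y y $ c))"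

text \<open>\<open>T y $ b $ c\<close> is \<open>T\<^sub>b\<^sup>c\<close>.\<close>

definition nabla_endo ::
    "('n::finite) christoffel \<Rightarrow> (real^'n \<Rightarrow> real^'n^'n) \<Rightarrow> real^'n \<Rightarrow> real^'n^'n^'n" where
  "nabla_endo \<Gamma> T y = (\<chi> a b c. partial a T y $ b $ c
     - (\<Sum>e\<in>UNIV. \<Gamma> y $ a $ e $ b * T y $ e $ c)
     + (\<Sum>e\<in>UNIV. \<Gamma> y $ a $ c $ e * T y $ b $ e))"

definition nabla_metric ::
    "('n::finite) christoffel \<Rightarrow> (real^'n \<Rightarrow> real^'n^'n) \<Rightarrow> real^'n \<Rightarrow> real^'n^'n^'n" where
  "nabla_metric \<Gamma> g y = (\<chi> a b c. partial a g y $ b $ c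
     - (\<Sum>e\<in>UNIV. \<Gamma> y $ a $ e $ b * g y $ e $ c)
     - (\<Sum>e\<in>UNIV. \<Gamma> y $ a $ e $ c * g y $ b $ e))"

text \<open>
  On \<open>\<Lambda>\<^sup>nTM\<close> the induced connection acts by \<open>\<partial>\<^sub>a + \<Gamma>\<^sub>a\<^sup>c\<^sub>c\<close>, hence on \<open>\<E>(w)\<close>, which is locally
  its power with exponent \<open>w / (n+1)\<close>, by \<open>\<partial>\<^sub>a + density_symbol w \<Gamma>\<close>.
\<close>

definition density_symbol :: "real \<Rightarrow> ('n::finite) christoffel \<Rightarrow> real^'n \<Rightarrow> real^'n" where
  "density_symbol w \<Gamma> y = (\<chi> a. w / (real CARD('n) + 1) * (\<Sum>c\<in>UNIV. \<Gamma> y $ a $ c $ c))"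

definition nabla_density ::
    "real \<Rightarrow> ('n::finite) christoffel \<Rightarrow> (real^'n \<Rightarrow> real) \<Rightarrow> real^'n \<Rightarrow> real^'n" where
  "nabla_density w \<Gamma> \<sigma> y = (\<chi> a. partial a \<sigma> y + density_symbol w \<Gamma> y $ a * \<sigma> y)"

text \<open>The induced connection on \<open>\<E>\<^sub>b(w)\<close>.\<close>

definition nabla_form ::
    "real \<Rightarrow> ('n::finite) christoffel \<Rightarrow> (real^'n \<Rightarrow> real^'n) \<Rightarrow> real^'n \<Rightarrow> real^'n^'n" where
  "nabla_form w \<Gamma> \<mu> y = (\<chi> a b. partial a \<mu> y $ b
     - (\<Sum>c\<in>UNIV. \<Gamma> y $ a $ c $ b * \<mu> y $ c)
     + density_symbol w \<Gamma> y $ a * \<mu> y $ b)"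

text \<open>
  \<open>curvature \<Gamma> y $ a $ b $ c $ d\<close> is \<open>R\<^sub>a\<^sub>b\<^sup>c\<^sub>d\<close>, obtained by applying
  \<open>\<nabla>\<^sub>a\<nabla>\<^sub>b - \<nabla>\<^sub>b\<nabla>\<^sub>a\<close> to the coordinate vector field \<open>\<partial>\<^sub>d\<close> (\<open>\<Gamma>\<close> torsion-free).
\<close>

definition curvature :: "('n::finite) christoffel \<Rightarrow> real^'n \<Rightarrow> real^'n^'n^'n^'n" where
  "curvature \<Gamma> y = (\<chi> a b c d.
     nabla_endo \<Gamma> (nabla_vec \<Gamma> (\<lambda>_. axis d 1)) y $ a $ b $ c
     - nabla_endo \<Gamma> (nabla_vec \<Gamma> (\<lambda>_. axis d 1)) y $ b $ a $ c)"

definition ricci :: "('n::finite) christoffel \<Rightarrow> real^'n \<Rightarrow> real^'n^'n" where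
  "ricci \<Gamma> y = (\<chi> a b. \<Sum>c\<in>UNIV. curvature \<Gamma> y $ c $ a $ c $ b)"

text \<open>\<open>(n - 1) P\<^sub>a\<^sub>b = Ric\<^sub>a\<^sub>b + \<beta>\<^sub>a\<^sub>b\<close> with
  \<open>\<beta>\<^sub>a\<^sub>b = - 2 P\<^bsub>[ab]\<^esub> = P\<^sub>b\<^sub>a - P\<^sub>a\<^sub>b\<close>; this determines \<open>P\<close> if \<open>n \<ge> 2\<close>.\<close>

definition schouten :: "('n::finite) christoffel \<Rightarrow> real^'n \<Rightarrow> real^'n^'n" where
  "schouten \<Gamma> y = (THE P. \<forall>a b.
     (real CARD('n) - 1) * P $ a $ b = ricci \<Gamma> y $ a $ b + (P $ b $ a - P $ a $ b))"

lemma schouten_explicit: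
  fixes \<Gamma> :: "('n::finite) christoffel"
  assumes "2 \<le> CARD('n)"
  shows "schouten \<Gamma> y = (\<chi> a b. (real CARD('n) * ricci \<Gamma> y $ a $ b + ricci \<Gamma> y $ b $ a)
           / ((real CARD('n))\<^sup>2 - 1))"
proof -
  define n where "n = real CARD('n)"
  have n: "n \<ge> 2" using assms by (simp add: n_def)
  have "1 < n\<^sup>2" using n by (simp add: one_less_power)
  then have n2: "n\<^sup>2 - 1 \<noteq> 0" by simp
  show ?thesis
    unfolding schouten_def n_def[symmetric]
  proof (rule the_equality, intro allI)
    fix a b
    let ?r = "ricci \<Gamma> y $ a $ b" and ?s = "ricci \<Gamma> y $ b $ a"
    have "n * ((n * ?r + ?s) / (n\<^sup>2 - 1)) - (n * ?s + ?r) / (n\<^sup>2 - 1)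
        = (n * (n * ?r + ?s) - (n * ?s + ?r)) / (n\<^sup>2 - 1)"
      by (simp only: times_divide_eq_right diff_divide_distrib)
    also have "n * (n * ?r + ?s) - (n * ?s + ?r) = (n\<^sup>2 - 1) * ?r"
      by (simp add: algebra_simps power2_eq_square)
    also have "(n\<^sup>2 - 1) * ?r / (n\<^sup>2 - 1) = ?r"
      using n2 by (rule nonzero_mult_div_cancel_left)
    finally have "n * ((n * ?r + ?s) / (n\<^sup>2 - 1)) = ?r + (n * ?s + ?r) / (n\<^sup>2 - 1)"
      by linarith
    then show "(n - 1) * (\<chi> a b. (n * ricci \<Gamma> y $ a $ b + ricci \<Gamma> y $ b $ a) / (n\<^sup>2 - 1)) $ a $ b =
      ricci \<Gamma> y $ a $ b +
      ((\<chi> a b. (n * ricci \<Gamma> y $ a $ b + ricci \<Gamma> y $ b $ a) / (n\<^sup>2 - 1)) $ b $ a -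
       (\<chi> a b. (n * ricci \<Gamma> y $ a $ b + ricci \<Gamma> y $ b $ a) / (n\<^sup>2 - 1)) $ a $ b)"
      by (simp only: vec_lambda_beta left_diff_distrib mult_1)
  next
    fix P :: "real^'n^'n"
    assume P: "\<forall>a b. (n - 1) * P $ a $ b = ricci \<Gamma> y $ a $ b + (P $ b $ a - P $ a $ b)"
    have "P $ a $ b = (n * ricci \<Gamma> y $ a $ b + ricci \<Gamma> y $ b $ a) / (n\<^sup>2 - 1)" for a b
    proof -
      have 1: "ricci \<Gamma> y $ a $ b = n * P $ a $ b - P $ b $ a"
        and 2: "ricci \<Gamma> y $ b $ a = n * P $ b $ a - P $ a $ b"
        using P[rule_format, of a b] P[rule_format, of b a] by (simp_all add: algebra_simps)
      have "n * ricci \<Gamma> y $ a $ b + ricci \<Gamma> y $ b $ a = (n\<^sup>2 - 1) * P $ a $ b"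
        unfolding 1 2 by (simp add: algebra_simps power2_eq_square)
      then show ?thesis using n2 by simp
    qed
    then show "P = (\<chi> a b. (n * ricci \<Gamma> y $ a $ b + ricci \<Gamma> y $ b $ a) / (n\<^sup>2 - 1))"
      by (simp add: vec_eq_iff)
  qed
qed


section \<open>Connections on manifolds and projective structures\<close>

text \<open>A family of Christoffel symbols is an affine connection iff it maps vector fields to
  tensor fields of type (1,1).\<close>

definition affine_connection ::
    "('m, 'n::finite) chart set \<Rightarrow> (('m, 'n) chart \<Rightarrow> 'n christoffel) \<Rightarrow> bool" where
  "affine_connection A D \<longleftrightarrow> smooth_field A D \<and>
     (\<forall>\<phi>\<in>A. \<forall>\<psi>\<in>A. \<forall>Y. smooth_on (snd \<phi> ` (fst \<phi> \<inter> fst \<psi>)) Y \<longrightarrow>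
        (\<forall>x\<in>fst \<phi> \<inter> fst \<psi>.
           nabla_vec (D \<phi>) Y (snd \<phi> x) ** transpose (jac \<phi> \<psi> (snd \<phi> x)) =
           transpose (jac \<phi> \<psi> (snd \<phi> x)) ** nabla_vec (D \<psi>) (push_vector \<phi> \<psi> Y) (snd \<psi> x)))"

definition torsion_free_connection ::
    "('m, 'n::finite) chart set \<Rightarrow> (('m, 'n) chart \<Rightarrow> 'n christoffel) \<Rightarrow> bool" where
  "torsion_free_connection A D \<longleftrightarrow> affine_connection A D \<and>
     (\<forall>\<phi>\<in>A. \<forall>y\<in>chart_image \<phi>. \<forall>a b c. D \<phi> y $ a $ b $ c = D \<phi> y $ c $ b $ a)"

definition projectively_related ::
    "('m, 'n::finite) chart set \<Rightarrow>
     ((('m, 'n) chart \<Rightarrow> 'n christoffel) \<times> (('m, 'n) chart \<Rightarrow> 'n christoffel)) set" where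
  "projectively_related A = {(D, D').
     torsion_free_connection A D \<and> torsion_free_connection A D' \<and>
     (\<exists>\<Upsilon>. one_form A \<Upsilon> \<and>
       (\<forall>\<phi>\<in>A. \<forall>Y. smooth_on (chart_image \<phi>) Y \<longrightarrow> (\<forall>y\<in>chart_image \<phi>. \<forall>a b.
          nabla_vec (D' \<phi>) Y y $ a $ b = nabla_vec (D \<phi>) Y y $ a $ b
            + \<Upsilon> \<phi> y $ a * Y y $ b
            + (\<Sum>c\<in>UNIV. \<Upsilon> \<phi> y $ c * Y y $ c) * (if a = b then 1 else 0))))}"

definition projective_structure ::
    "('m, 'n::finite) chart set \<Rightarrow> (('m, 'n) chart \<Rightarrow> 'n christoffel) set \<Rightarrow> bool" where
  "projective_structure A p \<longleftrightarrow>
     p \<in> {D. torsion_free_connection A D} // projectively_related A"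

definition levi_civita ::
    "('m, 'n::finite) chart set \<Rightarrow> (('m, 'n) chart \<Rightarrow> real^'n \<Rightarrow> real^'n^'n) \<Rightarrow>
     (('m, 'n) chart \<Rightarrow> 'n christoffel) \<Rightarrow> bool" where
  "levi_civita A g D \<longleftrightarrow> torsion_free_connection A D \<and>
     (\<forall>\<phi>\<in>A. \<forall>y\<in>chart_image \<phi>. nabla_metric (D \<phi>) (g \<phi>) y = 0)"

definition einstein_metric ::
    "('m, 'n::finite) chart set \<Rightarrow> (('m, 'n) chart \<Rightarrow> real^'n \<Rightarrow> real^'n^'n) \<Rightarrow> bool" where
  "einstein_metric A g \<longleftrightarrow> pseudo_metric A g \<and>
     (\<exists>D k. levi_civita A g D \<and>
        (\<forall>\<phi>\<in>A. \<forall>y\<in>chart_image \<phi>. ricci (D \<phi>) y = k *\<^sub>R g \<phi> y))"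


section \<open>Cotractors\<close>

text \<open>
  The cotractor bundle is \<open>J\<^sup>1\<E>(1)\<close>.  In a chart, the 1-jet at \<open>y\<close> of a section of \<open>\<E>(1)\<close> is
  represented by its gradient and its value; the pairs \<open>(m, 0)\<close> form the sub-bundle \<open>\<E>\<^sub>a(1)\<close>.
\<close>

type_synonym 'n cotractor = "(real^'n) \<times> real"

definition jet1 :: "(real^'n::finite \<Rightarrow> real) \<Rightarrow> real^'n \<Rightarrow> 'n cotractor" where
  "jet1 \<sigma> y = (\<chi> a. partial a \<sigma> y, \<sigma> y)"

text \<open>The isomorphism of \<open>J\<^sup>1\<E>(1)\<close> with \<open>\<E>\<^sub>a(1) \<oplus> \<E>(1)\<close> determined by a connection,
  \<open>j\<^sup>1\<sigma> \<mapsto> (\<nabla>\<^sub>a\<sigma> | \<sigma>)\<close>, and its inverse.\<close>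

definition to_splitting ::
    "('n::finite) christoffel \<Rightarrow> real^'n \<Rightarrow> 'n cotractor \<Rightarrow> 'n cotractor" where
  "to_splitting \<Gamma> y U = (fst U + snd U *\<^sub>R density_symbol 1 \<Gamma> y, snd U)"

definition of_splitting ::
    "('n::finite) christoffel \<Rightarrow> real^'n \<Rightarrow> 'n cotractor \<Rightarrow> 'n cotractor" where
  "of_splitting \<Gamma> y U = (fst U - snd U *\<^sub>R density_symbol 1 \<Gamma> y, snd U)"

lemma to_splitting_jet1: "to_splitting \<Gamma> y (jet1 \<sigma> y) = (nabla_density 1 \<Gamma> \<sigma> y, \<sigma> y)"
  by (simp add: to_splitting_def jet1_def nabla_density_def vec_eq_iff)

lemma of_to_splitting [simp]: "of_splitting \<Gamma> y (to_splitting \<Gamma> y U) = U"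
  and to_of_splitting [simp]: "to_splitting \<Gamma> y (of_splitting \<Gamma> y U) = U"
  by (simp_all add: to_splitting_def of_splitting_def)

text \<open>\<open>\<nabla>\<^sub>a(\<mu>\<^sub>b | \<sigma>) = (\<nabla>\<^sub>a\<mu>\<^sub>b + P\<^sub>a\<^sub>b\<sigma> | \<nabla>\<^sub>a\<sigma> - \<mu>\<^sub>a)\<close>, for a section \<open>U\<close> of \<open>J\<^sup>1\<E>(1)\<close>.\<close>

definition tractor_nabla ::
    "('n::finite) christoffel \<Rightarrow> 'n \<Rightarrow> (real^'n \<Rightarrow> 'n cotractor) \<Rightarrow> real^'n \<Rightarrow> 'n cotractor" where
  "tractor_nabla \<Gamma> a U y =
     (let \<mu> = (\<lambda>z. fst (to_splitting \<Gamma> z (U z)));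
          \<sigma> = (\<lambda>z. snd (to_splitting \<Gamma> z (U z)))
      in of_splitting \<Gamma> y
           (\<chi> b. nabla_form 1 \<Gamma> \<mu> y $ a $ b + schouten \<Gamma> y $ a $ b * \<sigma> y,
            nabla_density 1 \<Gamma> \<sigma> y $ a - \<mu> y $ a))"

type_synonym ('m, 'n) cotractor_form =
  "('m, 'n) chart \<Rightarrow> real^'n \<Rightarrow> 'n cotractor \<Rightarrow> 'n cotractor \<Rightarrow> real"

text \<open>The transformation law says that the value of the form on the 1-jets of two local sections
  of \<open>\<E>(1)\<close> does not depend on the chart.\<close>

definition symmetric_cotractor_form ::
    "('m, 'n::finite) chart set \<Rightarrow> ('m, 'n) cotractor_form \<Rightarrow> bool" where
  "symmetric_cotractor_form A h \<longleftrightarrow> zero_outside A (\<lambda>_ _. 0) h \<and>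
     (\<forall>\<phi>\<in>A. \<forall>U V. smooth_on (chart_image \<phi>) (\<lambda>y. h \<phi> y U V)) \<and>
     (\<forall>\<phi>\<in>A. \<forall>y\<in>chart_image \<phi>. bilinear (h \<phi> y) \<and> (\<forall>U V. h \<phi> y U V = h \<phi> y V U)) \<and>
     (\<forall>\<phi>\<in>A. \<forall>\<psi>\<in>A. \<forall>\<sigma> \<tau>.
        smooth_on (snd \<phi> ` (fst \<phi> \<inter> fst \<psi>)) \<sigma> \<longrightarrow> smooth_on (snd \<phi> ` (fst \<phi> \<inter> fst \<psi>)) \<tau> \<longrightarrow>
        (\<forall>x\<in>fst \<phi> \<inter> fst \<psi>.
           h \<psi> (snd \<psi> x) (jet1 (push_density 1 \<phi> \<psi> \<sigma>) (snd \<psi> x))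
                         (jet1 (push_density 1 \<phi> \<psi> \<tau>) (snd \<psi> x)) =
           h \<phi> (snd \<phi> x) (jet1 \<sigma> (snd \<phi> x)) (jet1 \<tau> (snd \<phi> x))))"

definition sub_metric :: "('m, 'n::finite) chart set \<Rightarrow> ('m, 'n) cotractor_form \<Rightarrow> bool" where
  "sub_metric A h \<longleftrightarrow> symmetric_cotractor_form A h \<and>
     (\<forall>\<phi>\<in>A. \<forall>y\<in>chart_image \<phi>. \<forall>\<mu>. (\<forall>\<nu>. h \<phi> y (\<mu>, 0) (\<nu>, 0) = 0) \<longrightarrow> \<mu> = 0)"

text \<open>The tractor connection does not depend on the choice of the connection in \<open>p\<close>.\<close>

definition tractor_parallel ::
    "('m, 'n::finite) chart set \<Rightarrow> (('m, 'n) chart \<Rightarrow> 'n christoffel) set \<Rightarrow>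
     ('m, 'n) cotractor_form \<Rightarrow> bool" where
  "tractor_parallel A p h \<longleftrightarrow>
     (\<forall>D\<in>p. \<forall>\<phi>\<in>A. \<forall>U V. smooth_on (chart_image \<phi>) U \<longrightarrow> smooth_on (chart_image \<phi>) V \<longrightarrow>
        (\<forall>y\<in>chart_image \<phi>. \<forall>a.
           partial a (\<lambda>z. h \<phi> z (U z) (V z)) y =
             h \<phi> y (tractor_nabla (D \<phi>) a U y) (V y) +
             h \<phi> y (U y) (tractor_nabla (D \<phi>) a V y)))"


section \<open>From sub-metrics to metrics\<close>

text \<open>
  The restriction of \<open>h\<close> to \<open>\<E>\<^sub>a(1)\<close> is a section \<open>\<zeta>\<^sup>a\<^sup>b\<close> of \<open>S\<^sup>2TM(-2)\<close>.  Its determinant is a section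
  of \<open>(\<Lambda>\<^sup>nTM)\<^sup>2(-2n) = \<E>(2)\<close>, so \<open>\<bar>det \<zeta>\<bar> \<zeta>\<^sup>a\<^sup>b\<close> has weight zero: it is the inverse of the
  metric associated with \<open>h\<close>.
\<close>

definition submetric_coeffs :: "('n::finite cotractor \<Rightarrow> 'n cotractor \<Rightarrow> real) \<Rightarrow> real^'n^'n" where
  "submetric_coeffs H = (\<chi> a b. H (axis a 1, 0) (axis b 1, 0))"

definition metric_of_submetric ::
    "('m, 'n::finite) chart set \<Rightarrow> ('m, 'n) cotractor_form \<Rightarrow>
     ('m, 'n) chart \<Rightarrow> real^'n \<Rightarrow> real^'n^'n" where
  "metric_of_submetric A h \<phi> y =
     (if \<phi> \<in> A \<and> y \<in> chart_image \<phi>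
      then matrix_inv (let \<zeta> = submetric_coeffs (h \<phi> y) in \<bar>det \<zeta>\<bar> *\<^sub>R \<zeta>)
      else 0)"

end

theory Submission
  imports Defs
begin

text \<open>
  In the splitting of \<open>\<nabla> \<in> p\<close>, write a sub-metric as \<open>\<zeta>\<^sup>a\<^sup>b\<mu>\<^sub>a\<nu>\<^sub>b + \<lambda>\<^sup>b(\<mu>\<^sub>b\<rho> + \<nu>\<^sub>b\<sigma>) + \<tau>\<sigma>\<rho>\<close>.  Changing \<open>\<nabla>\<close> by
  \<open>\<Upsilon>\<close> replaces \<open>\<lambda>\<^sup>b\<close> by \<open>\<lambda>\<^sup>b - \<zeta>\<^sup>a\<^sup>b\<Upsilon>\<^sub>a\<close>, so there is a unique \<open>\<nabla> \<in> p\<close> with \<open>\<lambda> = 0\<close>.  For this \<open>\<nabla>\<close> the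
  sub-metric is parallel iff \<open>\<nabla>\<^sub>c\<zeta>\<^sup>a\<^sup>b = 0\<close>, \<open>\<zeta>\<^sup>a\<^sup>bP\<^sub>c\<^sub>a = \<tau>\<delta>\<^sub>c\<^sup>b\<close> and \<open>\<nabla>\<^sub>c\<tau> = 0\<close>.  The first equation says that
  \<open>\<nabla>\<close> is the Levi-Civita connection of the metric with inverse \<open>\<bar>det \<zeta>\<bar> \<zeta>\<^sup>a\<^sup>b\<close>, the second one that
  \<open>P\<^sub>a\<^sub>b = \<tau> \<bar>det \<zeta>\<bar> g\<^sub>a\<^sub>b\<close>, hence \<open>Ric\<^sub>a\<^sub>b = (n - 1) \<tau> \<bar>det \<zeta>\<bar> g\<^sub>a\<^sub>b\<close>, and the third one that this factor is
  locally constant.  Conversely \<open>g\<close> determines \<open>\<nabla>\<close> and \<open>\<zeta>\<close>, and then \<open>\<tau>\<close> by the second equation; as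
  the tractor connection does not depend on \<open>\<nabla> \<in> p\<close>, it suffices to check the three equations for
  the Levi-Civita connection of an Einstein metric.
\<close>

section \<open>Calculus of smooth maps\<close>

text \<open>In a chart a cotractor is the gradient and value of a 1-jet, so a complement of the
  sub-bundle is spanned by some \<open>(- v, 1)\<close>, and the splitting of a connection is the
  case where \<open>v\<close> is its \<open>density_symbol\<close>. Being adapted to a form thus
  constrains only the traces of the Christoffel symbols, and these move by exactly \<Upsilon> inside
  \<open>p\<close>. The adapted connection is global because the vector \<theta> of the orthogonal
  complement has the same inhomogeneous change of charts as a density symbol, so that their
  difference is a 1-form.

  The other obstacle is weight. In \<nabla>\<zeta> = 0 the density part 2\<delta> appears next to
  Christoffel symbols of trace (n + 1)\<delta>; hence the logarithmic derivative of det \<zeta> is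
  2n\<delta> - 2(n + 1)\<delta> = -2\<delta>, and multiplying by |det \<zeta>| removes the weight.
  The same count makes the derivative of \<tau>|det \<zeta>| vanish, and connectedness of M turns
  this locally constant function into one constant.

  For injectivity, \<zeta> and \<tau> are written as expressions in g and its Levi-Civita
  connection, so that two forms with equal metrics agree.\<close>

lemma Ck_on_cong:
  assumes "open S" "\<And>x. x \<in> S \<Longrightarrow> f x = g x" "Ck_on k S f"
  shows "Ck_on k S g"
  using assms(2,3)
proof (induction k arbitrary: f g)
  case 0
  then show ?case by (simp cong: continuous_on_cong)
next
  case (Suc k)
  have d: "(g has_derivative frechet_derivative f (at x)) (at x)" if "x \<in> S" for x
  proof (rule has_derivative_transform_within_open[OF _ assms(1) that])
    show "(f has_derivative frechet_derivative f (at x)) (at x)"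
      using Suc.prems(2) that by (simp add: frechet_derivative_works)
  qed (use Suc.prems in auto)
  have e: "frechet_derivative g (at x) = frechet_derivative f (at x)" if "x \<in> S" for x
    using frechet_derivative_at[OF d[OF that]] by simp
  have "Ck_on k S (\<lambda>x. frechet_derivative g (at x) v)" for v
    by (rule Suc.IH[of "\<lambda>x. frechet_derivative f (at x) v"]) (use Suc.prems e in auto)
  moreover have "\<forall>x\<in>S. g differentiable (at x)"
    using d unfolding differentiable_def by blast
  ultimately show ?case by simp
qed

text \<open>Trades the chosen \<open>frechet_derivative\<close> for an explicit one; each closure
  property below then becomes an induction on \<open>k\<close> whose step is a differentiation
  rule.\<close>

lemma Ck_on_SucI:
  assumes "open S" "\<And>x. x \<in> S \<Longrightarrow> (f has_derivative f' x) (at x)"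
    and "\<And>v. Ck_on k S (\<lambda>x. f' x v)"
  shows "Ck_on (Suc k) S f"
proof -
  have e: "frechet_derivative f (at x) = f' x" if "x \<in> S" for x
    using frechet_derivative_at[OF assms(2)[OF that]] by simp
  have "Ck_on k S (\<lambda>x. frechet_derivative f (at x) v)" for v
    by (rule Ck_on_cong[OF assms(1) _ assms(3)]) (use e in auto)
  then show ?thesis using assms(2) by (auto simp: differentiable_def)
qed

lemma Ck_on_Suc_has_derivative:
  assumes "Ck_on (Suc k) S f" "x \<in> S"
  shows "(f has_derivative frechet_derivative f (at x)) (at x)"
  using assms by (simp add: frechet_derivative_works)

text \<open>Serves the product rule, whose summands keep one factor undifferentiated and so ask for
  that factor one order lower.\<close>

lemma Ck_on_SucD: "Ck_on (Suc k) S f \<Longrightarrow> Ck_on k S f"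
proof (induction k arbitrary: f)
  case 0
  then show ?case
    by (simp add: continuous_on_eq_continuous_within differentiable_at_withinI
        differentiable_imp_continuous_within)
next
  case (Suc k)
  have "Ck_on k S (\<lambda>x. frechet_derivative f (at x) v)" for v
    by (rule Suc.IH) (use Suc.prems in simp)
  then show ?case using Suc.prems by simp
qed

lemma Ck_on_const: "Ck_on k S (\<lambda>x. c)"
  by (induction k arbitrary: c) (simp_all add: frechet_derivative_const)

lemma Ck_on_bounded_linear:
  assumes "open S" "bounded_linear L" "Ck_on k S f"
  shows "Ck_on k S (\<lambda>x. L (f x))"
  using assms(3)
proof (induction k arbitrary: f)
  case 0
  then show ?case using assms(2) by (simp add: bounded_linear.continuous_on)
next
  case (Suc k)
  show ?case
  proof (rule Ck_on_SucI[OF assms(1)])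
    show "((\<lambda>x. L (f x)) has_derivative (\<lambda>v. L (frechet_derivative f (at x) v))) (at x)"
      if "x \<in> S" for x
      by (rule bounded_linear.has_derivative[OF assms(2) Ck_on_Suc_has_derivative[OF Suc.prems that]])
    show "Ck_on k S (\<lambda>x. L (frechet_derivative f (at x) v))" for v
      by (rule Suc.IH) (use Suc.prems in simp)
  qed
qed

lemma Ck_on_add:
  assumes "open S" "Ck_on k S f" "Ck_on k S g"
  shows "Ck_on k S (\<lambda>x. f x + g x)"
  using assms(2,3)
proof (induction k arbitrary: f g)
  case 0
  then show ?case by (simp add: continuous_on_add)
next
  case (Suc k)
  show ?case
  proof (rule Ck_on_SucI[OF assms(1)])
    show "((\<lambda>x. f x + g x) has_derivative
        (\<lambda>v. frechet_derivative f (at x) v + frechet_derivative g (at x) v)) (at x)"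
      if "x \<in> S" for x
      by (intro has_derivative_add Ck_on_Suc_has_derivative[OF Suc.prems(1) that]
          Ck_on_Suc_has_derivative[OF Suc.prems(2) that])
    show "Ck_on k S (\<lambda>x. frechet_derivative f (at x) v + frechet_derivative g (at x) v)" for v
      by (rule Suc.IH) (use Suc.prems in simp_all)
  qed
qed

lemma Ck_on_bilinear:
  assumes "open S" "bounded_bilinear B" "Ck_on k S f" "Ck_on k S g"
  shows "Ck_on k S (\<lambda>x. B (f x) (g x))"
  using assms(3,4)
proof (induction k arbitrary: f g)
  case 0
  then show ?case using assms(2) by (simp add: bounded_bilinear.continuous_on)
next
  case (Suc k)
  show ?case
  proof (rule Ck_on_SucI[OF assms(1)])
    show "((\<lambda>x. B (f x) (g x)) has_derivative
        (\<lambda>v. B (f x) (frechet_derivative g (at x) v) + B (frechet_derivative f (at x) v) (g x))) (at x)"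
      if "x \<in> S" for x
      by (rule bounded_bilinear.FDERIV[OF assms(2) Ck_on_Suc_has_derivative[OF Suc.prems(1) that]
          Ck_on_Suc_has_derivative[OF Suc.prems(2) that]])
    show "Ck_on k S (\<lambda>x. B (f x) (frechet_derivative g (at x) v)
        + B (frechet_derivative f (at x) v) (g x))" for v
      by (intro Ck_on_add[OF assms(1)] Suc.IH Ck_on_SucD[OF Suc.prems(1)] Ck_on_SucD[OF Suc.prems(2)])
        (use Suc.prems in simp_all)
  qed
qed

text \<open>Differentiation lowers the exponent by one, which is why the induction keeps
  \<open>r\<close> arbitrary.\<close>

lemma Ck_on_powr:
  fixes f :: "'a::real_normed_vector \<Rightarrow> real"
  assumes "open S" "\<And>x. x \<in> S \<Longrightarrow> 0 < f x" "Ck_on k S f"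
  shows "Ck_on k S (\<lambda>x. f x powr r)"
  using assms(3)
proof (induction k arbitrary: r)
  case 0
  then show ?case using assms(2) by (force intro!: continuous_intros)
next
  case (Suc k)
  show ?case
  proof (rule Ck_on_SucI[OF assms(1)])
    show "((\<lambda>x. f x powr r) has_derivative
        (\<lambda>v. r * (f x powr (r - 1) * frechet_derivative f (at x) v))) (at x)"
      if "x \<in> S" for x
    proof -
      note p = assms(2)[OF that]
      have "((\<lambda>x. f x powr r) has_derivative (\<lambda>v. f x powr r * (0 * ln (f x) +
          frechet_derivative f (at x) v * r / f x))) (at x)"
        by (rule has_derivative_powr[OF Ck_on_Suc_has_derivative[OF Suc.prems that]
            has_derivative_const p]) simp
      moreover have "f x powr r * (0 * ln (f x) + frechet_derivative f (at x) v * r / f x)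
          = r * (f x powr (r - 1) * frechet_derivative f (at x) v)" for v
        using p by (simp add: powr_diff)
      ultimately show ?thesis by simp
    qed
    show "Ck_on k S (\<lambda>x. r * (f x powr (r - 1) * frechet_derivative f (at x) v))" for v
      by (intro Ck_on_bilinear[OF assms(1) bounded_bilinear_mult] Ck_on_const Suc.IH
          Ck_on_SucD[OF Suc.prems]) (use Suc.prems in simp)
  qed
qed

lemma smooth_on_cong:
  assumes "open S" "\<And>x. x \<in> S \<Longrightarrow> f x = g x" "smooth_on S f"
  shows "smooth_on S g"
  using assms(3) Ck_on_cong[of S f g, OF assms(1,2)] unfolding smooth_on_def by blast

lemma smooth_on_const: "smooth_on S (\<lambda>x. c)"
  unfolding smooth_on_def by (simp add: Ck_on_const)

lemma smooth_on_bounded_linear: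
  "open S \<Longrightarrow> bounded_linear L \<Longrightarrow> smooth_on S f \<Longrightarrow> smooth_on S (\<lambda>x. L (f x))"
  unfolding smooth_on_def by (simp add: Ck_on_bounded_linear)

lemma smooth_on_add:
  "open S \<Longrightarrow> smooth_on S f \<Longrightarrow> smooth_on S g \<Longrightarrow> smooth_on S (\<lambda>x. f x + g x)"
  unfolding smooth_on_def by (simp add: Ck_on_add)

lemma smooth_on_bilinear:
  "open S \<Longrightarrow> bounded_bilinear B \<Longrightarrow> smooth_on S f \<Longrightarrow> smooth_on S g
    \<Longrightarrow> smooth_on S (\<lambda>x. B (f x) (g x))"
  unfolding smooth_on_def by (simp add: Ck_on_bilinear)

lemma smooth_on_mult:
  fixes f g :: "'a::real_normed_vector \<Rightarrow> real"
  shows "open S \<Longrightarrow> smooth_on S f \<Longrightarrow> smooth_on S g \<Longrightarrow> smooth_on S (\<lambda>x. f x * g x)"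
  by (rule smooth_on_bilinear[OF _ bounded_bilinear_mult])

lemma smooth_on_diff:
  assumes "open S" "smooth_on S f" "smooth_on S g"
  shows "smooth_on S (\<lambda>x. f x - g x)"
  using smooth_on_add[OF assms(1,2) smooth_on_bounded_linear[OF assms(1) bounded_linear_minus[OF
        bounded_linear_ident] assms(3)]] by simp

lemma smooth_on_powr:
  fixes f :: "'a::real_normed_vector \<Rightarrow> real"
  shows "open S \<Longrightarrow> (\<And>x. x \<in> S \<Longrightarrow> 0 < f x) \<Longrightarrow> smooth_on S f \<Longrightarrow> smooth_on S (\<lambda>x. f x powr r)"
  unfolding smooth_on_def by (simp add: Ck_on_powr)

lemma smooth_on_sum:
  assumes "open S" "\<And>i. i \<in> I \<Longrightarrow> smooth_on S (f i)"
  shows "smooth_on S (\<lambda>x. \<Sum>i\<in>I. f i x)"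
  using assms(2) by (induction I rule: infinite_finite_induct)
    (simp_all add: smooth_on_const smooth_on_add assms(1))

lemma smooth_on_prod:
  fixes f :: "'i \<Rightarrow> 'a::real_normed_vector \<Rightarrow> real"
  assumes "open S" "\<And>i. i \<in> I \<Longrightarrow> smooth_on S (f i)"
  shows "smooth_on S (\<lambda>x. \<Prod>i\<in>I. f i x)"
  using assms(2) by (induction I rule: infinite_finite_induct)
    (simp_all add: smooth_on_const smooth_on_mult assms(1))

text \<open>Taking half the exponent of the positive function \<open>f x * f x\<close> avoids any
  distinction of signs.\<close>

lemma smooth_on_abs_powr:
  fixes f :: "'a::real_normed_vector \<Rightarrow> real"
  assumes "open S" "\<And>x. x \<in> S \<Longrightarrow> f x \<noteq> 0" "smooth_on S f"
  shows "smooth_on S (\<lambda>x. \<bar>f x\<bar> powr r)"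
proof (rule smooth_on_cong[OF assms(1)])
  show "smooth_on S (\<lambda>x. (f x * f x) powr (r / 2))"
    by (intro smooth_on_powr smooth_on_mult assms) (use assms(2) in \<open>simp_all add: zero_less_mult_iff linorder_neq_iff[symmetric] disj_commute\<close>)
  show "(f x * f x) powr (r / 2) = \<bar>f x\<bar> powr r" if "x \<in> S" for x
    using powr_mult[of "\<bar>f x\<bar>" "\<bar>f x\<bar>" "r / 2"] by (simp add: powr_add[symmetric])
qed

lemma smooth_on_abs:
  fixes f :: "'a::real_normed_vector \<Rightarrow> real"
  assumes "open S" "\<And>x. x \<in> S \<Longrightarrow> f x \<noteq> 0" "smooth_on S f"
  shows "smooth_on S (\<lambda>x. \<bar>f x\<bar>)"
  by (rule smooth_on_cong[OF assms(1) _ smooth_on_abs_powr[OF assms, of 1]]) (auto simp: powr_one)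

lemma smooth_on_divide:
  fixes f g :: "'a::real_normed_vector \<Rightarrow> real"
  assumes "open S" "\<And>x. x \<in> S \<Longrightarrow> g x \<noteq> 0" "smooth_on S f" "smooth_on S g"
  shows "smooth_on S (\<lambda>x. f x / g x)"
proof (rule smooth_on_cong[OF assms(1)])
  \<comment> \<open>The reciprocal of \<open>g\<close> is \<open>g\<close> divided by its square,
    hence a product of functions already known to be smooth.\<close>
  show "smooth_on S (\<lambda>x. f x * (g x * \<bar>g x\<bar> powr (- 2)))"
    by (intro smooth_on_mult smooth_on_abs_powr assms)
  show "f x * (g x * \<bar>g x\<bar> powr (- 2)) = f x / g x" if "x \<in> S" for x
    using assms(2)[OF that] by (simp add: powr_minus field_simps power2_eq_square)
qed

lemma smooth_on_vec_nth: "open S \<Longrightarrow> smooth_on S f \<Longrightarrow> smooth_on S (\<lambda>x. f x $ i)"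
  by (rule smooth_on_bounded_linear[OF _ bounded_linear_vec_nth])

lemma bounded_linear_axis: "bounded_linear (\<lambda>x::'b::real_normed_vector. axis i x)"
proof (rule bounded_linear_intro[where K = 1])
  show "norm (axis i x) \<le> norm x * 1" for x :: 'b
    unfolding norm_vec_def
    by (rule order_trans[OF L2_set_le_sum])
      (simp_all add: axis_def if_distrib[of norm] sum.delta cong: if_cong)
qed (simp_all add: axis_def vec_eq_iff)

lemma smooth_on_vec_lambda:
  fixes f :: "'a::real_normed_vector \<Rightarrow> 'n::finite \<Rightarrow> 'b::real_normed_vector"
  assumes "open S" "\<And>i. smooth_on S (\<lambda>x. f x i)"
  shows "smooth_on S (\<lambda>x. \<chi> i. f x i)"
proof -
  have "smooth_on S (\<lambda>x. \<Sum>i\<in>UNIV. axis i (f x i))"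
    by (intro smooth_on_sum assms smooth_on_bounded_linear[OF assms(1) bounded_linear_axis])
  moreover have "(\<Sum>i\<in>UNIV. axis i (f x i)) = (\<chi> i. f x i)" for x
    by (simp add: vec_eq_iff axis_def if_distrib[of "\<lambda>z. z $ _"] sum.delta)
  ultimately show ?thesis by simp
qed

lemma smooth_on_Pair:
  assumes "open S" "smooth_on S f" "smooth_on S g"
  shows "smooth_on S (\<lambda>x. (f x, g x))"
proof -
  have "smooth_on S (\<lambda>x. (f x, 0) + (0, g x))"
    by (intro smooth_on_add smooth_on_bounded_linear[OF assms(1) _ assms(2)]
        smooth_on_bounded_linear[OF assms(1) _ assms(3)] assms(1)
        bounded_linear_Pair bounded_linear_ident bounded_linear_zero)
  then show ?thesis by simp
qed

lemma smooth_on_ident: "smooth_on S (\<lambda>x. x)"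
  unfolding smooth_on_def
proof
  fix k show "Ck_on k S (\<lambda>x::'a. x)"
    by (cases k) (simp_all add: frechet_derivative_ident Ck_on_const)
qed

lemma smooth_on_imp_differentiable: "smooth_on S f \<Longrightarrow> x \<in> S \<Longrightarrow> f differentiable (at x)"
  unfolding smooth_on_def by (metis Ck_on.simps(2))

lemma smooth_on_imp_has_derivative:
  "smooth_on S f \<Longrightarrow> x \<in> S \<Longrightarrow> (f has_derivative frechet_derivative f (at x)) (at x)"
  using frechet_derivative_works smooth_on_imp_differentiable by blast

lemma smooth_on_frechet_derivative:
  "smooth_on S f \<Longrightarrow> smooth_on S (\<lambda>x. frechet_derivative f (at x) v)"
  unfolding smooth_on_def by (metis Ck_on.simps(2))

section \<open>Smooth dependence of determinants and inverse matrices\<close>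

lemma smooth_on_det:
  fixes F :: "'a::real_normed_vector \<Rightarrow> real^'n^'n"
  assumes "open S" "smooth_on S F"
  shows "smooth_on S (\<lambda>x. det (F x))"
  unfolding det_def
  by (intro smooth_on_sum smooth_on_mult smooth_on_prod smooth_on_const smooth_on_vec_nth assms)

lemma
  fixes A :: "'a::semiring_1^'n^'m"
  assumes "invertible A"
  shows matrix_inv_right: "A ** matrix_inv A = mat 1"
    and matrix_inv_left: "matrix_inv A ** A = mat 1"
  using someI_ex[OF assms[unfolded invertible_def]] unfolding matrix_inv_def by auto

text \<open>Cramer's rule column by column. It makes the entries of the inverse rational in those of
  \<open>A\<close>, so smoothness of inversion follows from that of determinants and
  quotients.\<close>

lemma matrix_inv_eq_cramer:
  fixes A :: "real^'n^'n"
  assumes "invertible A"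
  shows "matrix_inv A = (\<chi> k l. det (\<chi> i j. if j = k then axis l 1 $ i else A $ i $ j) / det A)"
proof -
  have "A *v column l (matrix_inv A) = axis l 1" for l
    using matrix_inv_right[OF assms]
    by (metis column_def matrix_vector_mul_assoc matrix_vector_mult_basis matrix_vector_mul_lid)
  then have "column l (matrix_inv A) =
      (\<chi> k. det (\<chi> i j. if j = k then axis l 1 $ i else A $ i $ j) / det A)" for l
    using cramer[of A "column l (matrix_inv A)" "axis l 1"] assms by (simp add: invertible_det_nz)
  then show ?thesis by (simp add: vec_eq_iff column_def)
qed

lemma smooth_on_matrix_inv:
  fixes F :: "'a::real_normed_vector \<Rightarrow> real^'n^'n"
  assumes "open S" "smooth_on S F" "\<And>x. x \<in> S \<Longrightarrow> invertible (F x)"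
  shows "smooth_on S (\<lambda>x. matrix_inv (F x))"
proof (rule smooth_on_cong[OF assms(1)])
  have "smooth_on S (\<lambda>x. if j = k then axis l 1 $ i else F x $ i $ j)" for i j k l :: 'n
    by (cases "j = k") (auto intro!: smooth_on_const smooth_on_vec_nth assms)
  then show "smooth_on S (\<lambda>x. \<chi> k l.
      det (\<chi> i j. if j = k then axis l 1 $ i else F x $ i $ j) / det (F x))"
    using assms by (intro smooth_on_vec_lambda smooth_on_divide smooth_on_det)
      (auto simp: invertible_det_nz)
qed (simp add: matrix_inv_eq_cramer assms)

section \<open>Matrix calculus\<close>

lemma bounded_bilinear_matrix_matrix_mult:
  "bounded_bilinear ((**) :: real^'n^'m \<Rightarrow> real^'k^'n \<Rightarrow> real^'k^'m)"
  unfolding bilinear_conv_bounded_bilinear[symmetric] bilinear_def linear_iff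
  by (auto simp: vec_eq_iff matrix_matrix_mult_def sum.distrib algebra_simps sum_distrib_left)

lemma bounded_bilinear_matrix_vector_mult:
  "bounded_bilinear ((*v) :: real^'n^'m \<Rightarrow> real^'n \<Rightarrow> real^'m)"
  unfolding bilinear_conv_bounded_bilinear[symmetric] bilinear_def linear_iff
  by (auto simp: vec_eq_iff matrix_vector_mult_def sum.distrib algebra_simps sum_distrib_left)

lemma bounded_linear_transpose: "bounded_linear (transpose :: real^'n^'m \<Rightarrow> real^'m^'n)"
  unfolding linear_conv_bounded_linear[symmetric] linear_iff
  by (auto simp: vec_eq_iff transpose_def)

lemmas matrix_mult_linear =
  bounded_bilinear.add_left[OF bounded_bilinear_matrix_matrix_mult]
  bounded_bilinear.add_right[OF bounded_bilinear_matrix_matrix_mult]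
  bounded_bilinear.diff_left[OF bounded_bilinear_matrix_matrix_mult]
  bounded_bilinear.diff_right[OF bounded_bilinear_matrix_matrix_mult]
  bounded_bilinear.minus_left[OF bounded_bilinear_matrix_matrix_mult]
  bounded_bilinear.minus_right[OF bounded_bilinear_matrix_matrix_mult]
  bounded_bilinear.scaleR_left[OF bounded_bilinear_matrix_matrix_mult]
  bounded_bilinear.scaleR_right[OF bounded_bilinear_matrix_matrix_mult]

lemmas matrix_vector_linear =
  bounded_bilinear.add_left[OF bounded_bilinear_matrix_vector_mult]
  bounded_bilinear.add_right[OF bounded_bilinear_matrix_vector_mult]
  bounded_bilinear.diff_left[OF bounded_bilinear_matrix_vector_mult]
  bounded_bilinear.diff_right[OF bounded_bilinear_matrix_vector_mult]
  bounded_bilinear.minus_left[OF bounded_bilinear_matrix_vector_mult]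
  bounded_bilinear.minus_right[OF bounded_bilinear_matrix_vector_mult]
  bounded_bilinear.scaleR_left[OF bounded_bilinear_matrix_vector_mult]
  bounded_bilinear.scaleR_right[OF bounded_bilinear_matrix_vector_mult]

section \<open>Determinants, traces, inverses and their derivatives\<close>

lemma det_scaleR: "det (c *\<^sub>R (A::real^'n^'n)) = c ^ CARD('n) * det A"
  using det_rows_mul[of "\<lambda>_. c" "\<lambda>i. A $ i"]
  by (simp add: scalar_mult_eq_scaleR scaleR_vec_def)

lemma trace_scaleR: "trace (c *\<^sub>R (A::real^'n^'n)) = c * trace A"
  by (simp add: trace_def sum_distrib_left)

lemma trace_transpose: "trace (transpose A) = trace A"
  by (simp add: trace_def transpose_def)

lemma invertible_matrix_inv: "invertible A \<Longrightarrow> invertible (matrix_inv A)"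
  by (metis invertible_def matrix_inv_left matrix_inv_right)

lemma matrix_inv_unique:
  fixes A B :: "'a::semiring_1^'n^'n"
  assumes "A ** B = mat 1" "B ** A = mat 1"
  shows "matrix_inv A = B"
proof -
  have "invertible A" using assms unfolding invertible_def by blast
  then show ?thesis
    by (metis assms(2) matrix_inv_right matrix_mul_assoc matrix_mul_lid matrix_mul_rid)
qed

lemma matrix_inv_matrix_inv: "invertible (A::'a::semiring_1^'n^'n) \<Longrightarrow> matrix_inv (matrix_inv A) = A"
  by (simp add: matrix_inv_unique matrix_inv_left matrix_inv_right)

lemma det_matrix_inv: "invertible (A::real^'n^'n) \<Longrightarrow> det (matrix_inv A) = 1 / det A"
  using arg_cong[OF matrix_inv_right[of A], of det]
  by (simp add: det_mul det_I field_simps invertible_det_nz)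

lemma matrix_inv_scaleR:
  "invertible (A::real^'n^'n) \<Longrightarrow> c \<noteq> 0 \<Longrightarrow> matrix_inv (c *\<^sub>R A) = (1 / c) *\<^sub>R matrix_inv A"
  by (rule matrix_inv_unique) (simp_all add: matrix_mult_linear matrix_inv_left matrix_inv_right)

lemma transpose_matrix_inv:
  assumes "invertible (A::real^'n^'n)"
  shows "transpose (matrix_inv A) = matrix_inv (transpose A)"
  by (rule matrix_inv_unique[symmetric])
    (simp_all add: matrix_transpose_mul[symmetric] matrix_inv_left matrix_inv_right assms)

lemma matrix_inv_matrix_mult:
  fixes A B :: "'a::semiring_1^'n^'n"
  assumes "invertible A" "invertible B"
  shows "matrix_inv (A ** B) = matrix_inv B ** matrix_inv A"
proof (rule matrix_inv_unique)
  have "A ** B ** (matrix_inv B ** matrix_inv A) = A ** (B ** matrix_inv B) ** matrix_inv A"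
    by (simp only: matrix_mul_assoc)
  then show "A ** B ** (matrix_inv B ** matrix_inv A) = mat 1"
    by (simp add: matrix_inv_right assms)
  have "matrix_inv B ** matrix_inv A ** (A ** B) = matrix_inv B ** (matrix_inv A ** A) ** B"
    by (simp only: matrix_mul_assoc)
  then show "matrix_inv B ** matrix_inv A ** (A ** B) = mat 1"
    by (simp add: matrix_inv_left assms)
qed

text \<open>The determinant is multilinear in the rows, so its derivative varies one row at a time.
  This form covers singular matrices too and thereby gives the continuity of \<open>det\<close>
  behind \<open>open_invertible\<close>.\<close>

lemma has_derivative_det_rows:
  fixes F :: "'a::real_normed_vector \<Rightarrow> real^'n^'n"
  assumes "(F has_derivative F') (at x)"
  shows "((\<lambda>x. det (F x)) has_derivative
    (\<lambda>v. \<Sum>i\<in>UNIV. det (\<chi> k. if k = i then F' v $ i else F x $ k))) (at x)"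
proof -
  have c: "((\<lambda>x. F x $ i $ j) has_derivative (\<lambda>v. F' v $ i $ j)) (at x)" for i j
    by (intro bounded_linear.has_derivative[OF bounded_linear_vec_nth] assms)
  have "((\<lambda>x. det (F x)) has_derivative (\<lambda>v. \<Sum>p\<in>{p. p permutes UNIV}. of_int (sign p) *
      (\<Sum>i\<in>UNIV. F' v $ i $ p i * (\<Prod>j\<in>UNIV - {i}. F x $ j $ p j)))) (at x)"
    unfolding det_def by (intro has_derivative_sum has_derivative_mult_right has_derivative_prod c)
  moreover have "(\<Sum>p\<in>{p. p permutes UNIV}. of_int (sign p) *
      (\<Sum>i\<in>UNIV. F' v $ i $ p i * (\<Prod>j\<in>UNIV - {i}. F x $ j $ p j)))
    = (\<Sum>i\<in>UNIV. det (\<chi> k. if k = i then F' v $ i else F x $ k))" for v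
  proof -
    have "(\<Prod>k\<in>UNIV. (if k = i then F' v $ i else F x $ k) $ p k)
        = F' v $ i $ p i * (\<Prod>j\<in>UNIV - {i}. F x $ j $ p j)" for i and p :: "'n \<Rightarrow> 'n"
      by (subst prod.remove[of _ i]) auto
    then show ?thesis
      unfolding det_def vec_lambda_beta sum_distrib_left by (subst sum.swap) simp
  qed
  ultimately show ?thesis by simp
qed

text \<open>Row \<open>i\<close> of \<open>B ** A\<close> is a combination of the rows of
  \<open>A\<close>; every summand but that of \<open>A $ i\<close> repeats a row and contributes
  zero. This turns the row-wise derivative into a trace.\<close>

lemma det_replace_row_mult:
  fixes A B :: "real^'n^'n"
  shows "det (\<chi> k. if k = i then (B ** A) $ i else A $ k) = B $ i $ i * det A"
proof -
  have r: "(B ** A) $ i = (\<Sum>j\<in>UNIV. B $ i $ j *s A $ j)"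
    by (simp add: vec_eq_iff matrix_matrix_mult_def)
  have "det (\<chi> k. if k = i then (B ** A) $ i else A $ k)
      = (\<Sum>j\<in>UNIV. det (\<chi> k. if k = i then B $ i $ j *s A $ j else A $ k))"
    unfolding r using det_linear_row_sum[of UNIV i "\<lambda>_ j. B $ i $ j *s A $ j" "\<lambda>k. A $ k"]
    by (rule trans) simp_all
  also have "\<dots> = (\<Sum>j\<in>UNIV. B $ i $ j * det (\<chi> k. if k = i then A $ j else A $ k))"
    by (simp add: det_row_mul)
  also have "\<dots> = (\<Sum>j\<in>UNIV. if j = i then B $ i $ i * det A else 0)"
  proof (intro sum.cong refl)
    fix j
    have "(\<chi> k. if k = i then A $ i else A $ k) = A"
      by (simp add: vec_eq_iff)
    moreover have "det (\<chi> k. if k = i then A $ j else A $ k) = 0" if "j \<noteq> i"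
      by (rule det_identical_rows[OF that]) (use that in \<open>simp add: row_def vec_eq_iff\<close>)
    ultimately show "B $ i $ j * det (\<chi> k. if k = i then A $ j else A $ k)
        = (if j = i then B $ i $ i * det A else 0)"
      by auto
  qed
  also have "\<dots> = B $ i $ i * det A" by (simp add: sum.delta)
  finally show ?thesis .
qed

text \<open>Jacobi's formula. Writing \<open>F' v\<close> as
  \<open>(F' v ** matrix_inv (F x)) ** F x\<close> makes every replaced row a combination of rows of
  \<open>F x\<close>, and only diagonal coefficients survive.\<close>

lemma has_derivative_det:
  fixes F :: "'a::real_normed_vector \<Rightarrow> real^'n^'n"
  assumes "(F has_derivative F') (at x)" "invertible (F x)"
  shows "((\<lambda>x. det (F x)) has_derivative
    (\<lambda>v. det (F x) * trace (matrix_inv (F x) ** F' v))) (at x)"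
proof -
  have F: "(F' v ** matrix_inv (F x)) ** F x = F' v" for v
    using matrix_inv_left[OF assms(2)] by (simp add: matrix_mul_assoc[symmetric])
  have "det (\<chi> k. if k = i then F' v $ i else F x $ k)
      = (F' v ** matrix_inv (F x)) $ i $ i * det (F x)" for i v
    using det_replace_row_mult[of i "F' v ** matrix_inv (F x)" "F x"] unfolding F .
  then have "(\<Sum>i\<in>UNIV. det (\<chi> k. if k = i then F' v $ i else F x $ k))
      = det (F x) * trace (matrix_inv (F x) ** F' v)" for v
    by (simp add: trace_mul_sym[of "matrix_inv (F x)"])
      (simp add: trace_def sum_distrib_left mult.commute)
  with has_derivative_det_rows[OF assms(1)] show ?thesis by simp
qed

lemma open_invertible: "open {A::real^'n^'n. invertible A}"
proof -
  have "continuous_on UNIV (det :: real^'n^'n \<Rightarrow> real)"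
    using has_derivative_det_rows[OF has_derivative_ident]
    by (meson continuous_at_imp_continuous_on has_derivative_continuous)
  then have "open ((det :: real^'n^'n \<Rightarrow> real) -` (- {0}))"
    by (intro open_vimage) auto
  then show ?thesis by (simp add: vimage_def invertible_det_nz)
qed

text \<open>Differentiability comes from Cramer's rule; the value of the derivative then follows by
  differentiating \<open>A ** matrix_inv A = mat 1\<close> on the open set of invertible
  matrices.\<close>

lemma has_derivative_matrix_inv:
  fixes F :: "'a::real_normed_vector \<Rightarrow> real^'n^'n"
  assumes "(F has_derivative F') (at x)" "invertible (F x)"
  shows "((\<lambda>x. matrix_inv (F x)) has_derivative
    (\<lambda>v. - (matrix_inv (F x) ** F' v ** matrix_inv (F x)))) (at x)"
proof -
  let ?S = "{A::real^'n^'n. invertible A}" and ?A = "F x"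
  let ?G = "frechet_derivative matrix_inv (at ?A)"
  have "smooth_on ?S (\<lambda>A. matrix_inv A)"
    by (rule smooth_on_matrix_inv[OF open_invertible smooth_on_ident]) simp
  then have G: "(matrix_inv has_derivative ?G) (at ?A)"
    using assms(2) by (auto dest: smooth_on_imp_has_derivative)
  have "((\<lambda>A. A ** matrix_inv A) has_derivative (\<lambda>v. ?A ** ?G v + v ** matrix_inv ?A)) (at ?A)"
    by (rule bounded_bilinear.FDERIV[OF bounded_bilinear_matrix_matrix_mult has_derivative_ident G])
  moreover have "((\<lambda>A. A ** matrix_inv A) has_derivative (\<lambda>v. 0)) (at ?A)"
    by (rule has_derivative_transform_within_open[OF has_derivative_const[of "mat 1"] open_invertible])
      (simp_all add: assms matrix_inv_right)
  ultimately have "(\<lambda>v. ?A ** ?G v + v ** matrix_inv ?A) = (\<lambda>v. 0)"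
    by (rule has_derivative_unique)
  then have "?A ** ?G v = - (v ** matrix_inv ?A)" for v
    unfolding eq_neg_iff_add_eq_0 by (rule fun_cong)
  then have "matrix_inv ?A ** (?A ** ?G v) = - (matrix_inv ?A ** v ** matrix_inv ?A)" for v
    by (simp add: matrix_mult_linear matrix_mul_assoc)
  then have "?G v = - (matrix_inv ?A ** v ** matrix_inv ?A)" for v
    by (simp add: matrix_mul_assoc matrix_inv_left assms(2))
  with has_derivative_compose[OF assms(1) G] show ?thesis by simp
qed

lemma has_derivative_abs_powr:
  fixes f :: "'a::real_normed_vector \<Rightarrow> real"
  assumes "(f has_derivative f') (at x)" "f x \<noteq> 0"
  shows "((\<lambda>x. \<bar>f x\<bar> powr r) has_derivative (\<lambda>v. r * \<bar>f x\<bar> powr r * (f' v / f x))) (at x)"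
proof -
  let ?u = "f x"
  have "((\<lambda>u. \<bar>u\<bar> powr r) has_real_derivative r * \<bar>?u\<bar> powr r / ?u) (at ?u)"
  proof (cases "?u > 0")
    case True
    have "((\<lambda>u. u powr r) has_real_derivative r * \<bar>?u\<bar> powr r / ?u) (at ?u)"
      using True by (auto intro!: derivative_eq_intros simp: powr_diff)
    then show ?thesis
      by (rule has_field_derivative_transform_within_open[of _ _ _ "{0<..}"]) (use True in auto)
  next
    case False
    then have n: "?u < 0" using assms(2) by simp
    have "((\<lambda>u. (- u) powr r) has_real_derivative r * \<bar>?u\<bar> powr r / ?u) (at ?u)"
      using n by (auto intro!: derivative_eq_intros simp: powr_diff field_simps)
    then show ?thesis
      by (rule has_field_derivative_transform_within_open[of _ _ _ "{..<0}"]) (use n in auto)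
  qed
  from has_derivative_compose[OF assms(1) this[unfolded has_field_derivative_def]]
  show ?thesis by (simp add: mult_ac)
qed

section \<open>Coordinate partial derivatives\<close>

lemma partial_eq: "(f has_derivative f') (at y) \<Longrightarrow> partial a f y = f' (axis a 1)"
  unfolding partial_def by (metis frechet_derivative_at)

lemma partial_cong:
  assumes "open S" "y \<in> S" "f differentiable (at y)" "\<And>x. x \<in> S \<Longrightarrow> f x = g x"
  shows "partial a f y = partial a g y"
  unfolding partial_def using frechet_derivative_transform_within_open[OF assms(3,1,2,4)] by simp

lemma partial_const: "partial a (\<lambda>z. c) y = 0"
  by (simp add: partial_def frechet_derivative_const)

lemma partial_bounded_linear:
  assumes "bounded_linear L" "f differentiable (at y)"
  shows "partial a (\<lambda>z. L (f z)) y = L (partial a f y)"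
  using partial_eq[OF bounded_linear.has_derivative[OF assms(1)]] assms(2)
  by (simp add: frechet_derivative_works partial_def)

lemma partial_vec_nth: "f differentiable (at y) \<Longrightarrow> partial a (\<lambda>z. f z $ b) y = partial a f y $ b"
  by (rule partial_bounded_linear[OF bounded_linear_vec_nth])

lemma partial_add:
  assumes "f differentiable (at y)" "g differentiable (at y)"
  shows "partial a (\<lambda>z. f z + g z) y = partial a f y + partial a g y"
  using partial_eq[OF has_derivative_add] assms by (simp add: frechet_derivative_works partial_def)

lemma partial_bilinear:
  assumes "bounded_bilinear B" "f differentiable (at y)" "g differentiable (at y)"
  shows "partial a (\<lambda>z. B (f z) (g z)) y = B (f y) (partial a g y) + B (partial a f y) (g y)"
  using partial_eq[OF bounded_bilinear.FDERIV[OF assms(1)]] assms(2,3)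
  by (simp add: frechet_derivative_works partial_def)

lemmas partial_mult = partial_bilinear[OF bounded_bilinear_mult]
lemmas partial_scaleR = partial_bilinear[OF bounded_bilinear_scaleR]

lemma bounded_bilinear_differentiable:
  "bounded_bilinear B \<Longrightarrow> f differentiable (at y) \<Longrightarrow> g differentiable (at y)
    \<Longrightarrow> (\<lambda>z. B (f z) (g z)) differentiable (at y)"
  unfolding differentiable_def by (blast dest: bounded_bilinear.FDERIV)

lemma bounded_linear_differentiable:
  "bounded_linear L \<Longrightarrow> f differentiable (at y) \<Longrightarrow> (\<lambda>z. L (f z)) differentiable (at y)"
  unfolding differentiable_def by (blast dest: bounded_linear.has_derivative)

lemmas vec_nth_differentiable = bounded_linear_differentiable[OF bounded_linear_vec_nth]

lemma vec_lambda_differentiable: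
  fixes f :: "real^'n \<Rightarrow> 'm::finite \<Rightarrow> 'b::real_normed_vector"
  assumes "\<And>i. (\<lambda>z. f z i) differentiable (at y)"
  shows "(\<lambda>z. \<chi> i. f z i) differentiable (at y)"
proof -
  have "(\<lambda>z. \<Sum>i\<in>UNIV. axis i (f z i)) differentiable (at y)"
    by (intro differentiable_sum ballI finite bounded_linear_differentiable[OF bounded_linear_axis] assms)
  moreover have "(\<Sum>i\<in>UNIV. axis i (f z i)) = (\<chi> i. f z i)" for z
    by (simp add: vec_eq_iff axis_def if_distrib[of "\<lambda>z. z $ _"] sum.delta)
  ultimately show ?thesis by simp
qed

lemma matrix_inv_differentiable:
  fixes F :: "'a::real_normed_vector \<Rightarrow> real^'n^'n"
  shows "F differentiable (at y) \<Longrightarrow> invertible (F y) \<Longrightarrow> (\<lambda>z. matrix_inv (F z)) differentiable (at y)"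
  unfolding differentiable_def by (blast dest: has_derivative_matrix_inv)

lemma partial_matrix_inv:
  fixes F :: "real^'m \<Rightarrow> real^'n^'n"
  assumes "F differentiable (at y)" "invertible (F y)"
  shows "partial a (\<lambda>z. matrix_inv (F z)) y = - (matrix_inv (F y) ** partial a F y ** matrix_inv (F y))"
  using partial_eq[OF has_derivative_matrix_inv[OF assms(1)[unfolded frechet_derivative_works] assms(2)]]
  by (simp add: partial_def)

lemma has_derivative_abs_det_powr:
  fixes F :: "'a::real_normed_vector \<Rightarrow> real^'n^'n"
  assumes "(F has_derivative F') (at x)" "invertible (F x)"
  shows "((\<lambda>x. \<bar>det (F x)\<bar> powr r) has_derivative
    (\<lambda>v. r * \<bar>det (F x)\<bar> powr r * trace (matrix_inv (F x) ** F' v))) (at x)"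
  using has_derivative_abs_powr[OF has_derivative_det[OF assms], of r] assms(2)
  by (simp add: invertible_det_nz)

lemma abs_det_powr_differentiable:
  fixes F :: "'a::real_normed_vector \<Rightarrow> real^'n^'n"
  shows "F differentiable (at y) \<Longrightarrow> invertible (F y)
    \<Longrightarrow> (\<lambda>z. \<bar>det (F z)\<bar> powr r) differentiable (at y)"
  unfolding differentiable_def by (blast dest: has_derivative_abs_det_powr)

lemma partial_abs_det_powr:
  fixes F :: "real^'m \<Rightarrow> real^'n^'n"
  assumes "F differentiable (at y)" "invertible (F y)"
  shows "partial a (\<lambda>z. \<bar>det (F z)\<bar> powr r) y
    = r * \<bar>det (F y)\<bar> powr r * trace (matrix_inv (F y) ** partial a F y)"
  using partial_eq[OF has_derivative_abs_det_powr[OF assms(1)[unfolded frechet_derivative_works] assms(2)]]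
  by (simp add: partial_def)

lemma frechet_derivative_eq_sum_partial:
  assumes "f differentiable (at y)"
  shows "frechet_derivative f (at y) v = (\<Sum>a\<in>UNIV. v $ a *\<^sub>R partial a f y)"
proof -
  have l: "linear (frechet_derivative f (at y))"
    using assms by (rule linear_frechet_derivative)
  have "v = (\<Sum>a\<in>UNIV. v $ a *\<^sub>R axis a 1)"
    using basis_expansion[of v] by (simp add: scalar_mult_eq_scaleR)
  then have "frechet_derivative f (at y) v = frechet_derivative f (at y) (\<Sum>a\<in>UNIV. v $ a *\<^sub>R axis a 1)"
    by simp
  then show ?thesis
    by (simp add: linear_sum[OF l] linear_scale[OF l] partial_def)
qed

lemma partial_frechet:
  "f differentiable (at y) \<Longrightarrow> (f has_derivative (\<lambda>v. \<Sum>a\<in>UNIV. v $ a *\<^sub>R partial a f y)) (at y)"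
  by (simp add: frechet_derivative_eq_sum_partial[symmetric] frechet_derivative_works[symmetric])

section \<open>Metrics and weighted inverse metrics\<close>

text \<open>Taking determinants in \<open>g\<^sup>-\<^sup>1 = \<bar>det \<zeta>\<bar> \<zeta>\<close> gives \<open>\<bar>det \<zeta>\<bar> = \<bar>det g\<bar>\<close> to the power \<open>- 1 / (n + 1)\<close>,
  hence the exponent below.\<close>

definition weighted_inverse :: "real^'n^'n \<Rightarrow> real^'n^'n" where
  "weighted_inverse g = \<bar>det g\<bar> powr (1 / (real CARD('n) + 1)) *\<^sub>R matrix_inv g"

definition unweighted_inverse :: "real^'n^'n \<Rightarrow> real^'n^'n" where
  "unweighted_inverse \<zeta> = matrix_inv (\<bar>det \<zeta>\<bar> *\<^sub>R \<zeta>)"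

lemma powr_root_power: "0 < x \<Longrightarrow> (x powr (1 / (real n + 1))) ^ Suc n = x"
  by (simp add: powr_realpow[symmetric] powr_powr add.commute del: power_Suc)

lemma invertible_weighted_inverse:
  "invertible g \<Longrightarrow> invertible (weighted_inverse g)"
  unfolding weighted_inverse_def
  by (rule scalar_invertible[OF _ invertible_matrix_inv]) (simp_all add: invertible_det_nz)

lemma invertible_unweighted_inverse:
  "invertible \<zeta> \<Longrightarrow> invertible (unweighted_inverse \<zeta>)"
  unfolding unweighted_inverse_def
  by (rule invertible_matrix_inv[OF scalar_invertible]) (simp_all add: invertible_det_nz)

text \<open>With c the root of |det g|, the determinant in question is
  \<open>c^n / \<bar>det g\<bar>\<close> in absolute value, and
  \<open>c^(n+1) = \<bar>det g\<bar>\<close>. So the factor in \<open>unweighted_inverse\<close>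
  cancels the one in \<open>weighted_inverse\<close>.\<close>

lemma abs_det_weighted_inverse:
  fixes g :: "real^'n^'n"
  assumes "invertible g"
  shows "\<bar>det (weighted_inverse g)\<bar> * \<bar>det g\<bar> powr (1 / (real CARD('n) + 1)) = 1"
proof -
  have d: "0 < \<bar>det g\<bar>" using assms by (simp add: invertible_det_nz)
  let ?c = "\<bar>det g\<bar> powr (1 / (real CARD('n) + 1))"
  have "?c ^ CARD('n) * ?c = \<bar>det g\<bar>"
    using powr_root_power[OF d, of "CARD('n)"] by (simp add: mult.commute)
  then show ?thesis
    using d by (simp add: weighted_inverse_def det_scaleR det_matrix_inv assms abs_mult power_abs)
qed

lemma unweighted_weighted_inverse:
  assumes "invertible g"
  shows "unweighted_inverse (weighted_inverse g) = g"
  using abs_det_weighted_inverse[OF assms]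
  by (simp add: unweighted_inverse_def)
    (simp add: weighted_inverse_def matrix_inv_matrix_inv assms)

lemma weighted_unweighted_inverse:
  fixes \<zeta> :: "real^'n^'n"
  assumes "invertible \<zeta>"
  shows "weighted_inverse (unweighted_inverse \<zeta>) = \<zeta>"
proof -
  let ?d = "\<bar>det \<zeta>\<bar>"
  have d: "0 < ?d" using assms by (simp add: invertible_det_nz)
  have i: "invertible (?d *\<^sub>R \<zeta>)" using d assms by (simp add: scalar_invertible)
  \<comment> \<open>Rescaling the n rows contributes \<open>d^n\<close> and \<zeta> itself one more
    d; the root in \<open>weighted_inverse\<close> therefore gives \<open>1 / d\<close>.\<close>
  have "\<bar>det (unweighted_inverse \<zeta>)\<bar> = (1 / ?d) powr (real CARD('n) + 1)"
    using d by (simp add: unweighted_inverse_def det_matrix_inv i det_scaleR abs_mult power_abs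
        powr_add powr_realpow power_one_over)
  then show ?thesis
    using d by (simp add: weighted_inverse_def powr_powr)
      (simp add: unweighted_inverse_def matrix_inv_matrix_inv i)
qed

section \<open>Parallel metrics and parallel weighted inverse metrics\<close>

lemma trace_christoffel:
  "trace (\<Gamma> y $ a) = (real CARD('n) + 1) * density_symbol 1 (\<Gamma> :: 'n::finite christoffel) y $ a"
  by (simp add: density_symbol_def trace_def add_nonneg_eq_0_iff)

text \<open>Here \<open>\<Gamma> y $ a\<close> is read as a matrix with the upper index numbering
  the rows; the later computations use this matrix form.\<close>

lemma nabla_metric_eq_0_iff:
  "nabla_metric \<Gamma> g y = 0 \<longleftrightarrow>
    (\<forall>a. partial a g y = transpose (\<Gamma> y $ a) ** g y + g y ** \<Gamma> y $ a)"
  by (simp add: vec_eq_iff nabla_metric_def matrix_matrix_mult_def transpose_def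
      diff_diff_eq mult.commute)

text \<open>Assumption \<open>p\<close> says that \<zeta> is parallel as a contravariant tensor of
  weight -2. By Jacobi's formula, with trace (n + 1)\<delta> for the Christoffel matrix, det \<zeta>
  is parallel of weight 2; the product with |det \<zeta>| is then a parallel tensor without weight,
  and so is its inverse.\<close>

lemma
  fixes \<zeta> :: "real^'n \<Rightarrow> real^'n^'n"
  assumes d: "\<zeta> differentiable (at y)" and i: "invertible (\<zeta> y)"
    and p: "partial a \<zeta> y = (2 * density_symbol 1 \<Gamma> y $ a) *\<^sub>R \<zeta> y
      - \<Gamma> y $ a ** \<zeta> y - \<zeta> y ** transpose (\<Gamma> y $ a)"
  shows partial_abs_det_weighted:
      "partial a (\<lambda>z. \<bar>det (\<zeta> z)\<bar>) y = - 2 * density_symbol 1 \<Gamma> y $ a * \<bar>det (\<zeta> y)\<bar>"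
    and partial_unweighted_inverse:
      "partial a (\<lambda>z. unweighted_inverse (\<zeta> z)) y =
        transpose (\<Gamma> y $ a) ** unweighted_inverse (\<zeta> y) + unweighted_inverse (\<zeta> y) ** \<Gamma> y $ a"
proof -
  let ?G = "\<Gamma> y $ a" and ?\<delta> = "density_symbol 1 \<Gamma> y $ a" and ?d = "\<bar>det (\<zeta> y)\<bar>"
  let ?Z = "\<zeta> y"
  have "trace (matrix_inv ?Z ** partial a \<zeta> y) = 2 * ?\<delta> * real CARD('n) - 2 * trace ?G"
  proof -
    have "matrix_inv ?Z ** partial a \<zeta> y = (2 * ?\<delta>) *\<^sub>R mat 1 - matrix_inv ?Z ** ?G ** ?Z - transpose ?G"
      unfolding p by (simp add: matrix_mult_linear matrix_mul_assoc matrix_inv_left i)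
    moreover have "trace (matrix_inv ?Z ** ?G ** ?Z) = trace ?G"
      by (subst trace_mul_sym) (simp add: matrix_mul_assoc matrix_inv_right i)
    ultimately show ?thesis
      by (simp add: trace_sub trace_scaleR trace_I trace_transpose)
  qed
  then have "trace (matrix_inv ?Z ** partial a \<zeta> y) = - 2 * ?\<delta>"
    by (simp add: trace_christoffel algebra_simps)
  with partial_abs_det_powr[OF d i, of a 1]
  show 1: "partial a (\<lambda>z. \<bar>det (\<zeta> z)\<bar>) y = - 2 * ?\<delta> * ?d" by simp
  have dd: "(\<lambda>z. \<bar>det (\<zeta> z)\<bar>) differentiable (at y)"
    using abs_det_powr_differentiable[OF d i, of 1] by simp
  let ?X = "?d *\<^sub>R ?Z"
  have iX: "invertible ?X"
    by (rule scalar_invertible[OF _ i]) (use i in \<open>simp add: invertible_det_nz\<close>)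
  have dX: "(\<lambda>z. \<bar>det (\<zeta> z)\<bar> *\<^sub>R \<zeta> z) differentiable (at y)"
    by (rule bounded_bilinear_differentiable[OF bounded_bilinear_scaleR dd d])
  have "partial a (\<lambda>z. \<bar>det (\<zeta> z)\<bar> *\<^sub>R \<zeta> z) y = ?d *\<^sub>R partial a \<zeta> y + (- 2 * ?\<delta> * ?d) *\<^sub>R ?Z"
    by (simp only: partial_scaleR[OF dd d] 1)
  \<comment> \<open>The two multiples of \<delta> cancel: the rescaled tensor has weight
    zero.\<close>
  also have "\<dots> = - (?G ** ?X) - ?X ** transpose ?G"
    unfolding p by (simp add: algebra_simps matrix_mult_linear)
  finally have 2: "partial a (\<lambda>z. \<bar>det (\<zeta> z)\<bar> *\<^sub>R \<zeta> z) y = - (?G ** ?X) - ?X ** transpose ?G" .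
  let ?g = "matrix_inv ?X"
  have "- (?g ** (- (?G ** ?X) - ?X ** transpose ?G) ** ?g)
      = ?g ** ?G ** (?X ** ?g) + (?g ** ?X) ** transpose ?G ** ?g"
    by (simp only: matrix_mult_linear matrix_mul_assoc) simp
  then show "partial a (\<lambda>z. unweighted_inverse (\<zeta> z)) y =
        transpose ?G ** unweighted_inverse ?Z + unweighted_inverse ?Z ** ?G"
    unfolding unweighted_inverse_def
    by (simp add: partial_matrix_inv[OF dX iX] 2 matrix_inv_left[OF iX] matrix_inv_right[OF iX])
qed

text \<open>The way back: the trace of the equation for g is twice the trace of the Christoffel
  matrix, so the (n + 1)-st root of |det g| has logarithmic derivative 2\<delta>, the density term
  belonging to weight -2.\<close>

lemma
  fixes g :: "real^'n \<Rightarrow> real^'n^'n"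
  assumes d: "g differentiable (at y)" and i: "invertible (g y)"
    and p: "partial a g y = transpose (\<Gamma> y $ a) ** g y + g y ** \<Gamma> y $ a"
  shows partial_abs_det_root:
      "partial a (\<lambda>z. \<bar>det (g z)\<bar> powr (1 / (real CARD('n) + 1))) y
        = 2 * density_symbol 1 \<Gamma> y $ a * \<bar>det (g y)\<bar> powr (1 / (real CARD('n) + 1))"
    and partial_weighted_inverse:
      "partial a (\<lambda>z. weighted_inverse (g z)) y = (2 * density_symbol 1 \<Gamma> y $ a) *\<^sub>R weighted_inverse (g y)
      - \<Gamma> y $ a ** weighted_inverse (g y) - weighted_inverse (g y) ** transpose (\<Gamma> y $ a)"
proof -
  let ?G = "\<Gamma> y $ a" and ?\<delta> = "density_symbol 1 \<Gamma> y $ a" and ?r = "1 / (real CARD('n) + 1)"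
  let ?g = "g y" let ?h = "matrix_inv (g y)" let ?c = "\<bar>det (g y)\<bar> powr ?r"
  have "trace (?h ** partial a g y) = 2 * trace ?G"
  proof -
    have "?h ** partial a g y = ?h ** transpose ?G ** ?g + ?G"
      unfolding p by (simp add: matrix_mult_linear matrix_mul_assoc matrix_inv_left i)
    moreover have "trace (?h ** transpose ?G ** ?g) = trace ?G"
      by (subst trace_mul_sym) (simp add: matrix_mul_assoc matrix_inv_right i trace_transpose)
    ultimately show ?thesis by (simp add: trace_add)
  qed
  then have t: "?r * trace (?h ** partial a g y) = 2 * ?\<delta>"
    by (simp add: trace_christoffel add_nonneg_eq_0_iff)
  show 1: "partial a (\<lambda>z. \<bar>det (g z)\<bar> powr ?r) y = 2 * ?\<delta> * ?c"
    unfolding partial_abs_det_powr[OF d i] t[symmetric] by (simp only: mult_ac)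
  have "- (?h ** (transpose ?G ** ?g + ?g ** ?G) ** ?h)
      = - (?h ** transpose ?G ** (?g ** ?h)) - (?h ** ?g) ** ?G ** ?h"
    by (simp only: matrix_mult_linear matrix_mul_assoc) simp
  then have 2: "partial a (\<lambda>z. matrix_inv (g z)) y = - (?h ** transpose ?G) - ?G ** ?h"
    unfolding partial_matrix_inv[OF d i] p by (simp add: matrix_inv_left matrix_inv_right i)
  show "partial a (\<lambda>z. weighted_inverse (g z)) y = (2 * ?\<delta>) *\<^sub>R weighted_inverse ?g
      - ?G ** weighted_inverse ?g - weighted_inverse ?g ** transpose ?G"
    unfolding weighted_inverse_def
    unfolding partial_scaleR[OF abs_det_powr_differentiable[OF d i] matrix_inv_differentiable[OF d i]] 1 2
    by (simp add: matrix_mult_linear scaleR_diff_right)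
qed

text \<open>Lowering an index of the difference gives an array \<open>L\<close> that is symmetric in
  its first two indices by torsion-freeness and skew in its last two by metricity; such an array
  vanishes.\<close>

lemma levi_civita_unique_at:
  fixes G G' :: "real^'n^'n^'n" and g :: "real^'n^'n"
  assumes g: "transpose g = g" "invertible g"
    and sym: "\<And>a b c. G $ a $ b $ c = G $ c $ b $ a" "\<And>a b c. G' $ a $ b $ c = G' $ c $ b $ a"
    and eq: "\<And>a. transpose (G $ a) ** g + g ** G $ a = transpose (G' $ a) ** g + g ** G' $ a"
  shows "G = G'"
proof -
  define L where "L a b c = (transpose (G $ a - G' $ a) ** g) $ b $ c" for a b c
  have g': "g $ b $ c = g $ c $ b" for b c
    using arg_cong[OF g(1), of "\<lambda>A. A $ c $ b"] by (simp add: transpose_def)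
  have s: "L a b c = L b a c" for a b c
    unfolding L_def
    by (simp add: transpose_def matrix_matrix_mult_def sym(1)[of a _ b] sym(2)[of a _ b])
  have "transpose (G $ a - G' $ a) ** g + g ** (G $ a - G' $ a) = 0" for a
    using eq[of a] linear_diff[OF bounded_linear.linear[OF bounded_linear_transpose], of "G $ a" "G' $ a"]
    by (simp add: matrix_mult_linear add_diff_add[symmetric])
  moreover have "(g ** (G $ a - G' $ a)) $ b $ c = L a c b" for a b c
    unfolding L_def by (simp add: transpose_def matrix_matrix_mult_def g'[of b] mult.commute)
  ultimately have "L a b c + L a c b = 0" for a b c
    unfolding L_def by (metis vector_add_component zero_index)
  \<comment> \<open>Alternating the symmetry and the skew symmetry returns to the same index order
    after three sign changes.\<close>
  then have "L a b c = 0" for a b c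
    using s by (smt (verit))
  then have "transpose (G $ a - G' $ a) ** g = 0" for a
    by (simp add: vec_eq_iff L_def)
  then have "transpose (G $ a - G' $ a) ** (g ** matrix_inv g) = 0" for a
    by (simp only: matrix_mul_assoc) (simp add: matrix_matrix_mult_def vec_eq_iff)
  then have "transpose (G $ a - G' $ a) = 0" for a
    by (simp add: matrix_inv_right g)
  then show ?thesis by (simp add: vec_eq_iff transpose_def)
qed

section \<open>Projective invariance of the tractor connection\<close>

lemma mult_if_one:
  fixes x :: real
  shows "(if P then 1 else 0) * x = (if P then x else 0)" "x * (if P then 1 else 0) = (if P then x else 0)"
  by simp_all

text \<open>Torsion-freeness removes the correction terms for the lower index of \<nabla>Y from the
  antisymmetrised second derivative.\<close>

lemma ricci_explicit:
  fixes \<Gamma> :: "'n::finite christoffel"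
  assumes d: "\<Gamma> differentiable (at y)" and sym: "\<And>a b c. \<Gamma> y $ a $ b $ c = \<Gamma> y $ c $ b $ a"
  shows "ricci \<Gamma> y $ a $ b = (\<Sum>c\<in>UNIV. partial c \<Gamma> y $ a $ c $ b) - (\<Sum>c\<in>UNIV. partial a \<Gamma> y $ c $ c $ b)
    + (\<Sum>e\<in>UNIV. (\<Sum>c\<in>UNIV. \<Gamma> y $ c $ c $ e) * \<Gamma> y $ a $ e $ b)
    - (\<Sum>c\<in>UNIV. \<Sum>e\<in>UNIV. \<Gamma> y $ a $ c $ e * \<Gamma> y $ c $ e $ b)"
proof -
  \<comment> \<open>A coordinate field has constant components, so its covariant derivative is a
    slice of the Christoffel symbols.\<close>
  have v: "nabla_vec \<Gamma> (\<lambda>_. axis d 1) = (\<lambda>z. \<chi> a b. \<Gamma> z $ a $ b $ d)" for d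
    by (auto simp: fun_eq_iff nabla_vec_def vec_eq_iff partial_const axis_def if_distrib sum.delta
        cong: if_cong)
  have dT: "(\<lambda>z. \<chi> a b. \<Gamma> z $ a $ b $ d) differentiable (at y)" for d
    by (intro vec_lambda_differentiable vec_nth_differentiable d)
  have p: "partial e (\<lambda>z. \<chi> a b. \<Gamma> z $ a $ b $ d) y $ a $ b = partial e \<Gamma> y $ a $ b $ d" for a b d e
  proof -
    have "partial e (\<lambda>z. \<chi> a b. \<Gamma> z $ a $ b $ d) y $ a $ b
        = partial e (\<lambda>z. (\<chi> a b. \<Gamma> z $ a $ b $ d) $ a $ b) y"
      by (simp only: partial_vec_nth dT vec_nth_differentiable)
    also have "\<dots> = partial e (\<lambda>z. \<Gamma> z $ a $ b $ d) y" by simp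
    finally show ?thesis by (simp only: partial_vec_nth d vec_nth_differentiable)
  qed
  have "curvature \<Gamma> y $ c $ a $ c $ b = partial c \<Gamma> y $ a $ c $ b - partial a \<Gamma> y $ c $ c $ b
      + (\<Sum>e\<in>UNIV. \<Gamma> y $ c $ c $ e * \<Gamma> y $ a $ e $ b)
      - (\<Sum>e\<in>UNIV. \<Gamma> y $ a $ c $ e * \<Gamma> y $ c $ e $ b)" for c
    unfolding curvature_def nabla_endo_def by (simp add: v p sym[of c _ a])
  then show ?thesis
    unfolding ricci_def by (simp add: sum.distrib sum_subtractf sum_distrib_right sum.swap[of "\<lambda>c e. \<Gamma> y $ c $ c $ e * \<Gamma> y $ a $ e $ b"])
qed

text \<open>The difference tensor has trace n\<Upsilon> + \<Upsilon>, and the weight 1 of the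
  densities was normalised to divide by n + 1. A density symbol can thus be prescribed by the choice
  of \<Upsilon>.\<close>

lemma density_symbol_proj_change:
  fixes \<Gamma> \<Gamma>' :: "'n::finite christoffel"
  assumes "\<And>a b c. \<Gamma>' z $ a $ b $ c = \<Gamma> z $ a $ b $ c
      + \<Upsilon> z $ a * (if b = c then 1 else 0) + \<Upsilon> z $ c * (if a = b then 1 else 0)"
  shows "density_symbol 1 \<Gamma>' z = density_symbol 1 \<Gamma> z + \<Upsilon> z"
  by (simp add: density_symbol_def vec_eq_iff assms sum.distrib mult_if_one sum.delta
      field_simps add_nonneg_eq_0_iff)

lemma tractor_nabla_eq:
  assumes "\<And>z. to_splitting \<Gamma> z (U z) = (\<mu> z, \<sigma> z)"
  shows "tractor_nabla \<Gamma> a U y = of_splitting \<Gamma> y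
    (\<chi> b. nabla_form 1 \<Gamma> \<mu> y $ a $ b + schouten \<Gamma> y $ a $ b * \<sigma> y,
     nabla_density 1 \<Gamma> \<sigma> y $ a - \<mu> y $ a)"
  by (simp add: tractor_nabla_def assms)

text \<open>The difference tensor of two projectively equivalent connections, as a linear map of
  \<Upsilon> so that smoothness and derivatives pass through it.\<close>

definition change_term :: "real^'n \<Rightarrow> real^'n^'n^'n::finite" where
  "change_term u = (\<chi> a b c. u $ a * (if b = c then 1 else 0) + u $ c * (if a = b then 1 else 0))"

lemma bounded_linear_change_term: "bounded_linear change_term"
  unfolding linear_conv_bounded_linear[symmetric] linear_iff
  by (auto simp: vec_eq_iff change_term_def algebra_simps)

text \<open>The change is prescribed on a neighbourhood because curvature differentiates the
  Christoffel symbols; differentiability and symmetry concern the single point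
  \<open>y\<close>.\<close>

locale proj_change =
  fixes S :: "(real^'n::finite) set" and \<Gamma> \<Gamma>' :: "'n christoffel" and \<Upsilon> :: "real^'n \<Rightarrow> real^'n"
    and y :: "real^'n"
  assumes S: "open S" "y \<in> S"
    and d\<Gamma>: "\<Gamma> differentiable (at y)" and d\<Upsilon>: "\<Upsilon> differentiable (at y)"
    and sym: "\<And>a b c. \<Gamma> y $ a $ b $ c = \<Gamma> y $ c $ b $ a"
    and change: "\<And>z a b c. z \<in> S \<Longrightarrow> \<Gamma>' z $ a $ b $ c = \<Gamma> z $ a $ b $ c
      + \<Upsilon> z $ a * (if b = c then 1 else 0) + \<Upsilon> z $ c * (if a = b then 1 else 0)"
begin

lemma change': "z \<in> S \<Longrightarrow> \<Gamma>' z = \<Gamma> z + change_term (\<Upsilon> z)"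
  by (simp add: vec_eq_iff change_term_def change)

lemma d_term: "(\<lambda>z. change_term (\<Upsilon> z)) differentiable (at y)"
  by (rule bounded_linear_differentiable[OF bounded_linear_change_term d\<Upsilon>])

lemma d\<Gamma>': "\<Gamma>' differentiable (at y)"
  using differentiable_add[OF d\<Gamma> d_term] change' has_derivative_transform_within_open[OF _ S]
  unfolding differentiable_def by (metis (no_types, lifting))

lemma partial_change:
  "partial d \<Gamma>' y $ a $ b $ c = partial d \<Gamma> y $ a $ b $ c
    + partial d \<Upsilon> y $ a * (if b = c then 1 else 0) + partial d \<Upsilon> y $ c * (if a = b then 1 else 0)"
proof -
  have "partial d (\<lambda>z. \<Gamma> z + change_term (\<Upsilon> z)) y = partial d \<Gamma>' y"
    using change' by (intro partial_cong[OF S] differentiable_add d\<Gamma> d_term) simp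
  then have "partial d \<Gamma>' y = partial d \<Gamma> y + change_term (partial d \<Upsilon> y)"
    by (simp add: partial_add[OF d\<Gamma> d_term] partial_bounded_linear[OF bounded_linear_change_term d\<Upsilon>])
  then show ?thesis by (simp add: change_term_def)
qed

definition nabla_\<Upsilon> :: "'n \<Rightarrow> 'n \<Rightarrow> real" where
  "nabla_\<Upsilon> a b = partial a \<Upsilon> y $ b - (\<Sum>c\<in>UNIV. \<Gamma> y $ a $ c $ b * \<Upsilon> y $ c)"

text \<open>Each contraction with the difference tensor reduces to the trace \<open>t\<close> or to
  \<open>s\<close>. The products of \<open>t\<close> and \<Upsilon> cancel between \<open>3\<close>
  and \<open>4\<close>, and the remaining multiples of \<open>s\<close> are those that complete the
  partial derivatives of \<Upsilon> to covariant ones.\<close>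

lemma ricci_change:
  "ricci \<Gamma>' y $ a $ b = ricci \<Gamma> y $ a $ b + nabla_\<Upsilon> b a - real CARD('n) * nabla_\<Upsilon> a b
    + (real CARD('n) - 1) * (\<Upsilon> y $ a * \<Upsilon> y $ b)"
proof -
  let ?n = "real CARD('n)"
  define t where "t e = (\<Sum>c\<in>UNIV. \<Gamma> y $ c $ c $ e)" for e
  define s where "s = (\<Sum>c\<in>UNIV. \<Gamma> y $ a $ c $ b * \<Upsilon> y $ c)"
  note chg = change[OF S(2)]
  have sym': "\<Gamma>' y $ a $ b $ c = \<Gamma>' y $ c $ b $ a" for a b c
    by (simp add: chg sym[of a b c])
  have s': "s = (\<Sum>c\<in>UNIV. \<Gamma> y $ b $ c $ a * \<Upsilon> y $ c)"
    unfolding s_def by (simp add: sym[of a _ b])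
  have t': "t e = (\<Sum>c\<in>UNIV. \<Gamma> y $ e $ c $ c)" for e
    unfolding t_def by (simp add: sym[of _ _ e])
  have 1: "(\<Sum>c\<in>UNIV. partial c \<Gamma>' y $ a $ c $ b) = (\<Sum>c\<in>UNIV. partial c \<Gamma> y $ a $ c $ b)
      + partial b \<Upsilon> y $ a + partial a \<Upsilon> y $ b"
    by (simp add: partial_change sum.distrib mult_if_one sum.delta)
  have 2: "(\<Sum>c\<in>UNIV. partial a \<Gamma>' y $ c $ c $ b) = (\<Sum>c\<in>UNIV. partial a \<Gamma> y $ c $ c $ b)
      + (?n + 1) * partial a \<Upsilon> y $ b"
    by (simp add: partial_change sum.distrib mult_if_one sum.delta algebra_simps)
  have t'': "(\<Sum>c\<in>UNIV. \<Gamma>' y $ c $ c $ e) = t e + (?n + 1) * \<Upsilon> y $ e" for e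
    by (simp add: t_def chg sum.distrib mult_if_one sum.delta algebra_simps)
  have 3: "(\<Sum>e\<in>UNIV. (\<Sum>c\<in>UNIV. \<Gamma>' y $ c $ c $ e) * \<Gamma>' y $ a $ e $ b)
      = (\<Sum>e\<in>UNIV. t e * \<Gamma> y $ a $ e $ b) + t b * \<Upsilon> y $ a + t a * \<Upsilon> y $ b
        + (?n + 1) * s + 2 * (?n + 1) * (\<Upsilon> y $ a * \<Upsilon> y $ b)"
  proof -
    have "(t e + (?n + 1) * \<Upsilon> y $ e) * \<Gamma>' y $ a $ e $ b
        = t e * \<Gamma> y $ a $ e $ b + (?n + 1) * (\<Gamma> y $ a $ e $ b * \<Upsilon> y $ e)
          + (if e = b then (t b + (?n + 1) * \<Upsilon> y $ b) * \<Upsilon> y $ a else 0)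
          + (if a = e then (t a + (?n + 1) * \<Upsilon> y $ a) * \<Upsilon> y $ b else 0)" for e
      by (auto simp: chg algebra_simps)
    then show ?thesis
      by (simp add: t'' sum.distrib sum.delta s_def sum_distrib_left[symmetric])
        (simp add: algebra_simps)
  qed
  have 4: "(\<Sum>c\<in>UNIV. \<Sum>e\<in>UNIV. \<Gamma>' y $ a $ c $ e * \<Gamma>' y $ c $ e $ b)
      = (\<Sum>c\<in>UNIV. \<Sum>e\<in>UNIV. \<Gamma> y $ a $ c $ e * \<Gamma> y $ c $ e $ b) + 2 * s
        + t a * \<Upsilon> y $ b + t b * \<Upsilon> y $ a + (?n + 3) * (\<Upsilon> y $ a * \<Upsilon> y $ b)"
  proof -
    \<comment> \<open>Nine products of one summand from each factor, sorted by the Kronecker deltas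
      they carry. The purely quadratic ones sum to n + 1 + 1 + 1 times \<Upsilon>\<Upsilon>.\<close>
    have "\<Gamma>' y $ a $ c $ e * \<Gamma>' y $ c $ e $ b = \<Gamma> y $ a $ c $ e * \<Gamma> y $ c $ e $ b
        + (if e = b then \<Gamma> y $ a $ c $ b * \<Upsilon> y $ c else 0)
        + (if c = e then \<Gamma> y $ a $ c $ c * \<Upsilon> y $ b + \<Upsilon> y $ a * \<Gamma> y $ c $ c $ b + \<Upsilon> y $ a * \<Upsilon> y $ b else 0)
        + (if c = e then if b = c then \<Upsilon> y $ a * \<Upsilon> y $ b else 0 else 0)
        + (if a = c then \<Gamma> y $ a $ e $ b * \<Upsilon> y $ e else 0)
        + (if a = c then if e = b then \<Upsilon> y $ a * \<Upsilon> y $ b else 0 else 0)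
        + (if a = c then if c = e then \<Upsilon> y $ a * \<Upsilon> y $ b else 0 else 0)" for c e
      by (auto simp: chg algebra_simps)
    moreover have "(\<Sum>e\<in>UNIV. if a = c then f e else 0) = (if a = c then \<Sum>e\<in>UNIV. f e else (0::real))"
      for f :: "'n \<Rightarrow> real" and c by simp
    ultimately show ?thesis
      by (simp add: sum.distrib sum.delta s_def[symmetric])
        (simp add: t_def[symmetric] t'[symmetric] sum_distrib_left[symmetric] sum_distrib_right[symmetric]
          s_def[symmetric] algebra_simps)
  qed
  show ?thesis
    unfolding ricci_explicit[OF d\<Gamma> sym] ricci_explicit[OF d\<Gamma>' sym'] 1 2 3 4 nabla_\<Upsilon>_def
      t_def[symmetric] s_def[symmetric] s'[symmetric]
    by (simp add: algebra_simps)
qed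

text \<open>In \<open>n Ric_ab + Ric_ba\<close> the two derivatives of \<Upsilon> combine to 1 -
  \<open>n^2\<close> times one of them, and the quadratic terms to (n - 1)(n + 1); both match the
  denominator.\<close>

lemma schouten_change:
  assumes n: "2 \<le> CARD('n)"
  shows "schouten \<Gamma>' y $ a $ b = schouten \<Gamma> y $ a $ b - nabla_\<Upsilon> a b + \<Upsilon> y $ a * \<Upsilon> y $ b"
proof -
  let ?n = "real CARD('n)"
  have "1 < ?n\<^sup>2" using n by (simp add: one_less_power)
  then have "?n\<^sup>2 - 1 \<noteq> 0" by simp
  then show ?thesis
    unfolding schouten_explicit[OF n]
    by (simp add: ricci_change field_simps power2_eq_square)
qed

text \<open>A section is fixed as a jet, so only its components move, by \<sigma>\<Upsilon> in the
  first slot. The first slot of the derivative then moves by \<Upsilon> times \<open>s\<close>, the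
  second slot of that same derivative, which is precisely what passing back through
  \<open>of_splitting\<close> removes.\<close>

lemma tractor_nabla_change:
  assumes n: "2 \<le> CARD('n)" and dU: "U differentiable (at y)"
    and d\<delta>: "density_symbol 1 \<Gamma> differentiable (at y)"
  shows "tractor_nabla \<Gamma>' a U y = tractor_nabla \<Gamma> a U y"
proof -
  define \<mu> \<mu>' \<sigma> where "\<mu> z = fst (U z) + snd (U z) *\<^sub>R density_symbol 1 \<Gamma> z"
    and "\<mu>' z = fst (U z) + snd (U z) *\<^sub>R density_symbol 1 \<Gamma>' z" and "\<sigma> z = snd (U z)" for z
  note chg = change[OF S(2)]
  have dens: "density_symbol 1 \<Gamma>' z = density_symbol 1 \<Gamma> z + \<Upsilon> z" if "z \<in> S" for z
    using density_symbol_proj_change[of \<Gamma>' z \<Gamma> \<Upsilon>] change[OF that] by blast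
  have d\<sigma>: "\<sigma> differentiable (at y)"
    unfolding \<sigma>_def[abs_def] by (rule bounded_linear_differentiable[OF bounded_linear_snd dU])
  have d\<mu>: "\<mu> differentiable (at y)"
    unfolding \<mu>_def[abs_def]
    by (intro differentiable_add bounded_linear_differentiable[OF bounded_linear_fst dU]
        bounded_bilinear_differentiable[OF bounded_bilinear_scaleR] d\<delta>
        bounded_linear_differentiable[OF bounded_linear_snd dU])
  have d\<sigma>\<Upsilon>: "(\<lambda>z. \<sigma> z *\<^sub>R \<Upsilon> z) differentiable (at y)"
    by (intro bounded_bilinear_differentiable[OF bounded_bilinear_scaleR] d\<sigma> d\<Upsilon>)
  have \<mu>': "\<mu> z + \<sigma> z *\<^sub>R \<Upsilon> z = \<mu>' z" if "z \<in> S" for z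
    by (simp add: \<mu>_def \<mu>'_def \<sigma>_def dens[OF that] algebra_simps)
  have "partial a (\<lambda>z. \<mu> z + \<sigma> z *\<^sub>R \<Upsilon> z) y = partial a \<mu>' y"
    by (intro partial_cong[OF S] differentiable_add d\<mu> d\<sigma>\<Upsilon>) (simp add: \<mu>')
  then have p\<mu>': "partial a \<mu>' y = partial a \<mu> y + \<sigma> y *\<^sub>R partial a \<Upsilon> y + partial a \<sigma> y *\<^sub>R \<Upsilon> y"
    by (simp add: partial_add[OF d\<mu> d\<sigma>\<Upsilon>] partial_scaleR[OF d\<sigma> d\<Upsilon>] add_ac)
  define s where "s = nabla_density 1 \<Gamma> \<sigma> y $ a - \<mu> y $ a"
  have s': "nabla_density 1 \<Gamma>' \<sigma> y $ a - \<mu>' y $ a = s"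
    unfolding s_def nabla_density_def by (simp add: dens[OF S(2)] \<mu>'[OF S(2), symmetric] algebra_simps)
  have form: "nabla_form 1 \<Gamma>' \<mu>' y $ a $ b + schouten \<Gamma>' y $ a $ b * \<sigma> y
      = nabla_form 1 \<Gamma> \<mu> y $ a $ b + schouten \<Gamma> y $ a $ b * \<sigma> y + \<Upsilon> y $ b * s" for b
  proof -
    have "(\<Sum>c\<in>UNIV. \<Gamma>' y $ a $ c $ b * \<mu>' y $ c)
        = (\<Sum>c\<in>UNIV. \<Gamma> y $ a $ c $ b * \<mu> y $ c) + \<sigma> y * (\<Sum>c\<in>UNIV. \<Gamma> y $ a $ c $ b * \<Upsilon> y $ c)
          + \<Upsilon> y $ a * \<mu>' y $ b + \<Upsilon> y $ b * \<mu>' y $ a"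
    proof -
      have "\<Gamma>' y $ a $ c $ b * \<mu>' y $ c = \<Gamma> y $ a $ c $ b * \<mu> y $ c + \<sigma> y * (\<Gamma> y $ a $ c $ b * \<Upsilon> y $ c)
          + (if c = b then \<Upsilon> y $ a * \<mu>' y $ b else 0) + (if a = c then \<Upsilon> y $ b * \<mu>' y $ a else 0)" for c
        by (auto simp: chg \<mu>'[OF S(2), symmetric] algebra_simps)
      then show ?thesis by (simp add: sum.distrib sum.delta sum_distrib_left)
    qed
    then show ?thesis
      unfolding nabla_form_def s_def nabla_density_def
      by (simp add: schouten_change[OF n] p\<mu>' dens[OF S(2)] \<mu>'[OF S(2), symmetric] nabla_\<Upsilon>_def algebra_simps)
  qed
  have "tractor_nabla \<Gamma>' a U y = of_splitting \<Gamma>' y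
      (\<chi> b. nabla_form 1 \<Gamma>' \<mu>' y $ a $ b + schouten \<Gamma>' y $ a $ b * \<sigma> y, s)"
    unfolding s'[symmetric] by (rule tractor_nabla_eq) (simp add: to_splitting_def \<mu>'_def \<sigma>_def)
  also have "\<dots> = of_splitting \<Gamma> y
      (\<chi> b. nabla_form 1 \<Gamma> \<mu> y $ a $ b + schouten \<Gamma> y $ a $ b * \<sigma> y, s)"
    unfolding form by (simp add: of_splitting_def dens[OF S(2)] vec_eq_iff algebra_simps)
  also have "\<dots> = tractor_nabla \<Gamma> a U y"
    unfolding s_def
    by (rule tractor_nabla_eq[symmetric]) (simp add: to_splitting_def \<mu>_def \<sigma>_def)
  finally show ?thesis .
qed

end

section \<open>Parallel sub-metrics in an adapted splitting\<close>

text \<open>The pairs \<open>(- \<theta>, 1)\<close> span a complement of \<open>\<E>\<^sub>a(1)\<close>, here made orthogonal to it.  The splitting of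
  a connection corresponds to the complement given by its density symbol.\<close>

definition diag_form :: "real^'n^'n \<Rightarrow> real^'n \<Rightarrow> real \<Rightarrow> 'n::finite cotractor \<Rightarrow> 'n cotractor \<Rightarrow> real" where
  "diag_form \<zeta> \<theta> \<tau> U V =
    (fst U + snd U *\<^sub>R \<theta>) \<bullet> (\<zeta> *v (fst V + snd V *\<^sub>R \<theta>)) + \<tau> * snd U * snd V"

lemma diag_form_density_symbol:
  "diag_form \<zeta> (density_symbol 1 \<Gamma> y) \<tau> U V =
    fst (to_splitting \<Gamma> y U) \<bullet> (\<zeta> *v fst (to_splitting \<Gamma> y V))
    + \<tau> * snd (to_splitting \<Gamma> y U) * snd (to_splitting \<Gamma> y V)"
  by (simp add: diag_form_def to_splitting_def)

lemma submetric_coeffs_diag_form: "submetric_coeffs (diag_form \<zeta> \<theta> \<tau>) = \<zeta>"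
  by (simp add: submetric_coeffs_def diag_form_def vec_eq_iff inner_axis' matrix_vector_mult_basis
      column_def)

text \<open>The decomposition is unique: \<zeta> is read off the sub-bundle, \<theta> off mixed
  pairs because \<zeta> is invertible, and \<tau> off \<open>(- \<theta>, 1)\<close>, on which the
  first summand vanishes.\<close>

lemma diag_form_eqD:
  assumes "diag_form \<zeta> \<theta> \<tau> = diag_form \<zeta>' \<theta>' \<tau>'" "invertible \<zeta>"
  shows "\<zeta> = \<zeta>'" "\<theta> = \<theta>'" "\<tau> = \<tau>'"
proof -
  show \<zeta>: "\<zeta> = \<zeta>'"
    using submetric_coeffs_diag_form[of \<zeta> \<theta> \<tau>] submetric_coeffs_diag_form[of \<zeta>' \<theta>' \<tau>'] assms(1) by simp
  have "axis b 1 \<bullet> (\<zeta> *v \<theta>) = axis b 1 \<bullet> (\<zeta> *v \<theta>')" for b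
    using fun_cong[OF fun_cong[OF assms(1)], of "(axis b 1, 0)" "(0, 1)"]
    by (simp add: diag_form_def \<zeta>[symmetric])
  then have "\<zeta> *v \<theta> = \<zeta> *v \<theta>'" by (simp add: vec_eq_iff inner_axis')
  then show \<theta>: "\<theta> = \<theta>'"
    using inj_matrix_vector_mult[OF assms(2)] by (simp add: inj_eq)
  show "\<tau> = \<tau>'"
    using fun_cong[OF fun_cong[OF assms(1)], of "(- \<theta>, 1)" "(- \<theta>, 1)"]
    by (simp add: diag_form_def \<theta>[symmetric])
qed

lemma transpose_eq_nth: "transpose A = (A::'a^'n^'n) \<Longrightarrow> A $ i $ j = A $ j $ i"
proof -
  assume eq: "transpose A = A"
  have "transpose A $ i $ j = A $ j $ i" by (simp add: transpose_def)
  then show ?thesis by (simp only: eq)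
qed

lemma inner_matrix_vector_transpose: "x \<bullet> ((A::real^'n^'m) *v y) = (transpose A *v x) \<bullet> y"
  by (simp add: dot_lmul_matrix)

lemma axis_Pair_expansion: "(m, 0::real) = (\<Sum>a\<in>UNIV. m $ a *\<^sub>R (axis a 1, 0))" for m :: "real^'n"
proof -
  have "(\<Sum>a\<in>UNIV. m $ a *\<^sub>R (axis a (1::real), 0::real)) = (\<Sum>a\<in>UNIV. m $ a *\<^sub>R axis a 1, 0)"
    by (simp add: prod_eq_iff fst_sum snd_sum)
  also have "\<dots> = (m, 0)" using basis_expansion[of m] by (simp add: scalar_mult_eq_scaleR)
  finally show ?thesis by (rule HOL.sym)
qed

lemma bilinear_form_on_subbundle:
  fixes H :: "'n::finite cotractor \<Rightarrow> 'n cotractor \<Rightarrow> real"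
  assumes "bilinear H"
  shows "H (m, 0) (\<nu>, 0) = m \<bullet> (submetric_coeffs H *v \<nu>)"
proof -
  interpret H: bounded_bilinear H
    using assms by (simp add: bilinear_conv_bounded_bilinear)
  show ?thesis
    unfolding axis_Pair_expansion[of m] axis_Pair_expansion[of \<nu>]
    unfolding H.sum_left
    unfolding H.sum_right
    unfolding H.scaleR_left H.scaleR_right
    by (simp add: inner_vec_def matrix_vector_mult_def submetric_coeffs_def sum_distrib_left mult_ac)
qed

text \<open>Completing the square: the choice of \<theta> makes \<open>(- \<theta>, 1)\<close>
  orthogonal to the sub-bundle, and every cotractor splits into a part in the sub-bundle and a
  multiple of this vector.\<close>

lemma bilinear_eq_diag_form:
  fixes H :: "'n::finite cotractor \<Rightarrow> 'n cotractor \<Rightarrow> real"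
  assumes bil: "bilinear H" and sym: "\<And>U V. H U V = H V U"
    and inv: "invertible (submetric_coeffs H)"
    and \<theta>: "\<theta> = matrix_inv (submetric_coeffs H) *v (\<chi> b. H (axis b 1, 0) (0, 1))"
  shows "H = diag_form (submetric_coeffs H) \<theta> (H (- \<theta>, 1) (- \<theta>, 1))"
proof -
  let ?\<zeta> = "submetric_coeffs H"
  interpret H: bounded_bilinear H
    using bil by (simp add: bilinear_conv_bounded_bilinear)
  note 1 = bilinear_form_on_subbundle[OF bil]
  have 2: "H (m, 0) (0, 1) = m \<bullet> (\<chi> b. H (axis b 1, 0) (0, 1))" for m
    unfolding axis_Pair_expansion[of m] H.sum_left H.scaleR_left by (simp add: inner_vec_def)
  have \<theta>': "?\<zeta> *v \<theta> = (\<chi> b. H (axis b 1, 0) (0, 1))"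
    unfolding \<theta> by (simp add: matrix_vector_mul_assoc matrix_inv_right inv)
  have 3: "H (m, 0) (- \<theta>, 1) = 0" for m
  proof -
    have "H (m, 0) (- \<theta>, 1) = H (m, 0) (- \<theta>, 0) + H (m, 0) (0, 1)"
      using H.add_right[of "(m, 0)" "(- \<theta>, 0)" "(0, 1)"] by simp
    also have "\<dots> = m \<bullet> (?\<zeta> *v (- \<theta>)) + m \<bullet> (?\<zeta> *v \<theta>)"
      by (simp only: 1 2[of m] \<theta>')
    also have "?\<zeta> *v (- \<theta>) = - (?\<zeta> *v \<theta>)"
      by (rule matrix_vector_linear)
    finally show ?thesis by simp
  qed
  have dec: "U = (fst U + snd U *\<^sub>R \<theta>, 0) + snd U *\<^sub>R (- \<theta>, 1)" for U :: "'n cotractor"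
    by (simp add: prod_eq_iff)
  have 4: "H (- \<theta>, 1) (m, 0) = 0" for m
    using 3 sym by simp
  have "H U V = diag_form ?\<zeta> \<theta> (H (- \<theta>, 1) (- \<theta>, 1)) U V" for U V
  proof -
    let ?u = "fst U + snd U *\<^sub>R \<theta>" and ?v = "fst V + snd V *\<^sub>R \<theta>"
    have "H U V = H ((?u, 0) + snd U *\<^sub>R (- \<theta>, 1)) ((?v, 0) + snd V *\<^sub>R (- \<theta>, 1))"
      by (simp only: dec[symmetric])
    also have "\<dots> = ?u \<bullet> (?\<zeta> *v ?v) + snd U * (snd V * H (- \<theta>, 1) (- \<theta>, 1))"
      unfolding H.add_left H.add_right H.scaleR_left H.scaleR_right 1 3 4 by simp
    finally show ?thesis by (simp add: diag_form_def)
  qed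
  then show ?thesis by blast
qed

text \<open>The derivatives of \<open>U\<close> and \<open>V\<close> cancel, so the defect is a form
  in their values with three components. In the mixed one, \<tau> comes from the term -\<mu> of the
  tractor connection and \<zeta>P from its Schouten term; in the other two, 2\<delta> comes from the
  weights of the two arguments.\<close>

lemma tractor_leibniz:
  fixes \<Gamma> :: "'n::finite christoffel"
  assumes dU: "U differentiable (at y)" and dV: "V differentiable (at y)"
    and d\<delta>: "density_symbol 1 \<Gamma> differentiable (at y)"
    and d\<zeta>: "\<zeta> differentiable (at y)" and d\<tau>: "\<tau> differentiable (at y)"
    and sym: "transpose (\<zeta> y) = \<zeta> y"
    and U: "to_splitting \<Gamma> y (U y) = (\<mu>, \<sigma>)" and V: "to_splitting \<Gamma> y (V y) = (\<nu>, \<rho>)"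
  defines "h \<equiv> \<lambda>z. diag_form (\<zeta> z) (density_symbol 1 \<Gamma> z) (\<tau> z)"
  shows "partial a (\<lambda>z. h z (U z) (V z)) y
      - (h y (tractor_nabla \<Gamma> a U y) (V y) + h y (U y) (tractor_nabla \<Gamma> a V y))
    = \<mu> \<bullet> ((partial a \<zeta> y - ((2 * density_symbol 1 \<Gamma> y $ a) *\<^sub>R \<zeta> y
          - \<Gamma> y $ a ** \<zeta> y - \<zeta> y ** transpose (\<Gamma> y $ a))) *v \<nu>)
      + (\<tau> y *\<^sub>R axis a 1 - \<zeta> y *v schouten \<Gamma> y $ a) \<bullet> (\<rho> *\<^sub>R \<mu> + \<sigma> *\<^sub>R \<nu>)
      + (partial a \<tau> y - 2 * density_symbol 1 \<Gamma> y $ a * \<tau> y) * \<sigma> * \<rho>"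
proof -
  define m where "m U z = fst (to_splitting \<Gamma> z (U z))" for U :: "real^'n \<Rightarrow> 'n cotractor" and z
  define s where "s U z = snd (to_splitting \<Gamma> z (U z))" for U :: "real^'n \<Rightarrow> 'n cotractor" and z
  let ?G = "\<Gamma> y $ a" and ?\<delta> = "density_symbol 1 \<Gamma> y $ a" and ?P = "schouten \<Gamma> y $ a"
  have dm: "m W differentiable (at y)" and ds: "s W differentiable (at y)"
    if "W differentiable (at y)" for W
  proof -
    show ds: "s W differentiable (at y)"
      unfolding s_def[abs_def] to_splitting_def snd_conv
      by (rule bounded_linear_differentiable[OF bounded_linear_snd that])
    show "m W differentiable (at y)"
      unfolding m_def[abs_def] to_splitting_def fst_conv
      by (intro differentiable_add bounded_linear_differentiable[OF bounded_linear_fst that]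
        bounded_bilinear_differentiable[OF bounded_bilinear_scaleR] d\<delta>
        bounded_linear_differentiable[OF bounded_linear_snd that])
  qed
  have val: "m U y = \<mu>" "s U y = \<sigma>" "m V y = \<nu>" "s V y = \<rho>"
    using U V by (simp_all add: m_def s_def)
  have nab: "to_splitting \<Gamma> y (tractor_nabla \<Gamma> a W y) =
      (partial a (m W) y - transpose ?G *v m W y + ?\<delta> *\<^sub>R m W y + s W y *\<^sub>R ?P,
       partial a (s W) y + ?\<delta> * s W y - m W y $ a)" for W
  proof -
    have "tractor_nabla \<Gamma> a W y = of_splitting \<Gamma> y
       (\<chi> b. nabla_form 1 \<Gamma> (m W) y $ a $ b + schouten \<Gamma> y $ a $ b * s W y,
        nabla_density 1 \<Gamma> (s W) y $ a - m W y $ a)"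
      by (rule tractor_nabla_eq) (simp add: m_def s_def)
    then show ?thesis
      by (simp add: nabla_form_def nabla_density_def vec_eq_iff transpose_def matrix_vector_mult_def
          del: transpose_matrix_vector)
  qed
  have hh: "h z (W z) (X z) = m W z \<bullet> (\<zeta> z *v m X z) + \<tau> z * s W z * s X z" for z W X
    unfolding h_def diag_form_density_symbol m_def s_def by simp
  have hy: "h y W X = fst (to_splitting \<Gamma> y W) \<bullet> (\<zeta> y *v fst (to_splitting \<Gamma> y X))
    + \<tau> y * snd (to_splitting \<Gamma> y W) * snd (to_splitting \<Gamma> y X)" for W X
    unfolding h_def diag_form_density_symbol by simp
  have d1: "(\<lambda>z. \<zeta> z *v m V z) differentiable (at y)"
    by (rule bounded_bilinear_differentiable[OF bounded_bilinear_matrix_vector_mult d\<zeta> dm[OF dV]])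
  have d2: "(\<lambda>z. m U z \<bullet> (\<zeta> z *v m V z)) differentiable (at y)"
    by (rule bounded_bilinear_differentiable[OF bounded_bilinear_inner dm[OF dU] d1])
  have d3: "(\<lambda>z. \<tau> z * s U z) differentiable (at y)"
    by (rule bounded_bilinear_differentiable[OF bounded_bilinear_mult d\<tau> ds[OF dU]])
  have d4: "(\<lambda>z. \<tau> z * s U z * s V z) differentiable (at y)"
    by (rule bounded_bilinear_differentiable[OF bounded_bilinear_mult d3 ds[OF dV]])
  have lhs: "partial a (\<lambda>z. h z (U z) (V z)) y
      = \<mu> \<bullet> (\<zeta> y *v partial a (m V) y + partial a \<zeta> y *v \<nu>) + partial a (m U) y \<bullet> (\<zeta> y *v \<nu>)
        + (\<tau> y * \<sigma> * partial a (s V) y + (\<tau> y * partial a (s U) y + partial a \<tau> y * \<sigma>) * \<rho>)"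
    unfolding hh
    by (simp add: partial_add[OF d2 d4] partial_bilinear[OF bounded_bilinear_inner dm[OF dU] d1]
        partial_bilinear[OF bounded_bilinear_matrix_vector_mult d\<zeta> dm[OF dV]]
        partial_mult[OF d3 ds[OF dV]] partial_mult[OF d\<tau> ds[OF dU]] val)
  have sw: "x \<bullet> (\<zeta> y *v z) = (\<zeta> y *v x) \<bullet> z" for x z
    using inner_matrix_vector_transpose[of x "\<zeta> y" z] sym by simp
  have tr: "(transpose ?G *v x) \<bullet> z = x \<bullet> (?G *v z)" for x z
    by (rule inner_matrix_vector_transpose[symmetric])
  have c1: "h y (tractor_nabla \<Gamma> a U y) (V y)
      = partial a (m U) y \<bullet> (\<zeta> y *v \<nu>) - \<mu> \<bullet> (?G *v (\<zeta> y *v \<nu>)) + ?\<delta> * (\<mu> \<bullet> (\<zeta> y *v \<nu>))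
        + \<sigma> * ((\<zeta> y *v ?P) \<bullet> \<nu>) + \<tau> y * (partial a (s U) y + ?\<delta> * \<sigma> - \<mu> $ a) * \<rho>"
    unfolding hy nab V val by (simp add: inner_add_left inner_diff_left tr sw[of ?P] del: transpose_matrix_vector)
  have c2: "h y (U y) (tractor_nabla \<Gamma> a V y)
      = \<mu> \<bullet> (\<zeta> y *v partial a (m V) y) - \<mu> \<bullet> (\<zeta> y *v (transpose ?G *v \<nu>)) + ?\<delta> * (\<mu> \<bullet> (\<zeta> y *v \<nu>))
        + \<rho> * (\<mu> \<bullet> (\<zeta> y *v ?P)) + \<tau> y * \<sigma> * (partial a (s V) y + ?\<delta> * \<rho> - \<nu> $ a)"
    unfolding hy nab U val
    by (simp add: matrix_vector_linear inner_add_right inner_diff_right del: transpose_matrix_vector)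
  show ?thesis
    unfolding lhs c1 c2
    by (simp add: matrix_vector_linear inner_add_left inner_diff_left inner_add_right inner_diff_right
        matrix_vector_mul_assoc[symmetric] inner_axis' inner_axis inner_commute[of _ \<mu>]
        del: transpose_matrix_vector) (simp add: algebra_simps)
qed

section \<open>Changes of coordinates\<close>

definition jet_scale :: "('m, 'n::finite) chart \<Rightarrow> ('m, 'n) chart \<Rightarrow> real^'n \<Rightarrow> real" where
  "jet_scale \<phi> \<psi> y = \<bar>det (jac \<phi> \<psi> y)\<bar> powr (1 / (real CARD('n) + 1))"

definition jet_shift :: "('m, 'n::finite) chart \<Rightarrow> ('m, 'n) chart \<Rightarrow> real^'n \<Rightarrow> real^'n" where
  "jet_shift \<phi> \<psi> y =
    (\<chi> a. trace (matrix_inv (jac \<phi> \<psi> y) ** partial a (jac \<phi> \<psi>) y) / (real CARD('n) + 1))"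

text \<open>The change of chart on \<open>J\<^sup>1\<E>(1)\<close>; by Jacobi's formula, \<open>jet_shift\<close> is the logarithmic
  derivative of \<open>jet_scale\<close>.\<close>

definition jet_trans ::
    "('m, 'n::finite) chart \<Rightarrow> ('m, 'n) chart \<Rightarrow> real^'n \<Rightarrow> 'n cotractor \<Rightarrow> 'n cotractor" where
  "jet_trans \<phi> \<psi> y U = jet_scale \<phi> \<psi> y *\<^sub>R
    (transpose (matrix_inv (jac \<phi> \<psi> y)) *v (fst U + snd U *\<^sub>R jet_shift \<phi> \<psi> y), snd U)"

text \<open>The map \<open>jet_trans\<close> shifts before applying the inverse transposed Jacobian;
  moving \<theta> through that Jacobian adds both shifts in one place, so the diagonal shape
  persists. The new \<theta> acquires \<open>jet_shift\<close>, as the symbol of a connection does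
  in \<open>density_symbol_trans\<close>.\<close>

lemma diag_form_jet_trans:
  fixes \<zeta> :: "real^'n^'n" and \<phi> \<psi> :: "('m, 'n::finite) chart"
  assumes "invertible (jac \<phi> \<psi> y)"
  defines "J \<equiv> jac \<phi> \<psi> y" and "c \<equiv> jet_scale \<phi> \<psi> y"
  shows "diag_form \<zeta> \<theta> \<tau> (jet_trans \<phi> \<psi> y U) (jet_trans \<phi> \<psi> y V) =
    diag_form (c\<^sup>2 *\<^sub>R (matrix_inv J ** \<zeta> ** transpose (matrix_inv J)))
      (jet_shift \<phi> \<psi> y + transpose J *v \<theta>) (c\<^sup>2 * \<tau>) U V"
proof -
  let ?K = "matrix_inv J"
  have \<theta>: "\<theta> = transpose ?K *v (transpose J *v \<theta>)"
    using matrix_inv_right[OF assms(1)] unfolding J_def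
    by (simp add: matrix_vector_mul_assoc matrix_transpose_mul[symmetric] del: transpose_matrix_vector)
  have 1: "fst (jet_trans \<phi> \<psi> y W) + snd (jet_trans \<phi> \<psi> y W) *\<^sub>R \<theta>
      = c *\<^sub>R (transpose ?K *v (fst W + snd W *\<^sub>R (jet_shift \<phi> \<psi> y + transpose J *v \<theta>)))" for W
    by (subst (1) \<theta>) (simp add: jet_trans_def J_def[symmetric] c_def[symmetric] matrix_vector_linear
        scaleR_add_right del: transpose_matrix_vector)
  have 2: "(transpose ?K *v u) \<bullet> (\<zeta> *v (transpose ?K *v w)) = u \<bullet> ((?K ** \<zeta> ** transpose ?K) *v w)" for u w
    by (simp add: inner_matrix_vector_transpose[of u ?K] matrix_vector_mul_assoc[symmetric]
        del: transpose_matrix_vector)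
  have 3: "snd (jet_trans \<phi> \<psi> y W) = c * snd W" for W
    by (simp add: jet_trans_def c_def)
  show ?thesis
    unfolding diag_form_def 1 unfolding 3
    by (simp add: matrix_vector_linear 2 power2_eq_square algebra_simps del: transpose_matrix_vector)
qed

lemma abs_det_congruence_powr:
  fixes g J :: "real^'n^'n"
  shows "\<bar>det (transpose J ** g ** J)\<bar> powr r = (\<bar>det J\<bar> powr r)\<^sup>2 * \<bar>det g\<bar> powr r"
proof -
  have "\<bar>det (transpose J ** g ** J)\<bar> = \<bar>det J\<bar> * \<bar>det J\<bar> * \<bar>det g\<bar>"
    by (simp add: det_mul abs_mult)
  then show ?thesis
    by (simp add: powr_mult power2_eq_square del: abs_mult_self_eq)
qed

text \<open>The determinant of the congruence contributes two factors det J, whose root is the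
  square of \<open>jet_scale\<close> that \<open>diag_form_jet_trans\<close> demands.\<close>

lemma weighted_inverse_congruence:
  fixes g J :: "real^'n^'n"
  assumes "invertible J" "invertible g"
  shows "weighted_inverse (transpose J ** g ** J) =
    (\<bar>det J\<bar> powr (1 / (real CARD('n) + 1)))\<^sup>2 *\<^sub>R (matrix_inv J ** weighted_inverse g ** transpose (matrix_inv J))"
proof -
  let ?r = "1 / (real CARD('n) + 1)"
  have iT: "invertible (transpose J)" using assms(1) by (rule transpose_invertible)
  have "matrix_inv (transpose J ** g ** J) = matrix_inv J ** matrix_inv g ** transpose (matrix_inv J)"
    by (simp add: matrix_inv_matrix_mult invertible_mult iT assms transpose_matrix_inv matrix_mul_assoc)
  then show ?thesis
    by (simp add: weighted_inverse_def abs_det_congruence_powr matrix_mult_linear)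
qed

locale atlas =
  fixes A :: "('m::topological_space, 'n::finite) chart set"
  assumes smooth_atlas: "smooth_atlas A"
begin

lemma
  assumes "\<phi> \<in> A"
  shows open_domain: "open (fst \<phi>)" and open_chart_image: "open (chart_image \<phi>)"
    and chart_homeomorphism: "homeomorphism (fst \<phi>) (chart_image \<phi>) (snd \<phi>) (chart_inv \<phi>)"
  using smooth_atlas assms unfolding smooth_atlas_def is_chart_def by auto

lemma ex_chart: "\<exists>\<phi>\<in>A. x \<in> fst \<phi>"
  using smooth_atlas unfolding smooth_atlas_def by blast

lemma chart_image_I: "x \<in> fst \<phi> \<Longrightarrow> snd \<phi> x \<in> chart_image \<phi>"
  by (simp add: chart_image_def)

lemma chart_inv_chart: "\<phi> \<in> A \<Longrightarrow> x \<in> fst \<phi> \<Longrightarrow> chart_inv \<phi> (snd \<phi> x) = x"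
  using chart_homeomorphism by (metis homeomorphism_apply1)

lemma transition_chart: "\<phi> \<in> A \<Longrightarrow> x \<in> fst \<phi> \<Longrightarrow> transition \<phi> \<psi> (snd \<phi> x) = snd \<psi> x"
  by (simp add: transition_def chart_inv_chart)

abbreviation overlap :: "('m, 'n) chart \<Rightarrow> ('m, 'n) chart \<Rightarrow> (real^'n) set" where
  "overlap \<phi> \<psi> \<equiv> snd \<phi> ` (fst \<phi> \<inter> fst \<psi>)"

lemma open_overlap:
  assumes "\<phi> \<in> A" "\<psi> \<in> A"
  shows "open (overlap \<phi> \<psi>)"
proof -
  have "openin (top_of_set (fst \<phi>)) (fst \<phi> \<inter> fst \<psi>)"
    using open_domain[OF assms(2)] by blast
  then have "openin (top_of_set (chart_image \<phi>)) (overlap \<phi> \<psi>)"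
    using homeomorphism_imp_open_map[OF chart_homeomorphism[OF assms(1)]] by blast
  then show ?thesis using open_chart_image[OF assms(1)] openin_open_trans by blast
qed

lemma smooth_transition: "\<phi> \<in> A \<Longrightarrow> \<psi> \<in> A \<Longrightarrow> smooth_on (overlap \<phi> \<psi>) (transition \<phi> \<psi>)"
  using smooth_atlas unfolding smooth_atlas_def by blast

lemma smooth_jac:
  assumes "\<phi> \<in> A" "\<psi> \<in> A"
  shows "smooth_on (overlap \<phi> \<psi>) (jac \<phi> \<psi>)"
  unfolding jacobian_def matrix_def
  by (intro smooth_on_vec_lambda smooth_on_vec_nth smooth_on_frechet_derivative smooth_transition
      open_overlap assms)

end

locale chart_change = atlas A for A :: "('m::topological_space, 'n::finite) chart set" +
  fixes \<phi> \<psi> :: "('m, 'n) chart" and x :: 'm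
  assumes \<phi>: "\<phi> \<in> A" and \<psi>: "\<psi> \<in> A" and x\<phi>: "x \<in> fst \<phi>" and x\<psi>: "x \<in> fst \<psi>"
begin

definition "y = snd \<phi> x"
definition "z = snd \<psi> x"
definition "J = jac \<phi> \<psi> y"

lemma y_overlap: "y \<in> overlap \<phi> \<psi>" and z_overlap: "z \<in> overlap \<psi> \<phi>"
  and y_image: "y \<in> chart_image \<phi>" and z_image: "z \<in> chart_image \<psi>"
  using x\<phi> x\<psi> by (auto simp: y_def z_def chart_image_def)

lemma transition_z: "transition \<psi> \<phi> z = y"
  unfolding y_def z_def using transition_chart[OF \<psi> x\<psi>] .

lemma transition_has_derivative: "(transition \<phi> \<psi> has_derivative (*v) J) (at y)"
  and transition_has_derivative': "(transition \<psi> \<phi> has_derivative (*v) (jac \<psi> \<phi> z)) (at z)"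
  unfolding J_def jacobian_works[symmetric]
  using smooth_on_imp_differentiable smooth_transition[OF \<phi> \<psi>] smooth_transition[OF \<psi> \<phi>]
    y_overlap z_overlap by blast+

lemma jac_inverse: "jac \<psi> \<phi> z ** J = mat 1"
proof -
  have "((\<lambda>w. transition \<psi> \<phi> (transition \<phi> \<psi> w)) has_derivative (\<lambda>v. jac \<psi> \<phi> z *v (J *v v))) (at y)"
  proof (rule has_derivative_compose[OF transition_has_derivative])
    have "transition \<phi> \<psi> y = z"
      unfolding y_def z_def using transition_chart[OF \<phi> x\<phi>] .
    then show "(transition \<psi> \<phi> has_derivative (*v) (jac \<psi> \<phi> z)) (at (transition \<phi> \<psi> y))"
      using transition_has_derivative' by simp
  qed
  moreover have "((\<lambda>w. transition \<psi> \<phi> (transition \<phi> \<psi> w)) has_derivative (\<lambda>v. v)) (at y)"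
  proof (rule has_derivative_transform_within_open[OF has_derivative_ident open_overlap[OF \<phi> \<psi>] y_overlap])
    show "w = transition \<psi> \<phi> (transition \<phi> \<psi> w)" if "w \<in> overlap \<phi> \<psi>" for w
      using that by (auto simp: transition_chart \<phi> \<psi>)
  qed
  ultimately have "(\<lambda>v. jac \<psi> \<phi> z *v (J *v v)) = (\<lambda>v. v)"
    by (rule has_derivative_unique)
  then have "(jac \<psi> \<phi> z ** J) *v v = mat 1 *v v" for v
    by (simp add: fun_eq_iff matrix_vector_mul_assoc)
  then show ?thesis by (simp add: matrix_eq)
qed

lemma jac_inverse': "J ** jac \<psi> \<phi> z = mat 1"
  using jac_inverse matrix_left_right_inverse by blast

lemma invertible_J: "invertible J"
  using jac_inverse jac_inverse' unfolding invertible_def by blast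

lemma matrix_inv_J: "matrix_inv J = jac \<psi> \<phi> z"
  by (rule matrix_inv_unique[OF jac_inverse' jac_inverse])

lemma jac_differentiable: "jac \<phi> \<psi> differentiable (at y)"
  using smooth_on_imp_differentiable[OF smooth_jac[OF \<phi> \<psi>] y_overlap] .

lemma partial_compose_transition:
  assumes "f differentiable (at y)"
  shows "partial b (\<lambda>w. f (transition \<psi> \<phi> w)) z = (\<Sum>a\<in>UNIV. jac \<psi> \<phi> z $ a $ b *\<^sub>R partial a f y)"
proof -
  have "((\<lambda>w. f (transition \<psi> \<phi> w)) has_derivative
      (\<lambda>w. \<Sum>a\<in>UNIV. (jac \<psi> \<phi> z *v w) $ a *\<^sub>R partial a f y)) (at z)"
    by (rule has_derivative_compose[OF transition_has_derivative'])
      (simp add: transition_z partial_frechet assms)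
  then show ?thesis
    by (simp add: partial_eq matrix_vector_mult_basis column_def)
qed

text \<open>Justifies \<open>jet_trans\<close>: the product rule differentiates the scale factor,
  which yields the shift, and the chain rule supplies the inverse Jacobian.\<close>

lemma jet1_push_density:
  assumes d: "\<sigma> differentiable (at y)"
  shows "jet1 (push_density 1 \<phi> \<psi> \<sigma>) z = jet_trans \<phi> \<psi> y (jet1 \<sigma> y)"
proof -
  let ?r = "1 / (real CARD('n) + 1)"
  let ?f = "\<lambda>w. \<bar>det (jac \<phi> \<psi> w)\<bar> powr ?r * \<sigma> w"
  note inv = invertible_J[unfolded J_def]
  note ds = abs_det_powr_differentiable[OF jac_differentiable inv, of ?r]
  have f: "push_density 1 \<phi> \<psi> \<sigma> = (\<lambda>w. ?f (transition \<psi> \<phi> w))"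
    by (simp add: push_density_def fun_eq_iff Let_def)
  have pf: "partial a ?f y = jet_scale \<phi> \<psi> y * (partial a \<sigma> y + \<sigma> y * jet_shift \<phi> \<psi> y $ a)" for a
    unfolding partial_mult[OF ds d] partial_abs_det_powr[OF jac_differentiable inv]
      jet_scale_def jet_shift_def by (simp add: algebra_simps)
  have "partial b (push_density 1 \<phi> \<psi> \<sigma>) z = (\<Sum>a\<in>UNIV. jac \<psi> \<phi> z $ a $ b *
      (jet_scale \<phi> \<psi> y * (partial a \<sigma> y + \<sigma> y * jet_shift \<phi> \<psi> y $ a)))" for b
    using partial_compose_transition[OF differentiable_mult[OF ds d], of b]
    unfolding f pf real_scaleR_def .
  moreover have "push_density 1 \<phi> \<psi> \<sigma> z = jet_scale \<phi> \<psi> y * \<sigma> y"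
    by (simp add: f transition_z jet_scale_def)
  ultimately show ?thesis
    by (simp add: jet1_def jet_trans_def matrix_inv_J[unfolded J_def] prod_eq_iff vec_eq_iff
        matrix_vector_mult_def transpose_def sum_distrib_left mult_ac del: transpose_matrix_vector)
qed

text \<open>The classical inhomogeneous law for Christoffel symbols, obtained by testing
  tensoriality on a field with constant components in one chart; in the other chart its components
  are a column of the Jacobian, whose derivative is the extra term.\<close>

lemma affine_connection_trans:
  assumes D: "affine_connection A D"
  shows "J ** D \<phi> y $ a = partial a (jac \<phi> \<psi>) y + (\<Sum>c\<in>UNIV. J $ c $ a *\<^sub>R (D \<psi> z $ c ** J))"
proof -
  have "(J ** D \<phi> y $ a) $ e $ d
      = (partial a (jac \<phi> \<psi>) y + (\<Sum>c\<in>UNIV. J $ c $ a *\<^sub>R (D \<psi> z $ c ** J))) $ e $ d" for e d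
  proof -
    let ?Y = "\<lambda>_::real^'n. axis d 1 :: real^'n"
    have dc: "(\<lambda>w. jac \<phi> \<psi> w *v axis d 1) differentiable (at y)"
      by (rule bounded_bilinear_differentiable[OF bounded_bilinear_matrix_vector_mult jac_differentiable])
        simp
    have "nabla_vec (D \<phi>) ?Y y ** transpose J = transpose J ** nabla_vec (D \<psi>) (push_vector \<phi> \<psi> ?Y) z"
      using D \<phi> \<psi> x\<phi> x\<psi> smooth_on_const unfolding affine_connection_def J_def y_def z_def by blast
    then have 1: "(nabla_vec (D \<phi>) ?Y y ** transpose J) $ a $ e
        = (transpose J ** nabla_vec (D \<psi>) (push_vector \<phi> \<psi> ?Y) z) $ a $ e" by simp
    have 2: "(nabla_vec (D \<phi>) ?Y y ** transpose J) $ a $ e = (J ** D \<phi> y $ a) $ e $ d"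
      by (simp add: nabla_vec_def matrix_matrix_mult_def transpose_def partial_const axis_def
          if_distrib mult.commute cong: if_cong)
    have 3: "nabla_vec (D \<psi>) (push_vector \<phi> \<psi> ?Y) z $ c $ e
        = (\<Sum>a\<in>UNIV. jac \<psi> \<phi> z $ a $ c * partial a (jac \<phi> \<psi>) y $ e $ d) + (D \<psi> z $ c ** J) $ e $ d" for c
    proof -
      have p: "push_vector \<phi> \<psi> ?Y = (\<lambda>w. (\<lambda>w. jac \<phi> \<psi> w *v axis d 1) (transition \<psi> \<phi> w))"
        by (simp add: push_vector_def fun_eq_iff Let_def)
      have q: "partial c (push_vector \<phi> \<psi> ?Y) z
          = (\<Sum>a\<in>UNIV. jac \<psi> \<phi> z $ a $ c *\<^sub>R (partial a (jac \<phi> \<psi>) y *v axis d 1))"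
        unfolding p
        by (subst partial_compose_transition[OF dc])
          (simp add: partial_bilinear[OF bounded_bilinear_matrix_vector_mult jac_differentiable] partial_const)
      have "push_vector \<phi> \<psi> ?Y z = column d J"
        by (simp add: p transition_z J_def matrix_vector_mult_basis)
      then show ?thesis
        unfolding nabla_vec_def vec_lambda_beta q
        by (simp add: sum_component matrix_vector_mult_basis column_def matrix_matrix_mult_def)
    qed
    \<comment> \<open>Contraction with the Jacobian undoes the chain-rule factor from
      differentiating in the second chart.\<close>
    have 4: "(\<Sum>c\<in>UNIV. J $ c $ a * (\<Sum>b\<in>UNIV. jac \<psi> \<phi> z $ b $ c * X b)) = X a" for X :: "'n \<Rightarrow> real"
    proof -
      have "(\<Sum>c\<in>UNIV. J $ c $ a * (\<Sum>b\<in>UNIV. jac \<psi> \<phi> z $ b $ c * X b))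
          = (\<Sum>b\<in>UNIV. (jac \<psi> \<phi> z ** J) $ b $ a * X b)"
        by (simp add: sum_distrib_left sum_distrib_right matrix_matrix_mult_def mult_ac)
          (rule sum.swap)
      then show ?thesis by (simp add: jac_inverse mat_def mult_if_one sum.delta if_distrib[of "\<lambda>t. t * _"] cong: if_cong)
    qed
    have "(J ** D \<phi> y $ a) $ e $ d
        = (\<Sum>c\<in>UNIV. J $ c $ a * nabla_vec (D \<psi>) (push_vector \<phi> \<psi> ?Y) z $ c $ e)"
      unfolding 2[symmetric] 1 by (simp add: matrix_matrix_mult_def transpose_def)
    also have "\<dots> = partial a (jac \<phi> \<psi>) y $ e $ d
        + (\<Sum>c\<in>UNIV. J $ c $ a * (D \<psi> z $ c ** J) $ e $ d)"
      unfolding 3 distrib_left sum.distrib 4 ..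
    finally show ?thesis by (simp add: sum_component)
  qed
  then show ?thesis by (simp add: vec_eq_iff)
qed

text \<open>The trace of the Christoffel law after multiplication by the inverse Jacobian:
  conjugation leaves traces unchanged, and the inhomogeneous term has trace (n + 1) times
  \<open>jet_shift\<close>.\<close>

lemma density_symbol_trans:
  assumes "affine_connection A D"
  shows "density_symbol 1 (D \<phi>) y = jet_shift \<phi> \<psi> y + transpose J *v density_symbol 1 (D \<psi>) z"
proof -
  let ?n = "real CARD('n) + 1"
  have "trace (D \<phi> y $ a) = trace (matrix_inv J ** partial a (jac \<phi> \<psi>) y)
      + (\<Sum>c\<in>UNIV. J $ c $ a * trace (D \<psi> z $ c))" for a
  proof -
    have "D \<phi> y $ a = matrix_inv J ** (J ** D \<phi> y $ a)"
      by (simp add: matrix_mul_assoc matrix_inv_left invertible_J)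
    also have "trace \<dots> = trace (matrix_inv J ** partial a (jac \<phi> \<psi>) y)
        + (\<Sum>c\<in>UNIV. J $ c $ a * trace (matrix_inv J ** (D \<psi> z $ c ** J)))"
      unfolding affine_connection_trans[OF assms]
      by (simp add: matrix_mult_linear trace_add bounded_bilinear.sum_right[OF bounded_bilinear_matrix_matrix_mult])
        (simp add: trace_def sum_component sum_distrib_left sum.swap[of "\<lambda>i c. _ c * _ i c"])
    finally have "trace (D \<phi> y $ a) = \<dots>" .
    moreover have "trace (matrix_inv J ** (D \<psi> z $ c ** J)) = trace (D \<psi> z $ c)" for c
      by (subst trace_mul_sym) (simp add: matrix_mul_assoc[symmetric] matrix_inv_right invertible_J)
    ultimately show ?thesis by simp
  qed
  then have "?n * density_symbol 1 (D \<phi>) y $ a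
      = ?n * (jet_shift \<phi> \<psi> y $ a + (transpose J *v density_symbol 1 (D \<psi>) z) $ a)" for a
    by (simp add: trace_christoffel jet_shift_def J_def matrix_vector_mult_def transpose_def
        distrib_left sum_distrib_left mult_ac add_nonneg_eq_0_iff del: transpose_matrix_vector)
  then show ?thesis
    by (simp add: vec_eq_iff add_nonneg_eq_0_iff del: transpose_matrix_vector)
qed

text \<open>Every cotractor at \<open>y\<close> is the jet of an affine function, so the law given
  for jets of local sections holds for arbitrary vectors.\<close>

lemma symmetric_cotractor_form_trans:
  assumes "symmetric_cotractor_form A h"
  shows "h \<psi> z (jet_trans \<phi> \<psi> y U) (jet_trans \<phi> \<psi> y V) = h \<phi> y U V"
proof -
  define \<sigma> where "\<sigma> W w = snd W + (w - y) \<bullet> fst W" for W :: "'n cotractor" and w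
  have s: "smooth_on (overlap \<phi> \<psi>) (\<sigma> W)" for W
    unfolding \<sigma>_def[abs_def]
    by (intro smooth_on_add smooth_on_const smooth_on_bilinear[OF _ bounded_bilinear_inner]
        smooth_on_diff smooth_on_ident open_overlap \<phi> \<psi>)
  have j: "jet1 (\<sigma> W) y = W" for W
  proof -
    have "(\<sigma> W has_derivative (\<lambda>v. v \<bullet> fst W)) (at y)"
      unfolding \<sigma>_def[abs_def] by (auto intro!: derivative_eq_intros)
    then show ?thesis
      by (simp add: jet1_def partial_eq \<sigma>_def inner_axis' prod_eq_iff vec_eq_iff)
  qed
  have "h \<psi> z (jet1 (push_density 1 \<phi> \<psi> (\<sigma> U)) z) (jet1 (push_density 1 \<phi> \<psi> (\<sigma> V)) z)
      = h \<phi> y (jet1 (\<sigma> U) y) (jet1 (\<sigma> V) y)"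
    using assms \<phi> \<psi> x\<phi> x\<psi> s unfolding symmetric_cotractor_form_def y_def z_def by blast
  then show ?thesis
    using smooth_on_imp_differentiable[OF s y_overlap] by (simp add: jet1_push_density j)
qed

end

section \<open>The projective class\<close>

lemma affine_connection_outside:
  "affine_connection A D \<Longrightarrow> \<not> (\<phi> \<in> A \<and> y \<in> chart_image \<phi>) \<Longrightarrow> D \<phi> y = 0"
  unfolding affine_connection_def smooth_field_def zero_outside_def by blast

lemma density_symbol_add_change_term:
  "density_symbol 1 (\<lambda>z. \<Gamma> z + change_term (\<Upsilon> z)) z = density_symbol 1 \<Gamma> z + \<Upsilon> z"
  by (rule density_symbol_proj_change) (simp add: change_term_def)

lemma nabla_vec_change:
  assumes "\<And>a b c. \<Gamma>' y $ a $ b $ c = \<Gamma> y $ a $ b $ c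
      + u $ a * (if b = c then 1 else 0) + u $ c * (if a = b then 1 else 0)"
  shows "nabla_vec \<Gamma>' Y y $ a $ b = nabla_vec \<Gamma> Y y $ a $ b + u $ a * Y y $ b
    + (\<Sum>c\<in>UNIV. u $ c * Y y $ c) * (if a = b then 1 else 0)"
proof -
  have "(\<Sum>c\<in>UNIV. \<Gamma>' y $ a $ b $ c * Y y $ c) = (\<Sum>c\<in>UNIV. \<Gamma> y $ a $ b $ c * Y y $ c)
      + u $ a * Y y $ b + (\<Sum>c\<in>UNIV. u $ c * Y y $ c) * (if a = b then 1 else 0)"
  proof -
    have "\<Gamma>' y $ a $ b $ c * Y y $ c = \<Gamma> y $ a $ b $ c * Y y $ c
        + (if b = c then u $ a * Y y $ b else 0) + u $ c * Y y $ c * (if a = b then 1 else 0)" for c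
      by (simp add: assms algebra_simps)
    then show ?thesis by (simp add: sum.distrib sum.delta)
  qed
  then show ?thesis by (simp add: nabla_vec_def)
qed

text \<open>Coordinate fields recover the Christoffel symbols from covariant derivatives, so the
  condition on all vector fields becomes a pointwise one on symbols.\<close>

lemma projectively_related_iff:
  "(D, D') \<in> projectively_related A \<longleftrightarrow>
    torsion_free_connection A D \<and> torsion_free_connection A D' \<and>
    (\<exists>\<Upsilon>. one_form A \<Upsilon> \<and> (\<forall>\<phi>\<in>A. \<forall>y\<in>chart_image \<phi>. D' \<phi> y = D \<phi> y + change_term (\<Upsilon> \<phi> y)))"
proof -
  have "(\<forall>Y. smooth_on (chart_image \<phi>) Y \<longrightarrow> (\<forall>y\<in>chart_image \<phi>. \<forall>a b.
          nabla_vec (D' \<phi>) Y y $ a $ b = nabla_vec (D \<phi>) Y y $ a $ b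
            + \<Upsilon> \<phi> y $ a * Y y $ b
            + (\<Sum>c\<in>UNIV. \<Upsilon> \<phi> y $ c * Y y $ c) * (if a = b then 1 else 0)))
      \<longleftrightarrow> (\<forall>y\<in>chart_image \<phi>. D' \<phi> y = D \<phi> y + change_term (\<Upsilon> \<phi> y))" (is "?L = ?R") for \<Upsilon> \<phi>
  proof
    assume L: ?L
    show ?R
    proof
      fix y assume y: "y \<in> chart_image \<phi>"
      have "D' \<phi> y $ a $ b $ c = (D \<phi> y + change_term (\<Upsilon> \<phi> y)) $ a $ b $ c" for a b c
      proof -
        have "nabla_vec (D' \<phi>) (\<lambda>_. axis c 1) y $ a $ b = nabla_vec (D \<phi>) (\<lambda>_. axis c 1) y $ a $ b
            + \<Upsilon> \<phi> y $ a * axis c 1 $ b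
            + (\<Sum>d\<in>UNIV. \<Upsilon> \<phi> y $ d * axis c 1 $ d) * (if a = b then 1 else 0)"
          using L y smooth_on_const by blast
        then show ?thesis
          by (simp add: nabla_vec_def partial_const axis_def change_term_def if_distrib
              cong: if_cong)
      qed
      then show "D' \<phi> y = D \<phi> y + change_term (\<Upsilon> \<phi> y)" by (simp add: vec_eq_iff)
    qed
  next
    assume R: ?R
    then show ?L by (intro allI impI ballI nabla_vec_change) (simp add: change_term_def)
  qed
  then show ?thesis unfolding projectively_related_def by simp
qed

lemma one_form_diff:
  assumes "one_form A \<Upsilon>" "one_form A \<Upsilon>'" "\<And>\<phi>. \<phi> \<in> A \<Longrightarrow> open (chart_image \<phi>)"
  shows "one_form A (\<lambda>\<phi> y. \<Upsilon> \<phi> y - \<Upsilon>' \<phi> y)"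
  unfolding one_form_def smooth_field_def zero_outside_def
proof (intro conjI allI ballI impI)
  show "\<Upsilon> \<phi> y - \<Upsilon>' \<phi> y = 0" if "\<not> (\<phi> \<in> A \<and> y \<in> chart_image \<phi>)" for \<phi> y
  proof -
    have "\<Upsilon> \<phi> y = 0" "\<Upsilon>' \<phi> y = 0"
      using assms(1,2) that unfolding one_form_def smooth_field_def zero_outside_def by blast+
    then show ?thesis by simp
  qed
  show "smooth_on (chart_image \<phi>) (\<lambda>y. \<Upsilon> \<phi> y - \<Upsilon>' \<phi> y)" if "\<phi> \<in> A" for \<phi>
    using assms(1,2) that unfolding one_form_def smooth_field_def
    by (intro smooth_on_diff assms(3)) blast+
  fix \<phi> \<psi> x assume *: "\<phi> \<in> A" "\<psi> \<in> A" "x \<in> fst \<phi> \<inter> fst \<psi>"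
  then have "\<Upsilon> \<phi> (snd \<phi> x) = transpose (jac \<phi> \<psi> (snd \<phi> x)) *v \<Upsilon> \<psi> (snd \<psi> x)"
    "\<Upsilon>' \<phi> (snd \<phi> x) = transpose (jac \<phi> \<psi> (snd \<phi> x)) *v \<Upsilon>' \<psi> (snd \<psi> x)"
    using assms(1,2) unfolding one_form_def by blast+
  then show "\<Upsilon> \<phi> (snd \<phi> x) - \<Upsilon>' \<phi> (snd \<phi> x) =
      transpose (jac \<phi> \<psi> (snd \<phi> x)) *v (\<Upsilon> \<psi> (snd \<psi> x) - \<Upsilon>' \<psi> (snd \<psi> x))"
    by (simp only: matrix_vector_linear)
qed

text \<open>Connections vanish outside the chart images by convention, so pointwise uniqueness gives
  equality as functions. It identifies the adapted connections of two sub-metrics with the same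
  metric, and the connection in the Einstein condition with the one in \<open>p\<close>.\<close>

lemma levi_civita_unique:
  assumes g: "pseudo_metric A g" and D: "levi_civita A g D" "levi_civita A g D'"
  shows "D = D'"
proof (intro ext)
  fix \<phi> y
  show "D \<phi> y = D' \<phi> y"
  proof (cases "\<phi> \<in> A \<and> y \<in> chart_image \<phi>")
    case True
    show ?thesis
    proof (rule levi_civita_unique_at)
      show "transpose (g \<phi> y) = g \<phi> y" "invertible (g \<phi> y)"
        using g True unfolding pseudo_metric_def by auto
      show "D \<phi> y $ a $ b $ c = D \<phi> y $ c $ b $ a" "D' \<phi> y $ a $ b $ c = D' \<phi> y $ c $ b $ a" for a b c
        using D True unfolding levi_civita_def torsion_free_connection_def by blast+
      show "transpose (D \<phi> y $ a) ** g \<phi> y + g \<phi> y ** D \<phi> y $ a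
          = transpose (D' \<phi> y $ a) ** g \<phi> y + g \<phi> y ** D' \<phi> y $ a" for a
        using D True unfolding levi_civita_def nabla_metric_eq_0_iff by metis
    qed
  next
    case False
    then show ?thesis
      using D affine_connection_outside unfolding levi_civita_def torsion_free_connection_def by metis
  qed
qed

section \<open>The Einstein condition in terms of the Schouten tensor\<close>

lemma ricci_eq_schouten:
  fixes \<Gamma> :: "'n::finite christoffel"
  assumes "2 \<le> CARD('n)"
  shows "ricci \<Gamma> y $ a $ b = real CARD('n) * schouten \<Gamma> y $ a $ b - schouten \<Gamma> y $ b $ a"
proof -
  let ?n = "real CARD('n)"
  have "1 < ?n\<^sup>2" using assms by (simp add: one_less_power)
  then have "?n\<^sup>2 - 1 \<noteq> 0" by simp
  then show ?thesis
    unfolding schouten_explicit[OF assms] vec_lambda_beta times_divide_eq_right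
      diff_divide_distrib[symmetric]
    by (simp add: eq_divide_eq) (simp add: algebra_simps power2_eq_square)
qed

text \<open>For symmetric Ricci tensor, \<open>n Ric_ab + Ric_ba\<close> is (n + 1) times
  \<open>Ric_ab\<close>, and this factor cancels in (n - 1)(n + 1). The bound on the dimension keeps
  n - 1 away from zero.\<close>

lemma ricci_eq_scaleR_iff_schouten:
  fixes \<Gamma> :: "'n::finite christoffel"
  assumes "2 \<le> CARD('n)" "transpose g = g"
  shows "ricci \<Gamma> y = k *\<^sub>R g \<longleftrightarrow> schouten \<Gamma> y = (k / (real CARD('n) - 1)) *\<^sub>R g"
proof -
  let ?n = "real CARD('n)"
  have n: "2 \<le> ?n" using assms(1) by simp
  have n2: "?n\<^sup>2 - 1 = (?n - 1) * (?n + 1)" by (simp add: algebra_simps power2_eq_square)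
  note g = transpose_eq_nth[OF assms(2)]
  show ?thesis
  proof
    assume R: "ricci \<Gamma> y = k *\<^sub>R g"
    have "schouten \<Gamma> y $ a $ b = k / (?n - 1) * g $ a $ b" for a b
      unfolding schouten_explicit[OF assms(1)] R n2 using n
      by (simp add: g[of b a] divide_simps) (simp add: algebra_simps)
    then show "schouten \<Gamma> y = (k / (?n - 1)) *\<^sub>R g" by (simp add: vec_eq_iff)
  next
    assume P: "schouten \<Gamma> y = (k / (?n - 1)) *\<^sub>R g"
    have "ricci \<Gamma> y $ a $ b = k * g $ a $ b" for a b
      unfolding ricci_eq_schouten[OF assms(1)] P using n
      by (simp add: g[of b a] divide_simps) (simp add: algebra_simps)
    then show "ricci \<Gamma> y = k *\<^sub>R g" by (simp add: vec_eq_iff)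
  qed
qed

context atlas
begin

lemma chart_changeI:
  "\<phi> \<in> A \<Longrightarrow> \<psi> \<in> A \<Longrightarrow> x \<in> fst \<phi> \<Longrightarrow> x \<in> fst \<psi> \<Longrightarrow> chart_change A \<phi> \<psi> x"
  by unfold_locales

lemma smooth_connection:
  "affine_connection A D \<Longrightarrow> \<phi> \<in> A \<Longrightarrow> smooth_on (chart_image \<phi>) (D \<phi>)"
  unfolding affine_connection_def smooth_field_def by blast

lemma smooth_density_symbol:
  assumes "affine_connection A D" "\<phi> \<in> A"
  shows "smooth_on (chart_image \<phi>) (density_symbol 1 (D \<phi>))"
  unfolding density_symbol_def
  by (intro smooth_on_vec_lambda smooth_on_mult smooth_on_sum smooth_on_const smooth_on_vec_nth
      smooth_connection open_chart_image assms)

text \<open>Adding the difference tensor preserves tensoriality: a covector pulls back and a vector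
  pushes forward, so both their outer product and their pairing times the identity obey the (1,1)
  law. The case \<Upsilon> = \<theta> - \<delta> produces the adapted connection.\<close>

lemma torsion_free_add_change_term:
  assumes D: "torsion_free_connection A D" and \<Upsilon>: "one_form A \<Upsilon>"
  shows "torsion_free_connection A (\<lambda>\<phi> y. D \<phi> y + change_term (\<Upsilon> \<phi> y))" (is "torsion_free_connection A ?D")
  unfolding torsion_free_connection_def
proof
  have aff: "affine_connection A D" using D unfolding torsion_free_connection_def by blast
  have [simp]: "change_term 0 = 0" by (simp add: vec_eq_iff change_term_def)
  show "affine_connection A ?D"
    unfolding affine_connection_def smooth_field_def zero_outside_def
  proof (intro conjI allI ballI impI)
    show "?D \<phi> y = 0" if "\<not> (\<phi> \<in> A \<and> y \<in> chart_image \<phi>)" for \<phi> y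
    proof -
      have "\<Upsilon> \<phi> y = 0"
        using \<Upsilon> that unfolding one_form_def smooth_field_def zero_outside_def by blast
      then show ?thesis using affine_connection_outside[OF aff that] by simp
    qed
    show "smooth_on (chart_image \<phi>) (?D \<phi>)" if "\<phi> \<in> A" for \<phi>
      using that \<Upsilon> unfolding one_form_def smooth_field_def
      by (intro smooth_on_add smooth_on_bounded_linear[OF _ bounded_linear_change_term]
          open_chart_image smooth_connection aff) auto
    fix \<phi> \<psi> and Y :: "real^'n \<Rightarrow> real^'n" and x
    assume a: "\<phi> \<in> A" "\<psi> \<in> A" "smooth_on (overlap \<phi> \<psi>) Y" "x \<in> fst \<phi> \<inter> fst \<psi>"
    interpret chart_change A \<phi> \<psi> x using a by (intro chart_changeI) auto
    let ?Z = "push_vector \<phi> \<psi> Y" and ?u = "\<Upsilon> \<phi> y" and ?v = "\<Upsilon> \<psi> z"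
    have u: "?u = transpose J *v ?v"
      using \<Upsilon> a unfolding one_form_def J_def y_def z_def by blast
    have Z: "?Z z = J *v Y y"
      by (simp add: push_vector_def transition_z J_def Let_def)
    have law: "nabla_vec (D \<phi>) Y y ** transpose J = transpose J ** nabla_vec (D \<psi>) ?Z z"
      using aff a unfolding affine_connection_def J_def y_def z_def by blast
    define T where "T u w = (\<chi> a b. u $ a * w $ b) + (u \<bullet> w) *\<^sub>R mat 1" for u w :: "real^'n"
    have nv: "nabla_vec (?D C) W w = nabla_vec (D C) W w + T (\<Upsilon> C w) (W w)" for C W w
    proof -
      have "nabla_vec (?D C) W w $ a $ b = nabla_vec (D C) W w $ a $ b + \<Upsilon> C w $ a * W w $ b
        + (\<Sum>c\<in>UNIV. \<Upsilon> C w $ c * W w $ c) * (if a = b then 1 else 0)" for a b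
        by (rule nabla_vec_change) (simp add: change_term_def)
      then show ?thesis by (simp add: vec_eq_iff T_def mat_def inner_vec_def)
    qed
    have "T ?u (Y y) ** transpose J = transpose J ** T ?v (?Z z)"
    proof -
      have "?u \<bullet> Y y = ?v \<bullet> ?Z z"
        unfolding u Z by (simp only: inner_matrix_vector_transpose)
      moreover have "(\<chi> a b. ?u $ a * Y y $ b) ** transpose J = transpose J ** (\<chi> a b. ?v $ a * ?Z z $ b)"
        unfolding u Z
        by (simp add: vec_eq_iff matrix_matrix_mult_def matrix_vector_mult_def transpose_def
            sum_distrib_left sum_distrib_right mult_ac del: transpose_matrix_vector)
          (intro allI sum.swap)
      ultimately show ?thesis by (simp add: T_def matrix_mult_linear)
    qed
    then show "nabla_vec (?D \<phi>) Y (snd \<phi> x) ** transpose (jac \<phi> \<psi> (snd \<phi> x)) =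
        transpose (jac \<phi> \<psi> (snd \<phi> x)) ** nabla_vec (?D \<psi>) ?Z (snd \<psi> x)"
      unfolding nv y_def[symmetric] z_def[symmetric] J_def[symmetric]
      using law by (simp add: matrix_mult_linear)
  qed
  show "\<forall>\<phi>\<in>A. \<forall>y\<in>chart_image \<phi>. \<forall>a b c. ?D \<phi> y $ a $ b $ c = ?D \<phi> y $ c $ b $ a"
    using D unfolding torsion_free_connection_def by (auto simp: change_term_def)
qed

text \<open>Both connections are compared with one representative \<open>D0\<close> of the class,
  hence differ from each other by the 1-form \<Upsilon>' - \<Upsilon>.\<close>

lemma tractor_nabla_projectively_invariant:
  assumes n: "2 \<le> CARD('n)" and p: "projective_structure A p" and D: "D \<in> p" "D' \<in> p"
    and \<phi>: "\<phi> \<in> A" and y: "y \<in> chart_image \<phi>" and dU: "U differentiable (at y)"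
  shows "tractor_nabla (D' \<phi>) a U y = tractor_nabla (D \<phi>) a U y"
proof -
  obtain D0 where D0: "p = projectively_related A `` {D0}"
    using p unfolding projective_structure_def quotient_def by blast
  obtain \<Upsilon> \<Upsilon>' where \<Upsilon>: "one_form A \<Upsilon>" "one_form A \<Upsilon>'"
      "\<And>y. y \<in> chart_image \<phi> \<Longrightarrow> D \<phi> y = D0 \<phi> y + change_term (\<Upsilon> \<phi> y)"
      "\<And>y. y \<in> chart_image \<phi> \<Longrightarrow> D' \<phi> y = D0 \<phi> y + change_term (\<Upsilon>' \<phi> y)"
    and tf: "torsion_free_connection A D"
    using D \<phi> unfolding D0 by (auto simp: projectively_related_iff)
  have aff: "affine_connection A D" using tf unfolding torsion_free_connection_def by blast
  interpret proj_change "chart_image \<phi>" "D \<phi>" "D' \<phi>" "\<lambda>y. \<Upsilon>' \<phi> y - \<Upsilon> \<phi> y" y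
  proof
    show "open (chart_image \<phi>)" "y \<in> chart_image \<phi>"
      using open_chart_image[OF \<phi>] y by auto
    show "D \<phi> differentiable (at y)"
      using smooth_on_imp_differentiable[OF smooth_connection[OF aff \<phi>] y] .
    have "one_form A (\<lambda>\<phi> y. \<Upsilon>' \<phi> y - \<Upsilon> \<phi> y)"
      by (rule one_form_diff[OF \<Upsilon>(2,1)]) (rule open_chart_image)
    then show "(\<lambda>y. \<Upsilon>' \<phi> y - \<Upsilon> \<phi> y) differentiable (at y)"
      using \<phi> y smooth_on_imp_differentiable unfolding one_form_def smooth_field_def by blast
    show "D \<phi> y $ a $ b $ c = D \<phi> y $ c $ b $ a" for a b c
      using tf \<phi> y unfolding torsion_free_connection_def by blast
    show "D' \<phi> z $ a $ b $ c = D \<phi> z $ a $ b $ c + (\<Upsilon>' \<phi> z - \<Upsilon> \<phi> z) $ a * (if b = c then 1 else 0)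
        + (\<Upsilon>' \<phi> z - \<Upsilon> \<phi> z) $ c * (if a = b then 1 else 0)" if "z \<in> chart_image \<phi>" for z a b c
      by (simp add: \<Upsilon>(3,4)[OF that] change_term_def)
  qed
  show ?thesis
    by (rule tractor_nabla_change[OF n dU])
      (rule smooth_on_imp_differentiable[OF smooth_density_symbol[OF aff \<phi>] y])
qed

end

section \<open>From sub-metrics to Einstein metrics\<close>

text \<open>Transported from \<open>weighted_inverse_congruence\<close>, since the two inverses undo
  each other.\<close>

lemma unweighted_inverse_congruence:
  fixes \<zeta> J :: "real^'n^'n"
  assumes "invertible J" "invertible \<zeta>"
  shows "unweighted_inverse ((\<bar>det J\<bar> powr (1 / (real CARD('n) + 1)))\<^sup>2 *\<^sub>R
      (matrix_inv J ** \<zeta> ** transpose (matrix_inv J))) = transpose J ** unweighted_inverse \<zeta> ** J"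
proof -
  let ?g = "unweighted_inverse \<zeta>"
  have g: "invertible ?g" by (rule invertible_unweighted_inverse[OF assms(2)])
  have "invertible (transpose J ** ?g ** J)"
    by (intro invertible_mult transpose_invertible assms g)
  from unweighted_weighted_inverse[OF this] show ?thesis
    by (simp add: weighted_inverse_congruence[OF assms(1) g] weighted_unweighted_inverse[OF assms(2)])
qed

lemma transpose_scaleR: "transpose (c *\<^sub>R A) = c *\<^sub>R transpose (A :: real^'n^'m)"
  by (simp add: transpose_def vec_eq_iff)

lemma transpose_unweighted_inverse:
  assumes "invertible \<zeta>" "transpose \<zeta> = \<zeta>"
  shows "transpose (unweighted_inverse \<zeta>) = unweighted_inverse \<zeta>"
proof -
  have "invertible (\<bar>det \<zeta>\<bar> *\<^sub>R \<zeta>)"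
    by (rule scalar_invertible[OF _ assms(1)]) (use assms(1) in \<open>simp add: invertible_det_nz\<close>)
  then show ?thesis
    by (simp add: unweighted_inverse_def transpose_matrix_inv transpose_scaleR assms(2))
qed

lemma transpose_weighted_inverse:
  "invertible g \<Longrightarrow> transpose g = g \<Longrightarrow> transpose (weighted_inverse g) = weighted_inverse g"
  by (simp add: weighted_inverse_def transpose_scaleR transpose_matrix_inv)

lemma smooth_on_of_splitting:
  assumes "open S" "smooth_on S (density_symbol 1 \<Gamma>)"
  shows "smooth_on S (\<lambda>z. of_splitting \<Gamma> z W)"
  unfolding of_splitting_def
  by (intro smooth_on_Pair smooth_on_diff smooth_on_const smooth_on_bilinear[OF _ bounded_bilinear_scaleR] assms)

lemma matrix_eq_0I:
  fixes M :: "real^'n^'m"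
  assumes "\<And>\<mu> \<nu>. \<mu> \<bullet> (M *v \<nu>) = 0"
  shows "M = 0"
proof -
  have "M *v \<nu> = 0" for \<nu> using assms[of "M *v \<nu>" \<nu>] by simp
  then show ?thesis by (simp add: matrix_eq)
qed

text \<open>Testing against sections that are constant in the splitting of \<open>\<Gamma>\<close> extracts the three
  components of the equation for parallel forms.\<close>

lemma parallel_diag_form_components:
  fixes \<Gamma> :: "'n::finite christoffel"
  assumes S: "open S" "y \<in> S" and s\<delta>: "smooth_on S (density_symbol 1 \<Gamma>)"
    and d\<zeta>: "\<zeta> differentiable (at y)" and d\<tau>: "\<tau> differentiable (at y)"
    and sym: "transpose (\<zeta> y) = \<zeta> y"
    and h: "\<And>z. z \<in> S \<Longrightarrow> h z = diag_form (\<zeta> z) (density_symbol 1 \<Gamma> z) (\<tau> z)"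
    and par: "\<And>U V. smooth_on S U \<Longrightarrow> smooth_on S V \<Longrightarrow>
      partial a (\<lambda>z. h z (U z) (V z)) y =
        h y (tractor_nabla \<Gamma> a U y) (V y) + h y (U y) (tractor_nabla \<Gamma> a V y)"
  shows "partial a \<zeta> y = (2 * density_symbol 1 \<Gamma> y $ a) *\<^sub>R \<zeta> y
      - \<Gamma> y $ a ** \<zeta> y - \<zeta> y ** transpose (\<Gamma> y $ a)"
    and "\<zeta> y *v schouten \<Gamma> y $ a = \<tau> y *\<^sub>R axis a 1"
    and "partial a \<tau> y = 2 * density_symbol 1 \<Gamma> y $ a * \<tau> y"
proof -
  let ?M = "partial a \<zeta> y - ((2 * density_symbol 1 \<Gamma> y $ a) *\<^sub>R \<zeta> y
      - \<Gamma> y $ a ** \<zeta> y - \<zeta> y ** transpose (\<Gamma> y $ a))"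
  let ?w = "\<tau> y *\<^sub>R axis a 1 - \<zeta> y *v schouten \<Gamma> y $ a"
  let ?t = "partial a \<tau> y - 2 * density_symbol 1 \<Gamma> y $ a * \<tau> y"
  have d\<delta>: "density_symbol 1 \<Gamma> differentiable (at y)"
    using smooth_on_imp_differentiable[OF s\<delta> S(2)] .
  have key: "\<mu> \<bullet> (?M *v \<nu>) + ?w \<bullet> (\<rho> *\<^sub>R \<mu> + \<sigma> *\<^sub>R \<nu>) + ?t * \<sigma> * \<rho> = 0" for \<mu> \<nu> \<sigma> \<rho>
  proof -
    let ?U = "\<lambda>z. of_splitting \<Gamma> z (\<mu>, \<sigma>)" and ?V = "\<lambda>z. of_splitting \<Gamma> z (\<nu>, \<rho>)"
    note sm = smooth_on_of_splitting[OF S(1) s\<delta>]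
    note dd = smooth_on_imp_differentiable[OF sm S(2)]
    have "(\<lambda>z. diag_form (\<zeta> z) (density_symbol 1 \<Gamma> z) (\<tau> z) (?U z) (?V z))
        = (\<lambda>z. \<mu> \<bullet> (\<zeta> z *v \<nu>) + \<tau> z * \<sigma> * \<rho>)"
      unfolding diag_form_density_symbol by simp
    moreover have "(\<lambda>z. \<mu> \<bullet> (\<zeta> z *v \<nu>) + \<tau> z * \<sigma> * \<rho>) differentiable (at y)"
      by (intro differentiable_add bounded_bilinear_differentiable[OF bounded_bilinear_inner]
          bounded_bilinear_differentiable[OF bounded_bilinear_matrix_vector_mult]
          differentiable_mult differentiable_const d\<zeta> d\<tau>)
    ultimately have "partial a (\<lambda>z. diag_form (\<zeta> z) (density_symbol 1 \<Gamma> z) (\<tau> z) (?U z) (?V z)) y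
        = partial a (\<lambda>z. h z (?U z) (?V z)) y"
      by (intro partial_cong[OF S]) (simp_all add: h)
    with par[OF sm sm, of "(\<mu>, \<sigma>)" "(\<nu>, \<rho>)"] h[OF S(2)]
      tractor_leibniz[OF dd dd d\<delta> d\<zeta> d\<tau> sym to_of_splitting to_of_splitting, of a \<mu> \<sigma> \<nu> \<rho>]
    show ?thesis by simp
  qed
  have "?M = 0" using key[of _ _ 0 0] by (intro matrix_eq_0I) simp
  then show "partial a \<zeta> y = (2 * density_symbol 1 \<Gamma> y $ a) *\<^sub>R \<zeta> y
      - \<Gamma> y $ a ** \<zeta> y - \<zeta> y ** transpose (\<Gamma> y $ a)" by simp
  \<comment> \<open>Taking \<mu> to be the vector itself and \<rho> = 1 leaves its squared Euclidean
    norm.\<close>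
  have "?w = 0" using key[of ?w 0 1 0] by simp
  then show "\<zeta> y *v schouten \<Gamma> y $ a = \<tau> y *\<^sub>R axis a 1" by simp
  show "partial a \<tau> y = 2 * density_symbol 1 \<Gamma> y $ a * \<tau> y"
    using key[of 0 0 1 1] by simp
qed

text \<open>The vector equations assemble to \<zeta> times the transposed Schouten matrix = \<tau>
  times the identity. Inverting \<zeta> gives proportionality to the metric; taking the trace
  expresses \<tau> through \<zeta> and P, which is what injectivity uses.\<close>

lemma schouten_eq_of_weighted:
  fixes \<zeta> :: "real^'n::finite^'n"
  assumes i: "invertible \<zeta>" and P: "\<And>a. \<zeta> *v P $ a = \<tau> *\<^sub>R axis a 1" and sym: "transpose \<zeta> = \<zeta>"
  shows "P = (\<tau> * \<bar>det \<zeta>\<bar>) *\<^sub>R unweighted_inverse \<zeta>"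
    and "\<tau> = trace (\<zeta> ** transpose P) / real CARD('n)"
proof -
  have d: "\<bar>det \<zeta>\<bar> \<noteq> 0" using i by (simp add: invertible_det_nz)
  have e: "\<zeta> ** transpose P = \<tau> *\<^sub>R mat 1"
  proof -
    have "(\<zeta> ** transpose P) $ b $ a = (\<zeta> *v P $ a) $ b" for a b
      by (simp add: matrix_matrix_mult_def matrix_vector_mult_def transpose_def)
    then show ?thesis by (simp add: P vec_eq_iff mat_def axis_def)
  qed
  have "matrix_inv \<zeta> ** (\<zeta> ** transpose P) = \<tau> *\<^sub>R matrix_inv \<zeta>"
    by (simp add: e matrix_mult_linear)
  then have "transpose P = \<tau> *\<^sub>R matrix_inv \<zeta>"
    by (simp add: matrix_mul_assoc matrix_inv_left i)
  then have "P = \<tau> *\<^sub>R transpose (matrix_inv \<zeta>)"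
    by (metis transpose_scaleR transpose_transpose)
  then show "P = (\<tau> * \<bar>det \<zeta>\<bar>) *\<^sub>R unweighted_inverse \<zeta>"
    using d by (simp add: unweighted_inverse_def matrix_inv_scaleR i transpose_matrix_inv sym)
  show "\<tau> = trace (\<zeta> ** transpose P) / real CARD('n)"
    by (simp add: e trace_scaleR trace_I)
qed

context atlas
begin

text \<open>Each point has a coordinate ball on which the expression of \<open>F\<close> is
  constant; its preimage is an open neighbourhood in M, so connectedness applies.\<close>

lemma locally_constant_if_partial_eq_0:
  fixes F :: "'m \<Rightarrow> real"
  assumes conn: "connected (UNIV :: 'm set)"
    and F: "\<And>\<phi> x. \<phi> \<in> A \<Longrightarrow> x \<in> fst \<phi> \<Longrightarrow> F x = f \<phi> (snd \<phi> x)"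
    and d: "\<And>\<phi> y. \<phi> \<in> A \<Longrightarrow> y \<in> chart_image \<phi> \<Longrightarrow> f \<phi> differentiable (at y)"
    and p: "\<And>\<phi> y a. \<phi> \<in> A \<Longrightarrow> y \<in> chart_image \<phi> \<Longrightarrow> partial a (f \<phi>) y = 0"
  shows "\<exists>k. \<forall>x. F x = k"
proof -
  have "F constant_on UNIV"
  proof (rule locally_constant_imp_constant[OF conn])
    fix x :: 'm
    obtain \<phi> where \<phi>: "\<phi> \<in> A" "x \<in> fst \<phi>" using ex_chart by blast
    obtain e where e: "e > 0" "ball (snd \<phi> x) e \<subseteq> chart_image \<phi>"
      using open_chart_image[OF \<phi>(1)] chart_image_I[OF \<phi>(2)] open_contains_ball by blast
    have "\<exists>c. \<forall>y\<in>ball (snd \<phi> x) e. f \<phi> y = c"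
    proof (rule has_derivative_zero_constant)
      show "(f \<phi> has_derivative (\<lambda>h. 0)) (at y within ball (snd \<phi> x) e)"
        if "y \<in> ball (snd \<phi> x) e" for y
      proof -
        have "y \<in> chart_image \<phi>" using e(2) that by blast
        from partial_frechet[OF d[OF \<phi>(1) this]] p[OF \<phi>(1) this]
        have "(f \<phi> has_derivative (\<lambda>h. 0)) (at y)" by simp
        then show ?thesis by (rule has_derivative_at_withinI)
      qed
    qed simp
    then obtain c where c: "\<And>y. y \<in> ball (snd \<phi> x) e \<Longrightarrow> f \<phi> y = c" by blast
    let ?T = "fst \<phi> \<inter> snd \<phi> -` ball (snd \<phi> x) e"
    have "continuous_on (fst \<phi>) (snd \<phi>)"
      using chart_homeomorphism[OF \<phi>(1)] homeomorphism_cont1 by blast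
    then have "open ?T"
      using continuous_open_preimage open_domain[OF \<phi>(1)] open_ball by blast
    moreover have "x \<in> ?T" using \<phi> e by simp
    moreover have "F x' = F x" if "x' \<in> ?T" for x'
      using that F[OF \<phi>(1)] \<phi>(2) c e(1) by simp
    ultimately show "\<exists>T. openin (top_of_set UNIV) T \<and> x \<in> T \<and> (\<forall>x'\<in>T. F x' = F x)"
      by (metis subtopology_UNIV open_openin)
  qed
  then show ?thesis unfolding constant_on_def by auto
qed

end

section \<open>Coefficients of a sub-metric and their behaviour under changes of chart\<close>

locale submetric = atlas A for A :: "('m::topological_space, 'n::finite) chart set" +
  fixes h :: "('m, 'n) cotractor_form"
  assumes sub_metric: "sub_metric A h"
begin

definition \<zeta> :: "('m, 'n) chart \<Rightarrow> real^'n \<Rightarrow> real^'n^'n" where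
  "\<zeta> \<phi> y = submetric_coeffs (h \<phi> y)"

text \<open>The complement orthogonal to the sub-bundle is spanned by
  \<open>(- \<theta>, 1)\<close>; \<theta> is the density symbol that the adapted connection must
  have.\<close>

definition \<theta> :: "('m, 'n) chart \<Rightarrow> real^'n \<Rightarrow> real^'n" where
  "\<theta> \<phi> y = matrix_inv (\<zeta> \<phi> y) *v (\<chi> b. h \<phi> y (axis b 1, 0) (0, 1))"

definition \<tau> :: "('m, 'n) chart \<Rightarrow> real^'n \<Rightarrow> real" where
  "\<tau> \<phi> y = h \<phi> y (- \<theta> \<phi> y, 1) (- \<theta> \<phi> y, 1)"

lemma form: "symmetric_cotractor_form A h"
  using sub_metric unfolding sub_metric_def by blast

lemma smooth_form: "\<phi> \<in> A \<Longrightarrow> smooth_on (chart_image \<phi>) (\<lambda>y. h \<phi> y U V)"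
  using form unfolding symmetric_cotractor_form_def by blast

lemma form_outside: "\<not> (\<phi> \<in> A \<and> y \<in> chart_image \<phi>) \<Longrightarrow> h \<phi> y = (\<lambda>_ _. 0)"
  using form unfolding symmetric_cotractor_form_def zero_outside_def by blast

lemma transpose_coeffs:
  assumes "\<phi> \<in> A" "y \<in> chart_image \<phi>"
  shows "transpose (\<zeta> \<phi> y) = \<zeta> \<phi> y"
proof -
  have "h \<phi> y U V = h \<phi> y V U" for U V
    using form assms unfolding symmetric_cotractor_form_def by blast
  then show ?thesis by (simp add: \<zeta>_def submetric_coeffs_def transpose_def vec_eq_iff)
qed

lemma bilinear_form: "\<phi> \<in> A \<Longrightarrow> y \<in> chart_image \<phi> \<Longrightarrow> bilinear (h \<phi> y)"
  using form unfolding symmetric_cotractor_form_def by blast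

lemma invertible_coeffs:
  assumes "\<phi> \<in> A" "y \<in> chart_image \<phi>"
  shows "invertible (\<zeta> \<phi> y)"
proof -
  have "\<mu> = 0" if "\<zeta> \<phi> y *v \<mu> = 0" for \<mu>
  proof -
    have "h \<phi> y (\<mu>, 0) (\<nu>, 0) = 0" for \<nu>
    proof -
      have "h \<phi> y (\<nu>, 0) (\<mu>, 0) = \<nu> \<bullet> (\<zeta> \<phi> y *v \<mu>)"
        unfolding \<zeta>_def by (rule bilinear_form_on_subbundle[OF bilinear_form[OF assms]])
      then show ?thesis
        using form assms that unfolding symmetric_cotractor_form_def by (metis inner_zero_right)
    qed
    then show ?thesis using sub_metric assms unfolding sub_metric_def by blast
  qed
  then show ?thesis
    unfolding invertible_left_inverse matrix_left_invertible_ker by blast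
qed

lemma form_eq:
  assumes "\<phi> \<in> A" "y \<in> chart_image \<phi>"
  shows "h \<phi> y = diag_form (\<zeta> \<phi> y) (\<theta> \<phi> y) (\<tau> \<phi> y)"
  unfolding \<zeta>_def \<tau>_def
proof (rule bilinear_eq_diag_form)
  show "bilinear (h \<phi> y)" by (rule bilinear_form[OF assms])
  show "h \<phi> y U V = h \<phi> y V U" for U V
    using form assms unfolding symmetric_cotractor_form_def by blast
  show "invertible (submetric_coeffs (h \<phi> y))"
    using invertible_coeffs[OF assms] unfolding \<zeta>_def .
  show "\<theta> \<phi> y = matrix_inv (submetric_coeffs (h \<phi> y)) *v (\<chi> b. h \<phi> y (axis b 1, 0) (0, 1))"
    by (simp add: \<theta>_def \<zeta>_def)
qed

lemma smooth_coeffs: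
  assumes "\<phi> \<in> A"
  shows "smooth_on (chart_image \<phi>) (\<zeta> \<phi>)" "smooth_on (chart_image \<phi>) (\<theta> \<phi>)"
    "smooth_on (chart_image \<phi>) (\<tau> \<phi>)"
proof -
  note o = open_chart_image[OF assms]
  show \<zeta>: "smooth_on (chart_image \<phi>) (\<zeta> \<phi>)"
    unfolding \<zeta>_def[abs_def] submetric_coeffs_def
    by (intro smooth_on_vec_lambda smooth_form assms o)
  show \<theta>: "smooth_on (chart_image \<phi>) (\<theta> \<phi>)"
    unfolding \<theta>_def[abs_def]
    by (intro smooth_on_bilinear[OF o bounded_bilinear_matrix_vector_mult] smooth_on_matrix_inv
        smooth_on_vec_lambda smooth_form assms o \<zeta> invertible_coeffs)
  show "smooth_on (chart_image \<phi>) (\<tau> \<phi>)"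
  proof (rule smooth_on_cong[OF o])
    \<comment> \<open>The arguments in the definition of \<tau> vary with the point, whereas
      smoothness of \<open>h\<close> is given for fixed ones; completing the square rewrites \<tau>
      with fixed arguments.\<close>
    show "smooth_on (chart_image \<phi>) (\<lambda>y. h \<phi> y (0, 1) (0, 1) - \<theta> \<phi> y \<bullet> (\<zeta> \<phi> y *v \<theta> \<phi> y))"
      by (intro smooth_on_diff smooth_form smooth_on_bilinear[OF o bounded_bilinear_inner]
          smooth_on_bilinear[OF o bounded_bilinear_matrix_vector_mult] assms o \<zeta> \<theta>)
    show "h \<phi> y (0, 1) (0, 1) - \<theta> \<phi> y \<bullet> (\<zeta> \<phi> y *v \<theta> \<phi> y) = \<tau> \<phi> y" if "y \<in> chart_image \<phi>" for y
      unfolding form_eq[OF assms that] by (simp add: diag_form_def)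
  qed
qed

text \<open>Invariance of \<open>h\<close> gives two diagonal decompositions of one form, and their
  uniqueness yields the three laws.\<close>

lemma coeffs_trans:
  assumes "chart_change A \<phi> \<psi> x"
  defines "J \<equiv> jac \<phi> \<psi> (snd \<phi> x)" and "c \<equiv> jet_scale \<phi> \<psi> (snd \<phi> x)"
  shows "\<zeta> \<phi> (snd \<phi> x) = c\<^sup>2 *\<^sub>R (matrix_inv J ** \<zeta> \<psi> (snd \<psi> x) ** transpose (matrix_inv J))"
    and "\<theta> \<phi> (snd \<phi> x) = jet_shift \<phi> \<psi> (snd \<phi> x) + transpose J *v \<theta> \<psi> (snd \<psi> x)"
    and "\<tau> \<phi> (snd \<phi> x) = c\<^sup>2 * \<tau> \<psi> (snd \<psi> x)"
proof -
  interpret C: chart_change A \<phi> \<psi> x by fact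
  have "diag_form (\<zeta> \<phi> C.y) (\<theta> \<phi> C.y) (\<tau> \<phi> C.y) U V =
    diag_form ((jet_scale \<phi> \<psi> C.y)\<^sup>2 *\<^sub>R (matrix_inv C.J ** \<zeta> \<psi> C.z ** transpose (matrix_inv C.J)))
      (jet_shift \<phi> \<psi> C.y + transpose C.J *v \<theta> \<psi> C.z) ((jet_scale \<phi> \<psi> C.y)\<^sup>2 * \<tau> \<psi> C.z) U V" for U V
  proof -
    have "diag_form (\<zeta> \<phi> C.y) (\<theta> \<phi> C.y) (\<tau> \<phi> C.y) U V = h \<phi> C.y U V"
      by (simp add: form_eq C.\<phi> C.y_image)
    also have "\<dots> = h \<psi> C.z (jet_trans \<phi> \<psi> C.y U) (jet_trans \<phi> \<psi> C.y V)"
      by (rule C.symmetric_cotractor_form_trans[OF form, symmetric])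
    also have "\<dots> = diag_form (\<zeta> \<psi> C.z) (\<theta> \<psi> C.z) (\<tau> \<psi> C.z)
        (jet_trans \<phi> \<psi> C.y U) (jet_trans \<phi> \<psi> C.y V)"
      by (simp add: form_eq C.\<psi> C.z_image)
    finally show ?thesis
      unfolding C.J_def using diag_form_jet_trans C.invertible_J C.J_def by metis
  qed
  then have "diag_form (\<zeta> \<phi> C.y) (\<theta> \<phi> C.y) (\<tau> \<phi> C.y) =
    diag_form ((jet_scale \<phi> \<psi> C.y)\<^sup>2 *\<^sub>R (matrix_inv C.J ** \<zeta> \<psi> C.z ** transpose (matrix_inv C.J)))
      (jet_shift \<phi> \<psi> C.y + transpose C.J *v \<theta> \<psi> C.z) ((jet_scale \<phi> \<psi> C.y)\<^sup>2 * \<tau> \<psi> C.z)"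
    by blast
  from diag_form_eqD[OF this invertible_coeffs[OF C.\<phi> C.y_image]]
  show "\<zeta> \<phi> (snd \<phi> x) = c\<^sup>2 *\<^sub>R (matrix_inv J ** \<zeta> \<psi> (snd \<psi> x) ** transpose (matrix_inv J))"
    and "\<theta> \<phi> (snd \<phi> x) = jet_shift \<phi> \<psi> (snd \<phi> x) + transpose J *v \<theta> \<psi> (snd \<psi> x)"
    and "\<tau> \<phi> (snd \<phi> x) = c\<^sup>2 * \<tau> \<psi> (snd \<psi> x)"
    unfolding J_def c_def C.J_def C.y_def C.z_def by blast+
qed

lemma metric_of_submetric_eq:
  "\<phi> \<in> A \<Longrightarrow> y \<in> chart_image \<phi> \<Longrightarrow> metric_of_submetric A h \<phi> y = unweighted_inverse (\<zeta> \<phi> y)"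
  by (simp add: metric_of_submetric_def unweighted_inverse_def \<zeta>_def Let_def)

lemma pseudo_metric_of_submetric: "pseudo_metric A (metric_of_submetric A h)"
  unfolding pseudo_metric_def smooth_field_def zero_outside_def
proof (intro conjI ballI allI impI)
  show "metric_of_submetric A h \<phi> y = 0" if "\<not> (\<phi> \<in> A \<and> y \<in> chart_image \<phi>)" for \<phi> y
    using that by (auto simp: metric_of_submetric_def)
  show "smooth_on (chart_image \<phi>) (metric_of_submetric A h \<phi>)" if \<phi>: "\<phi> \<in> A" for \<phi>
  proof (rule smooth_on_cong[OF open_chart_image[OF \<phi>]])
    have d: "det (\<zeta> \<phi> y) \<noteq> 0" if "y \<in> chart_image \<phi>" for y
      using invertible_coeffs[OF \<phi> that] by (simp add: invertible_det_nz)
    show "smooth_on (chart_image \<phi>) (\<lambda>y. unweighted_inverse (\<zeta> \<phi> y))"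
      unfolding unweighted_inverse_def
      by (intro smooth_on_matrix_inv smooth_on_bilinear[OF _ bounded_bilinear_scaleR] smooth_on_abs
          smooth_on_det smooth_coeffs open_chart_image scalar_invertible invertible_coeffs \<phi> d)
        (simp_all add: d)
  qed (simp add: metric_of_submetric_eq \<phi>)
  fix \<phi> y assume *: "\<phi> \<in> A" "y \<in> chart_image \<phi>"
  show "transpose (metric_of_submetric A h \<phi> y) = metric_of_submetric A h \<phi> y"
    by (simp add: metric_of_submetric_eq * transpose_unweighted_inverse invertible_coeffs transpose_coeffs)
  show "invertible (metric_of_submetric A h \<phi> y)"
    by (simp add: metric_of_submetric_eq * invertible_unweighted_inverse invertible_coeffs)
next
  fix \<phi> \<psi> x assume *: "\<phi> \<in> A" "\<psi> \<in> A" "x \<in> fst \<phi> \<inter> fst \<psi>"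
  then have c: "chart_change A \<phi> \<psi> x" by (intro chart_changeI) auto
  interpret C: chart_change A \<phi> \<psi> x by (rule c)
  show "metric_of_submetric A h \<phi> (snd \<phi> x) = transpose (jac \<phi> \<psi> (snd \<phi> x)) **
      metric_of_submetric A h \<psi> (snd \<psi> x) ** jac \<phi> \<psi> (snd \<phi> x)"
    using unweighted_inverse_congruence[OF C.invertible_J invertible_coeffs[OF C.\<psi> C.z_image]]
      C.y_image C.z_image
    by (simp add: metric_of_submetric_eq C.\<phi> C.\<psi> coeffs_trans(1)[OF c] jet_scale_def
        C.J_def C.y_def C.z_def)
qed

text \<open>\<theta> and the density symbol carry the same inhomogeneous term
  \<open>jet_shift\<close>, which cancels in the difference.\<close>

lemma one_form_gauge:
  assumes "affine_connection A D"
  shows "one_form A (\<lambda>\<phi> y. \<theta> \<phi> y - density_symbol 1 (D \<phi>) y)"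
  unfolding one_form_def smooth_field_def zero_outside_def
proof (intro conjI ballI allI impI)
  show "\<theta> \<phi> y - density_symbol 1 (D \<phi>) y = 0" if "\<not> (\<phi> \<in> A \<and> y \<in> chart_image \<phi>)" for \<phi> y
  proof -
    \<comment> \<open>Off the charts the inverse of the zero matrix is unspecified, but the vector
      it is applied to vanishes.\<close>
    have "(\<chi> b. h \<phi> y (axis b 1, 0) (0, 1)) = 0" by (simp add: form_outside[OF that] vec_eq_iff)
    then have "\<theta> \<phi> y = 0" unfolding \<theta>_def by (simp only: matrix_vector_mult_0_right)
    then show ?thesis
      by (simp add: density_symbol_def affine_connection_outside[OF assms that] vec_eq_iff)
  qed
  show "smooth_on (chart_image \<phi>) (\<lambda>y. \<theta> \<phi> y - density_symbol 1 (D \<phi>) y)" if "\<phi> \<in> A" for \<phi>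
    by (intro smooth_on_diff open_chart_image smooth_coeffs smooth_density_symbol assms that)
  fix \<phi> \<psi> x assume *: "\<phi> \<in> A" "\<psi> \<in> A" "x \<in> fst \<phi> \<inter> fst \<psi>"
  then have c: "chart_change A \<phi> \<psi> x" by (intro chart_changeI) auto
  interpret C: chart_change A \<phi> \<psi> x by (rule c)
  show "\<theta> \<phi> (snd \<phi> x) - density_symbol 1 (D \<phi>) (snd \<phi> x) = transpose (jac \<phi> \<psi> (snd \<phi> x)) *v
      (\<theta> \<psi> (snd \<psi> x) - density_symbol 1 (D \<psi>) (snd \<psi> x))"
    using C.density_symbol_trans[OF assms]
    by (simp add: coeffs_trans(2)[OF c] C.J_def C.y_def C.z_def matrix_vector_linear
        del: transpose_matrix_vector)
qed

text \<open>The last conclusion gives \<open>h\<close> by g and D alone; as g determines D, it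
  carries injectivity.\<close>

lemma parallel_imp_einstein:
  assumes n: "2 \<le> CARD('n)" and conn: "connected (UNIV :: 'm set)"
    and p: "projective_structure A p" and par: "tractor_parallel A p h"
  defines "g \<equiv> metric_of_submetric A h"
  obtains D k where "D \<in> p" "levi_civita A g D"
    "\<And>\<phi> y. \<phi> \<in> A \<Longrightarrow> y \<in> chart_image \<phi> \<Longrightarrow> ricci (D \<phi>) y = k *\<^sub>R g \<phi> y"
    "\<And>\<phi> y. \<phi> \<in> A \<Longrightarrow> y \<in> chart_image \<phi> \<Longrightarrow>
      h \<phi> y = diag_form (weighted_inverse (g \<phi> y)) (density_symbol 1 (D \<phi>) y)
        (trace (weighted_inverse (g \<phi> y) ** transpose (schouten (D \<phi>) y)) / real CARD('n))"
proof -
  obtain D0 where D0: "p = projectively_related A `` {D0}" "torsion_free_connection A D0"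
    using p unfolding projective_structure_def quotient_def by blast
  then have aff0: "affine_connection A D0" unfolding torsion_free_connection_def by blast
  \<comment> \<open>The added 1-form moves the density symbol by exactly itself, from that of
    \<open>D0\<close> to \<theta>.\<close>
  define D where "D \<phi> y = D0 \<phi> y + change_term (\<theta> \<phi> y - density_symbol 1 (D0 \<phi>) y)" for \<phi> y
  have tf: "torsion_free_connection A D"
    unfolding D_def[abs_def] by (rule torsion_free_add_change_term[OF D0(2) one_form_gauge[OF aff0]])
  then have aff: "affine_connection A D" unfolding torsion_free_connection_def by blast
  have Dp: "D \<in> p"
    unfolding D0(1) using D0(2) tf one_form_gauge[OF aff0] D_def
    by (auto simp: projectively_related_iff)
  have \<delta>: "density_symbol 1 (D \<phi>) = \<theta> \<phi>" for \<phi>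
    unfolding D_def[abs_def] by (rule ext) (simp add: density_symbol_add_change_term)
  have comp: "partial a (\<zeta> \<phi>) y = (2 * density_symbol 1 (D \<phi>) y $ a) *\<^sub>R \<zeta> \<phi> y
      - D \<phi> y $ a ** \<zeta> \<phi> y - \<zeta> \<phi> y ** transpose (D \<phi> y $ a)"
    "\<zeta> \<phi> y *v schouten (D \<phi>) y $ a = \<tau> \<phi> y *\<^sub>R axis a 1"
    "partial a (\<tau> \<phi>) y = 2 * density_symbol 1 (D \<phi>) y $ a * \<tau> \<phi> y"
    if "\<phi> \<in> A" "y \<in> chart_image \<phi>" for \<phi> y a
  proof -
    have h: "h \<phi> z = diag_form (\<zeta> \<phi> z) (density_symbol 1 (D \<phi>) z) (\<tau> \<phi> z)"
      if "z \<in> chart_image \<phi>" for z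
      unfolding \<delta> by (rule form_eq[OF \<open>\<phi> \<in> A\<close> that])
    have P: "partial a (\<lambda>z. h \<phi> z (U z) (V z)) y =
        h \<phi> y (tractor_nabla (D \<phi>) a U y) (V y) + h \<phi> y (U y) (tractor_nabla (D \<phi>) a V y)"
      if "smooth_on (chart_image \<phi>) U" "smooth_on (chart_image \<phi>) V" for U V
      using par Dp \<open>\<phi> \<in> A\<close> \<open>y \<in> chart_image \<phi>\<close> that unfolding tractor_parallel_def by blast
    note sm = smooth_on_imp_differentiable[OF smooth_coeffs(1)[OF that(1)] that(2)]
      smooth_on_imp_differentiable[OF smooth_coeffs(3)[OF that(1)] that(2)]
    note prems = open_chart_image[OF that(1)] that(2) smooth_density_symbol[OF aff that(1)] sm
      transpose_coeffs[OF that]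
    note R = parallel_diag_form_components[where S = "chart_image \<phi>" and h = "h \<phi>"
        and \<zeta> = "\<zeta> \<phi>" and \<tau> = "\<tau> \<phi>" and \<Gamma> = "D \<phi>" and y = y and a = a]
    show "partial a (\<zeta> \<phi>) y = (2 * density_symbol 1 (D \<phi>) y $ a) *\<^sub>R \<zeta> \<phi> y
        - D \<phi> y $ a ** \<zeta> \<phi> y - \<zeta> \<phi> y ** transpose (D \<phi> y $ a)"
      by (rule R(1)[OF prems]) (erule h, erule (1) P)
    show "\<zeta> \<phi> y *v schouten (D \<phi>) y $ a = \<tau> \<phi> y *\<^sub>R axis a 1"
      by (rule R(2)[OF prems]) (erule h, erule (1) P)
    show "partial a (\<tau> \<phi>) y = 2 * density_symbol 1 (D \<phi>) y $ a * \<tau> \<phi> y"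
      by (rule R(3)[OF prems]) (erule h, erule (1) P)
  qed
  have d\<zeta>: "\<zeta> \<phi> differentiable (at y)" if "\<phi> \<in> A" "y \<in> chart_image \<phi>" for \<phi> y
    using smooth_on_imp_differentiable[OF smooth_coeffs(1)[OF that(1)] that(2)] .
  have d\<tau>: "\<tau> \<phi> differentiable (at y)" if "\<phi> \<in> A" "y \<in> chart_image \<phi>" for \<phi> y
    using smooth_on_imp_differentiable[OF smooth_coeffs(3)[OF that(1)] that(2)] .
  have dd: "(\<lambda>z. \<bar>det (\<zeta> \<phi> z)\<bar>) differentiable (at y)" if "\<phi> \<in> A" "y \<in> chart_image \<phi>" for \<phi> y
    using abs_det_powr_differentiable[OF d\<zeta>[OF that] invertible_coeffs[OF that], of 1] by simp
  have lc: "levi_civita A g D"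
    unfolding levi_civita_def nabla_metric_eq_0_iff
  proof (intro conjI ballI allI tf)
    fix \<phi> y a assume *: "\<phi> \<in> A" "y \<in> chart_image \<phi>"
    have "partial a (\<lambda>z. unweighted_inverse (\<zeta> \<phi> z)) y = partial a (g \<phi>) y"
    proof (rule partial_cong[OF open_chart_image[OF *(1)] *(2)])
      show "(\<lambda>z. unweighted_inverse (\<zeta> \<phi> z)) differentiable (at y)"
        unfolding unweighted_inverse_def
        by (intro matrix_inv_differentiable bounded_bilinear_differentiable[OF bounded_bilinear_scaleR]
            dd d\<zeta> * scalar_invertible invertible_coeffs)
          (use invertible_coeffs[OF *] in \<open>simp add: invertible_det_nz\<close>)
    qed (simp add: g_def metric_of_submetric_eq *)
    then show "partial a (g \<phi>) y = transpose (D \<phi> y $ a) ** g \<phi> y + g \<phi> y ** D \<phi> y $ a"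
      using partial_unweighted_inverse[OF d\<zeta>[OF *] invertible_coeffs[OF *] comp(1)[OF *]]
      by (simp add: g_def metric_of_submetric_eq *)
  qed
  \<comment> \<open>\<tau> has weight -2 and |det \<zeta>| weight 2, so the product is a function on
    M: the factor between P and g.\<close>
  define F where "F \<phi> y = \<tau> \<phi> y * \<bar>det (\<zeta> \<phi> y)\<bar>" for \<phi> y
  have inv: "F \<phi> (snd \<phi> x) = F \<psi> (snd \<psi> x)"
    if "\<phi> \<in> A" "\<psi> \<in> A" "x \<in> fst \<phi>" "x \<in> fst \<psi>" for \<phi> \<psi> x
  proof -
    have c: "chart_change A \<phi> \<psi> x" using that by (rule chart_changeI)
    interpret C: chart_change A \<phi> \<psi> x by (rule c)
    let ?c = "jet_scale \<phi> \<psi> C.y"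
    have cn: "?c ^ CARD('n) * ?c = \<bar>det C.J\<bar>"
      using powr_root_power[of "\<bar>det C.J\<bar>" "CARD('n)"] C.invertible_J
      by (simp add: jet_scale_def C.J_def[symmetric] invertible_det_nz mult.commute)
    have "\<bar>det (\<zeta> \<phi> C.y)\<bar> * ?c\<^sup>2 = \<bar>det (\<zeta> \<psi> C.z)\<bar>"
    proof -
      \<comment> \<open>The scalar contributes \<open>c^(2n)\<close> and the two Jacobians the
        inverse square of det J, which is \<open>c^(- 2n - 2)\<close>; together
        \<open>c^(- 2)\<close>.\<close>
      have "det (\<zeta> \<phi> C.y) = (?c\<^sup>2) ^ CARD('n) * (det (\<zeta> \<psi> C.z) / (det C.J)\<^sup>2)"
        using coeffs_trans(1)[OF c]
        by (simp add: C.y_def[symmetric] C.z_def[symmetric] C.J_def[symmetric] det_scaleR det_mul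
            det_matrix_inv C.invertible_J power2_eq_square)
      then have "\<bar>det (\<zeta> \<phi> C.y)\<bar> * ?c\<^sup>2 = (?c ^ CARD('n) * ?c)\<^sup>2 * (\<bar>det (\<zeta> \<psi> C.z)\<bar> / (det C.J)\<^sup>2)"
        by (simp add: abs_mult power_mult_distrib power_commutes power2_eq_square mult_ac)
      then show ?thesis
        using C.invertible_J unfolding cn by (simp add: invertible_det_nz)
    qed
    then show ?thesis
      using coeffs_trans(3)[OF c] by (simp add: F_def C.y_def C.z_def mult_ac)
  qed
  \<comment> \<open>The logarithmic derivatives 2\<delta> of \<tau> and -2\<delta> of |det \<zeta>|
    cancel.\<close>
  have F0: "partial a (F \<phi>) y = 0" and dF: "F \<phi> differentiable (at y)"
    if "\<phi> \<in> A" "y \<in> chart_image \<phi>" for \<phi> y a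
    using partial_abs_det_weighted[OF d\<zeta>[OF that] invertible_coeffs[OF that] comp(1)[OF that]]
    unfolding F_def[abs_def]
    by (simp_all add: partial_mult[OF d\<tau>[OF that] dd[OF that]] comp(3)[OF that]
        differentiable_mult d\<tau>[OF that] dd[OF that])
  \<comment> \<open>A choice of chart at each point turns the family \<open>F\<close> into one
    function on M; by \<open>inv\<close> its values do not depend on the choice.\<close>
  define pick where "pick x = (SOME \<phi>. \<phi> \<in> A \<and> x \<in> fst \<phi>)" for x
  have pick: "pick x \<in> A" "x \<in> fst (pick x)" for x
    using someI_ex[of "\<lambda>\<phi>. \<phi> \<in> A \<and> x \<in> fst \<phi>"] ex_chart unfolding pick_def by blast+
  have "\<exists>k. \<forall>x. F (pick x) (snd (pick x) x) = k"
    by (rule locally_constant_if_partial_eq_0[OF conn, of _ F]) (use inv pick dF F0 in blast)+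
  then obtain k where k: "\<And>x. F (pick x) (snd (pick x) x) = k" by blast
  have Fk: "F \<phi> y = k" if "\<phi> \<in> A" "y \<in> chart_image \<phi>" for \<phi> y
  proof -
    from that have "y \<in> snd \<phi> ` fst \<phi>" by (simp add: chart_image_def)
    then obtain x where "x \<in> fst \<phi>" "y = snd \<phi> x" by blast
    then show ?thesis using inv[OF that(1) pick(1)] pick(2) k by metis
  qed
  show thesis
  proof (rule that[OF Dp lc])
    fix \<phi> y assume *: "\<phi> \<in> A" "y \<in> chart_image \<phi>"
    have "schouten (D \<phi>) y = k *\<^sub>R g \<phi> y"
      using schouten_eq_of_weighted(1)[OF invertible_coeffs[OF *] comp(2)[OF *] transpose_coeffs[OF *]]
        Fk[OF *] by (simp add: F_def g_def metric_of_submetric_eq *)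
    moreover have "transpose (g \<phi> y) = g \<phi> y"
      using pseudo_metric_of_submetric * unfolding pseudo_metric_def g_def by blast
    \<comment> \<open>Here \<open>k\<close> is the factor of the Schouten tensor; the Einstein
      constant is n - 1 times as large.\<close>
    ultimately show "ricci (D \<phi>) y = ((real CARD('n) - 1) * k) *\<^sub>R g \<phi> y"
      using ricci_eq_scaleR_iff_schouten[OF n, of "g \<phi> y" "D \<phi>" y "(real CARD('n) - 1) * k"] n by simp
    show "h \<phi> y = diag_form (weighted_inverse (g \<phi> y)) (density_symbol 1 (D \<phi>) y)
        (trace (weighted_inverse (g \<phi> y) ** transpose (schouten (D \<phi>) y)) / real CARD('n))"
      using schouten_eq_of_weighted(2)[OF invertible_coeffs[OF *] comp(2)[OF *] transpose_coeffs[OF *]]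
        form_eq[OF *]
      by (simp add: g_def metric_of_submetric_eq * weighted_unweighted_inverse invertible_coeffs \<delta>)
  qed
qed

end

section \<open>From Einstein metrics to sub-metrics\<close>

locale einstein_gauge = atlas A for A :: "('m::topological_space, 'n::finite) chart set" +
  fixes g :: "('m, 'n) chart \<Rightarrow> real^'n \<Rightarrow> real^'n^'n" and D :: "('m, 'n) chart \<Rightarrow> 'n christoffel"
    and k :: real
  assumes dim: "2 \<le> CARD('n)" and metric: "pseudo_metric A g" and lc: "levi_civita A g D"
    and einstein: "\<And>\<phi> y. \<phi> \<in> A \<Longrightarrow> y \<in> chart_image \<phi> \<Longrightarrow> ricci (D \<phi>) y = k *\<^sub>R g \<phi> y"
begin

text \<open>The \<tau> forced by the mixed equation: P is k / (n - 1) times g, and \<zeta> is the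
  root of |det g| times the inverse of g.\<close>

definition scale :: "('m, 'n) chart \<Rightarrow> real^'n \<Rightarrow> real" where
  "scale \<phi> y = k / (real CARD('n) - 1) * \<bar>det (g \<phi> y)\<bar> powr (1 / (real CARD('n) + 1))"

definition einstein_form :: "('m, 'n) cotractor_form" where
  "einstein_form \<phi> y = (if \<phi> \<in> A \<and> y \<in> chart_image \<phi>
    then diag_form (weighted_inverse (g \<phi> y)) (density_symbol 1 (D \<phi>) y) (scale \<phi> y)
    else (\<lambda>_ _. 0))"

lemma affine: "affine_connection A D"
  using lc unfolding levi_civita_def torsion_free_connection_def by blast

lemma metric_at:
  assumes "\<phi> \<in> A" "y \<in> chart_image \<phi>"
  shows "transpose (g \<phi> y) = g \<phi> y" "invertible (g \<phi> y)"
  using metric assms unfolding pseudo_metric_def by blast+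

lemma smooth_metric: "\<phi> \<in> A \<Longrightarrow> smooth_on (chart_image \<phi>) (g \<phi>)"
  using metric unfolding pseudo_metric_def smooth_field_def by blast

lemma smooth_scale: "\<phi> \<in> A \<Longrightarrow> smooth_on (chart_image \<phi>) (scale \<phi>)"
  unfolding scale_def[abs_def]
  by (intro smooth_on_mult smooth_on_const smooth_on_abs_powr smooth_on_det smooth_metric
      open_chart_image) (use metric_at in \<open>auto simp: invertible_det_nz\<close>)

lemma smooth_weighted_inverse:
  "\<phi> \<in> A \<Longrightarrow> smooth_on (chart_image \<phi>) (\<lambda>y. weighted_inverse (g \<phi> y))"
  unfolding weighted_inverse_def
  by (intro smooth_on_bilinear[OF _ bounded_bilinear_scaleR] smooth_on_matrix_inv smooth_on_abs_powr
      smooth_on_det smooth_metric open_chart_image)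
    (use metric_at in \<open>auto simp: invertible_det_nz\<close>)

text \<open>Each coefficient obeys the law prescribed by \<open>diag_form_jet_trans\<close>; for the
  middle one this is \<open>density_symbol_trans\<close>.\<close>

lemma einstein_form_trans:
  assumes "chart_change A \<phi> \<psi> x"
  shows "einstein_form \<psi> (snd \<psi> x) (jet_trans \<phi> \<psi> (snd \<phi> x) U) (jet_trans \<phi> \<psi> (snd \<phi> x) V)
    = einstein_form \<phi> (snd \<phi> x) U V"
proof -
  interpret C: chart_change A \<phi> \<psi> x by fact
  have g: "g \<phi> C.y = transpose C.J ** g \<psi> C.z ** C.J"
    using metric C.\<phi> C.\<psi> C.x\<phi> C.x\<psi> unfolding pseudo_metric_def C.J_def C.y_def C.z_def by blast
  have i: "invertible (g \<psi> C.z)" using metric_at(2)[OF C.\<psi> C.z_image] .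
  have "weighted_inverse (g \<phi> C.y) = (jet_scale \<phi> \<psi> C.y)\<^sup>2 *\<^sub>R
      (matrix_inv C.J ** weighted_inverse (g \<psi> C.z) ** transpose (matrix_inv C.J))"
    unfolding g jet_scale_def C.J_def[symmetric]
    by (rule weighted_inverse_congruence[OF C.invertible_J i])
  moreover have "scale \<phi> C.y = (jet_scale \<phi> \<psi> C.y)\<^sup>2 * scale \<psi> C.z"
    unfolding scale_def g abs_det_congruence_powr by (simp add: jet_scale_def C.J_def)
  ultimately have "einstein_form \<psi> C.z (jet_trans \<phi> \<psi> C.y U) (jet_trans \<phi> \<psi> C.y V) = einstein_form \<phi> C.y U V"
    using C.\<phi> C.\<psi> C.y_image C.z_image
      diag_form_jet_trans[OF C.invertible_J[unfolded C.J_def], folded C.J_def]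
    by (simp add: einstein_form_def C.density_symbol_trans[OF affine] del: transpose_matrix_vector)
  then show ?thesis by (simp add: C.y_def C.z_def)
qed

lemma sub_metric_einstein_form: "sub_metric A einstein_form"
  unfolding sub_metric_def symmetric_cotractor_form_def zero_outside_def
proof (intro conjI ballI allI impI)
  show "einstein_form \<phi> y = (\<lambda>_ _. 0)" if "\<not> (\<phi> \<in> A \<and> y \<in> chart_image \<phi>)" for \<phi> y
    using that by (auto simp: einstein_form_def)
  show "smooth_on (chart_image \<phi>) (\<lambda>y. einstein_form \<phi> y U V)" if \<phi>: "\<phi> \<in> A" for \<phi> U V
  proof (rule smooth_on_cong[OF open_chart_image[OF \<phi>]])
    note o = open_chart_image[OF \<phi>]
    show "smooth_on (chart_image \<phi>)
        (\<lambda>y. diag_form (weighted_inverse (g \<phi> y)) (density_symbol 1 (D \<phi>) y) (scale \<phi> y) U V)"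
      unfolding diag_form_def
      by (intro smooth_on_add smooth_on_mult smooth_on_const smooth_on_bilinear[OF o bounded_bilinear_inner]
          smooth_on_bilinear[OF o bounded_bilinear_matrix_vector_mult]
          smooth_on_bilinear[OF o bounded_bilinear_scaleR]
          smooth_density_symbol[OF affine] smooth_weighted_inverse smooth_scale o \<phi>)
  qed (simp add: einstein_form_def \<phi>)
  fix \<phi> y assume *: "\<phi> \<in> A" "y \<in> chart_image \<phi>"
  let ?Z = "weighted_inverse (g \<phi> y)"
  have tr: "transpose ?Z = ?Z" by (simp add: transpose_weighted_inverse metric_at[OF *])
  have eq: "einstein_form \<phi> y = diag_form ?Z (density_symbol 1 (D \<phi>) y) (scale \<phi> y)"
    by (simp add: einstein_form_def *)
  show "bilinear (einstein_form \<phi> y)"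
    unfolding eq bilinear_def linear_iff diag_form_def
    by (simp add: matrix_vector_linear inner_add_left inner_add_right scaleR_add_left algebra_simps)
  show "einstein_form \<phi> y U V = einstein_form \<phi> y V U" for U V
    unfolding eq diag_form_def
    using inner_matrix_vector_transpose[of _ ?Z, unfolded tr] by (simp add: inner_commute mult_ac)
  show "\<mu> = 0" if "\<forall>\<nu>. einstein_form \<phi> y (\<mu>, 0) (\<nu>, 0) = 0" for \<mu>
  proof -
    \<comment> \<open>Testing with \<nu> = Z\<mu> and the symmetry of Z gives a Euclidean norm,
      which is definite whatever the signature of g.\<close>
    have "(?Z *v \<mu>) \<bullet> (?Z *v \<mu>) = 0"
      using that inner_matrix_vector_transpose[of \<mu> ?Z "?Z *v \<mu>"] by (simp add: eq diag_form_def tr)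
    then have "?Z *v \<mu> = ?Z *v 0" by simp
    then show ?thesis
      using inj_matrix_vector_mult[OF invertible_weighted_inverse[OF metric_at(2)[OF *]]] by (simp only: inj_eq)
  qed
next
  fix \<phi> \<psi> and \<sigma> \<tau> :: "real^'n \<Rightarrow> real" and x
  assume *: "\<phi> \<in> A" "\<psi> \<in> A" "x \<in> fst \<phi> \<inter> fst \<psi>"
    and s: "smooth_on (overlap \<phi> \<psi>) \<sigma>" "smooth_on (overlap \<phi> \<psi>) \<tau>"
  then have c: "chart_change A \<phi> \<psi> x" by (intro chart_changeI) auto
  interpret C: chart_change A \<phi> \<psi> x by (rule c)
  show "einstein_form \<psi> (snd \<psi> x) (jet1 (push_density 1 \<phi> \<psi> \<sigma>) (snd \<psi> x))
      (jet1 (push_density 1 \<phi> \<psi> \<tau>) (snd \<psi> x)) =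
    einstein_form \<phi> (snd \<phi> x) (jet1 \<sigma> (snd \<phi> x)) (jet1 \<tau> (snd \<phi> x))"
    using C.jet1_push_density[OF smooth_on_imp_differentiable[OF s(1) C.y_overlap]]
      C.jet1_push_density[OF smooth_on_imp_differentiable[OF s(2) C.y_overlap]]
      einstein_form_trans[OF c]
    by (simp add: C.y_def C.z_def)
qed

text \<open>The three components of the defect vanish separately: the first by metricity, the mixed
  one by the Einstein equation, the last because the root of |det g| has logarithmic derivative
  2\<delta> and \<open>k\<close> is constant.\<close>

lemma tractor_leibniz_einstein_form:
  assumes \<phi>: "\<phi> \<in> A" and y: "y \<in> chart_image \<phi>"
    and U: "smooth_on (chart_image \<phi>) U" and V: "smooth_on (chart_image \<phi>) V"
  shows "partial a (\<lambda>z. einstein_form \<phi> z (U z) (V z)) y =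
    einstein_form \<phi> y (tractor_nabla (D \<phi>) a U y) (V y) + einstein_form \<phi> y (U y) (tractor_nabla (D \<phi>) a V y)"
proof -
  note o = open_chart_image[OF \<phi>]
  note s\<delta> = smooth_density_symbol[OF affine \<phi>]
  let ?h = "\<lambda>z. diag_form (weighted_inverse (g \<phi> z)) (density_symbol 1 (D \<phi>) z) (scale \<phi> z)"
  have eq: "einstein_form \<phi> z = ?h z" if "z \<in> chart_image \<phi>" for z
    by (simp add: einstein_form_def \<phi> that)
  have dg: "g \<phi> differentiable (at y)"
    using smooth_on_imp_differentiable[OF smooth_metric[OF \<phi>] y] .
  have pg: "partial a (g \<phi>) y = transpose (D \<phi> y $ a) ** g \<phi> y + g \<phi> y ** D \<phi> y $ a"
    using lc \<phi> y unfolding levi_civita_def nabla_metric_eq_0_iff by blast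
  have i: "invertible (g \<phi> y)" by (rule metric_at(2)[OF \<phi> y])
  have p\<tau>: "partial a (scale \<phi>) y = 2 * density_symbol 1 (D \<phi>) y $ a * scale \<phi> y"
    unfolding scale_def[abs_def]
      partial_mult[OF differentiable_const abs_det_powr_differentiable[OF dg i]] partial_const
      partial_abs_det_root[where \<Gamma> = "D \<phi>", OF dg i pg] by simp
  have P: "schouten (D \<phi>) y = (k / (real CARD('n) - 1)) *\<^sub>R g \<phi> y"
    using einstein[OF \<phi> y] ricci_eq_scaleR_iff_schouten[OF dim metric_at(1)[OF \<phi> y]] by blast
  have "weighted_inverse (g \<phi> y) *v g \<phi> y $ a = \<bar>det (g \<phi> y)\<bar> powr (1 / (real CARD('n) + 1)) *\<^sub>R axis a 1"
  proof -
    have "g \<phi> y $ a = g \<phi> y *v axis a 1"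
      using transpose_eq_nth[OF metric_at(1)[OF \<phi> y]]
      by (simp add: matrix_vector_mult_basis column_def vec_eq_iff)
    then show ?thesis
      by (simp add: weighted_inverse_def matrix_vector_linear matrix_mult_linear matrix_vector_mul_assoc
          matrix_inv_left i)
  qed
  then have P': "weighted_inverse (g \<phi> y) *v schouten (D \<phi>) y $ a = scale \<phi> y *\<^sub>R axis a 1"
    by (simp add: P scale_def matrix_vector_linear)
  note sU = smooth_on_imp_differentiable[OF U y] and sV = smooth_on_imp_differentiable[OF V y]
  have sh: "smooth_on (chart_image \<phi>) (\<lambda>z. ?h z (U z) (V z))"
    unfolding diag_form_def
    by (intro smooth_on_add smooth_on_mult smooth_on_bilinear[OF o bounded_bilinear_inner]
        smooth_on_bilinear[OF o bounded_bilinear_matrix_vector_mult]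
        smooth_on_bilinear[OF o bounded_bilinear_scaleR]
        smooth_on_bounded_linear[OF o bounded_linear_fst] smooth_on_bounded_linear[OF o bounded_linear_snd]
        s\<delta> smooth_weighted_inverse smooth_scale U V o \<phi>)
  have "partial a (\<lambda>z. ?h z (U z) (V z)) y = partial a (\<lambda>z. einstein_form \<phi> z (U z) (V z)) y"
    by (rule partial_cong[OF o y smooth_on_imp_differentiable[OF sh y]]) (simp add: eq)
  moreover have "partial a (\<lambda>z. ?h z (U z) (V z)) y
      - (?h y (tractor_nabla (D \<phi>) a U y) (V y) + ?h y (U y) (tractor_nabla (D \<phi>) a V y)) = 0"
    using tractor_leibniz[OF sU sV smooth_on_imp_differentiable[OF s\<delta> y]
        smooth_on_imp_differentiable[OF smooth_weighted_inverse[OF \<phi>] y]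
        smooth_on_imp_differentiable[OF smooth_scale[OF \<phi>] y]
        transpose_weighted_inverse[OF i metric_at(1)[OF \<phi> y]]
        surjective_pairing surjective_pairing, of a]
    by (simp add: partial_weighted_inverse[where \<Gamma> = "D \<phi>", OF dg i pg] p\<tau> P')
  ultimately show ?thesis by (simp add: eq y)
qed

lemma tractor_parallel_einstein_form:
  assumes p: "projective_structure A p" and D: "D \<in> p"
  shows "tractor_parallel A p einstein_form"
  unfolding tractor_parallel_def
proof (intro ballI allI impI)
  fix D' \<phi> and U V :: "real^'n \<Rightarrow> 'n cotractor" and y a
  assume *: "D' \<in> p" "\<phi> \<in> A" "smooth_on (chart_image \<phi>) U" "smooth_on (chart_image \<phi>) V"
    "y \<in> chart_image \<phi>"
  have "tractor_nabla (D' \<phi>) a W y = tractor_nabla (D \<phi>) a W y" if "smooth_on (chart_image \<phi>) W" for W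
    by (rule tractor_nabla_projectively_invariant[OF dim p D *(1,2,5) smooth_on_imp_differentiable[OF that *(5)]])
  then show "partial a (\<lambda>z. einstein_form \<phi> z (U z) (V z)) y =
      einstein_form \<phi> y (tractor_nabla (D' \<phi>) a U y) (V y) + einstein_form \<phi> y (U y) (tractor_nabla (D' \<phi>) a V y)"
    using * tractor_leibniz_einstein_form by simp
qed

lemma metric_of_einstein_form: "metric_of_submetric A einstein_form = g"
proof (intro ext)
  fix \<phi> y
  show "metric_of_submetric A einstein_form \<phi> y = g \<phi> y"
  proof (cases "\<phi> \<in> A \<and> y \<in> chart_image \<phi>")
    case True
    then show ?thesis
      using unweighted_weighted_inverse[OF metric_at(2)[of \<phi> y]]
      by (simp add: metric_of_submetric_def einstein_form_def submetric_coeffs_diag_form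
          unweighted_inverse_def Let_def)
  next
    case False
    then have "g \<phi> y = 0"
      using metric unfolding pseudo_metric_def smooth_field_def zero_outside_def by blast
    with False show ?thesis by (auto simp: metric_of_submetric_def)
  qed
qed

end

theorem theorem3p1:
  fixes A :: "('m::{t2_space, second_countable_topology}, 'n::finite) chart set"
    and p :: "(('m, 'n) chart \<Rightarrow> 'n christoffel) set"
  assumes "2 \<le> CARD('n)"
    and "connected (UNIV :: 'm set)"
    and "smooth_atlas A"
    and "projective_structure A p"
  shows "bij_betw (metric_of_submetric A)
           {h. sub_metric A h \<and> tractor_parallel A p h}
           {g. einstein_metric A g \<and> (\<exists>D\<in>p. levi_civita A g D)}"
proof (rule bij_betwI')
  interpret atlas A by unfold_locales fact
  fix h assume "h \<in> {h. sub_metric A h \<and> tractor_parallel A p h}"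
  then have h: "sub_metric A h" "tractor_parallel A p h" by auto
  interpret H: submetric A h by unfold_locales fact
  obtain D k where D: "D \<in> p" "levi_civita A (metric_of_submetric A h) D"
    "\<And>\<phi> y. \<phi> \<in> A \<Longrightarrow> y \<in> chart_image \<phi> \<Longrightarrow> ricci (D \<phi>) y = k *\<^sub>R metric_of_submetric A h \<phi> y"
    "\<And>\<phi> y. \<phi> \<in> A \<Longrightarrow> y \<in> chart_image \<phi> \<Longrightarrow>
      h \<phi> y = diag_form (weighted_inverse (metric_of_submetric A h \<phi> y)) (density_symbol 1 (D \<phi>) y)
        (trace (weighted_inverse (metric_of_submetric A h \<phi> y) ** transpose (schouten (D \<phi>) y)) / real CARD('n))"
    by (rule H.parallel_imp_einstein[OF assms(1,2,4) h(2)]) (rule that)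
  show "metric_of_submetric A h \<in> {g. einstein_metric A g \<and> (\<exists>D\<in>p. levi_civita A g D)}"
    unfolding einstein_metric_def using H.pseudo_metric_of_submetric D(1-3) by blast
  fix h' assume "h' \<in> {h. sub_metric A h \<and> tractor_parallel A p h}"
  then have h': "sub_metric A h'" "tractor_parallel A p h'" by auto
  interpret H': submetric A h' by unfold_locales fact
  show "(metric_of_submetric A h = metric_of_submetric A h') = (h = h')"
  proof
    assume eq: "metric_of_submetric A h = metric_of_submetric A h'"
    obtain D' where D': "levi_civita A (metric_of_submetric A h') D'"
      "\<And>\<phi> y. \<phi> \<in> A \<Longrightarrow> y \<in> chart_image \<phi> \<Longrightarrow>
        h' \<phi> y = diag_form (weighted_inverse (metric_of_submetric A h' \<phi> y)) (density_symbol 1 (D' \<phi>) y)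
          (trace (weighted_inverse (metric_of_submetric A h' \<phi> y) ** transpose (schouten (D' \<phi>) y)) / real CARD('n))"
      by (rule H'.parallel_imp_einstein[OF assms(1,2,4) h'(2)]) (rule that)
    note D' = D'[folded eq]
    \<comment> \<open>Both adapted connections are Levi-Civita for the common metric; after this the
      two forms have the same explicit expression.\<close>
    have "D' = D"
      by (rule levi_civita_unique[OF H.pseudo_metric_of_submetric D'(1) D(2)])
    show "h = h'"
    proof (intro ext)
      fix \<phi> y
      have "h \<phi> y = h' \<phi> y"
        by (cases "\<phi> \<in> A \<and> y \<in> chart_image \<phi>")
          (simp_all add: D(4) D'(2) \<open>D' = D\<close> H.form_outside H'.form_outside)
      then show "h \<phi> y U V = h' \<phi> y U V" for U V by simp
    qed
  qed simp
next
  interpret atlas A by unfold_locales fact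
  fix g assume "g \<in> {g. einstein_metric A g \<and> (\<exists>D\<in>p. levi_civita A g D)}"
  then obtain D D' k where g: "pseudo_metric A g" "D \<in> p" "levi_civita A g D" "levi_civita A g D'"
    "\<forall>\<phi>\<in>A. \<forall>y\<in>chart_image \<phi>. ricci (D' \<phi>) y = k *\<^sub>R g \<phi> y"
    unfolding einstein_metric_def by blast
  \<comment> \<open>The Einstein condition brings its own Levi-Civita connection, a priori different
    from the one in \<open>p\<close>.\<close>
  have "D' = D" by (rule levi_civita_unique[OF g(1,4,3)])
  interpret G: einstein_gauge A g D k
    using assms(1) g \<open>D' = D\<close> by unfold_locales auto
  show "\<exists>h\<in>{h. sub_metric A h \<and> tractor_parallel A p h}. g = metric_of_submetric A h"
    using G.sub_metric_einstein_form G.tractor_parallel_einstein_form[OF assms(4) g(2)]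
      G.metric_of_einstein_form by (intro bexI[of _ G.einstein_form]) auto
qed

end
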